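(* For every integer $k \ge 2$ there exist a fixed $\epsilon > 0$ (not depending on $n$), a positive integer $l$, and an $l$-clause Achlioptas rule for random $k$-SAT such that, with probability $1-o(1)$ as $n \to \infty$, the formula generated by the rule after $(r_k(n) + \epsilon)\cdot n$ steps is satisfiable, where $r_k(n)$ is the satisfiability threshold of random $k$-SAT. For $k \ge 7$ one can take $l = 3$; for $3 \le k \le 6$ one can take $l = 5$; and for $k = 2$ one can take $l = 2$.
   Context: Variables and clauses: the Boolean variables are $x_1,\dots,x_n$, and all asymptotics are as $n\to\infty$ with $k$, $l$ fixed. A literal is a variable $x_i$ or its negation $\overline{x}_i$. A $k$-clause is a disjunction of $k$ literals on $k$ distinct variables, so there are $\binom{n}{k}2^k$ possible $k$-clauses. A formula is a conjunction of $k$-clauses; it is satisfiable if some truth assignment to the $n$ variables satisfies every clause. Numbers of steps or clauses such as $cn$ are understood up to integer rounding. Random $k$-SAT threshold: let $\Phi^{(k)}_{m}$ be the conjunction of $m$ independent uniformly random $k$-clauses. $r_k = r_k(n)$ denotes a threshold sequence (whose existence is a theorem of Friedgut), i.e. a sequence such that for every $\delta>0$, $\Pr[\Phi^{(k)}_{(r_k(n)+\delta)n}\text{ is satisfiable}] = o(1)$ and $\Pr[\Phi^{(k)}_{(r_k(n)-\delta)n}\text{ is satisfiable}] = 1-o(1)$. $l$-clause Achlioptas $k$-SAT process: begin at step $0$ with the empty formula $\Phi_0=\emptyset$. At each step $i\ge 1$, $l$ clauses are selected independently and uniformly at random, with replacement, from the $\binom{n}{k}2^k$ possible $k$-clauses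 (independently of previous steps). According to a fixed rule $R$, exactly one of the $l$ clauses, $\phi_i$, is chosen, and $\Phi_i=\Phi_{i-1}\wedge\phi_i$. The rule $R$ (an "$l$-clause Achlioptas rule") may depend on the $l$ clauses presented, the current formula $\Phi_{i-1}$, the entire history of presented clauses up to step $i$, and additional randomness, but not on clauses presented in subsequent steps; no efficiency is required of the rule. *)

theory Defs
  imports "HOL-Probability.Probability"
begin

text \<open>The literal \<open>(i, True)\<close> is the variable \<open>x\<^sub>i\<close>, and \<open>(i, False)\<close> is its negation.\<close>

type_synonym lit = "nat \<times> bool"
type_synonym clause = "lit set"
type_synonym formula = "clause list"

definition kclauses :: "nat \<Rightarrow> nat \<Rightarrow> clause set" where
  "kclauses n k = {C. C \<subseteq> {1..n} \<times> UNIV \<and> card C = k \<and> inj_on fst C}"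

definition satisfiable :: "formula \<Rightarrow> bool" where
  "satisfiable F \<longleftrightarrow> (\<exists>\<sigma> :: nat \<Rightarrow> bool. \<forall>C\<in>set F. \<exists>(i, b)\<in>C. \<sigma> i = b)"

lemma card_kclauses: "card (kclauses n k) = (n choose k) * 2 ^ k"
proof -
  define A where "A = (SIGMA S:{S. S \<subseteq> {1..n} \<and> card S = k}. Pow S)"
  define f :: "nat set \<times> nat set \<Rightarrow> clause" where "f = (\<lambda>(S, T). (\<lambda>i. (i, i \<in> T)) ` S)"
  define g :: "clause \<Rightarrow> nat set \<times> nat set" where "g = (\<lambda>C. (fst ` C, {i. (i, True) \<in> C}))"
  have "bij_betw f A (kclauses n k)"
  proof (rule bij_betw_byWitness[where f' = g])
    show "\<forall>a\<in>A. g (f a) = a"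
      by (force simp: A_def f_def g_def image_image)
    show "\<forall>C\<in>kclauses n k. f (g C) = C"
    proof
      fix C assume "C \<in> kclauses n k"
      then have inj: "inj_on fst C" by (simp add: kclauses_def)
      have "(i, (i, True) \<in> C) = (i, b)" if "(i, b) \<in> C" for i b
        using inj_onD[OF inj, of "(i, True)" "(i, False)"] that by (cases b) auto
      then have "(\<lambda>x. (fst x, (fst x, True) \<in> C)) ` C = id ` C"
        by (intro image_cong) auto
      then show "f (g C) = C" by (simp add: f_def g_def image_image)
    qed
    show "f ` A \<subseteq> kclauses n k"
      by (auto simp: A_def f_def kclauses_def inj_on_def card_image)
    show "g ` kclauses n k \<subseteq> A"
      by (force simp: A_def g_def kclauses_def card_image)
  qed
  then have "card (kclauses n k) = card A" by (simp add: bij_betw_same_card)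
  also have "\<dots> = (\<Sum>S\<in>{S. S \<subseteq> {1..n} \<and> card S = k}. card (Pow S))"
    unfolding A_def by (intro card_SigmaI) (auto intro: finite_subset)
  also have "\<dots> = (\<Sum>S\<in>{S. S \<subseteq> {1..n} \<and> card S = k}. 2 ^ k)"
    by (intro sum.cong) (auto simp: card_Pow finite_subset)
  also have "\<dots> = (n choose k) * 2 ^ k"
    by (simp add: n_subsets)
  finally show ?thesis .
qed

text \<open>
  For \<open>n < k\<close> there are no \<open>k\<close>-clauses and \<open>pmf_of_set (kclauses n k)\<close> is an unspecified
  distribution; the distributions below are used only in limits as \<open>n\<close> tends to infinity.
\<close>

definition random_formula :: "nat \<Rightarrow> nat \<Rightarrow> nat \<Rightarrow> formula pmf" where
  "random_formula k n m = replicate_pmf m (pmf_of_set (kclauses n k))"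

text \<open>
  Real numbers of clauses or steps are rounded down; negative numbers are replaced by zero.
\<close>

definition sat_threshold :: "nat \<Rightarrow> (nat \<Rightarrow> real) \<Rightarrow> bool" where
  "sat_threshold k r \<longleftrightarrow>
     (\<forall>\<delta>>0.
        (\<lambda>n. measure_pmf.prob (random_formula k n (nat \<lfloor>(r n + \<delta>) * real n\<rfloor>))
               {F. satisfiable F}) \<longlonglongrightarrow> 0 \<and>
        (\<lambda>n. measure_pmf.prob (random_formula k n (nat \<lfloor>(r n - \<delta>) * real n\<rfloor>))
               {F. satisfiable F}) \<longlonglongrightarrow> 1)"

text \<open>
  A history lists, for each completed step, the presented clauses and the index of the
  chosen one; it determines the current formula. A rule receives the number of variables,
  the history and the currently presented clauses, and returns the conditional distribution,
  given these data, of the index to be chosen. Additional randomness of the rule is thus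
  described by its conditional law; deterministic rules are those returning point masses.
\<close>

type_synonym history = "(clause list \<times> nat) list"
type_synonym choice_rule = "nat \<Rightarrow> history \<Rightarrow> clause list \<Rightarrow> nat pmf"

definition achlioptas_rule :: "nat \<Rightarrow> choice_rule \<Rightarrow> bool" where
  "achlioptas_rule l R \<longleftrightarrow>
     (\<forall>n h cs. length cs = l \<longrightarrow> set_pmf (R n h cs) \<subseteq> {..<l})"

primrec achlioptas_history ::
    "nat \<Rightarrow> nat \<Rightarrow> choice_rule \<Rightarrow> nat \<Rightarrow> nat \<Rightarrow> history pmf" where
  "achlioptas_history k l R n 0 = return_pmf []"
| "achlioptas_history k l R n (Suc i) =
     do {
       h \<leftarrow> achlioptas_history k l R n i;
       cs \<leftarrow> replicate_pmf l (pmf_of_set (kclauses n k));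
       j \<leftarrow> R n h cs;
       return_pmf (h @ [(cs, j)])
     }"

definition chosen_formula :: "history \<Rightarrow> formula" where
  "chosen_formula h = map (\<lambda>(cs, j). cs ! j) h"

definition achlioptas_formula ::
    "nat \<Rightarrow> nat \<Rightarrow> choice_rule \<Rightarrow> nat \<Rightarrow> nat \<Rightarrow> formula pmf" where
  "achlioptas_formula k l R n m = map_pmf chosen_formula (achlioptas_history k l R n m)"

end

theory Submission
  imports Defs "HOL-Real_Asymp.Real_Asymp"
begin

text \<open>
  The rule picks the presented clause with the largest number of positive literals, counted up
  to two. It ignores the history, so the chosen clauses are independent. Keeping two literals of
  every chosen clause, positive ones if possible, leaves a random 2-SAT formula in which purely
  negative clauses are rare. With \<open>\<alpha>\<close>, \<open>\<mu>\<close> and \<open>\<beta>\<close> the rates of clauses with two, one and no positive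
  literals, an implication chain grows per step by the largest eigenvalue \<open>\<mu> + sqrt (\<alpha> * \<beta>)\<close> of a
  2 by 2 matrix; while this is below 1, the expected number of bicycles, one of which occurs in
  every unsatisfiable 2-CNF, is \<open>O(1 / n)\<close>.

  For \<open>k \<ge> 3\<close> the crude first moment bound \<open>r\<^sub>k \<le> 2 ^ k\<close> (up to \<open>o(1)\<close>) is already far below the
  density the rule can bear. For \<open>k = 2\<close> it is not, and \<open>r\<^sub>2 < 1.12\<close> is needed. As \<open>r\<close> is assumed to
  be a threshold, it suffices that a formula with \<open>1.1 n\<close> clauses is unsatisfiable with
  probability bounded away from 0. This follows from the second moment of the number of closed
  bicycles (snakes) of logarithmic length: the clauses of a second snake lie in a fixed one or not, so
  the pair sum is an entry of a power of \<open>p J + B\<close>, where \<open>J\<close> is the all-ones matrix and \<open>B\<close> the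
  adjacency matrix of the implications of the fixed snake, whose walks hardly branch.
\<close>

subsection \<open>Occurrence of clauses in a random formula\<close>

text \<open>The obstacle is \<open>k = 2\<close>. With two choices at density c the rates are 7c/8,
  c/2 and c/8, so an implication chain grows by c(1/2 + sqrt(7)/8) per step and the rule bears
  densities up to about 1.2038, whereas counting satisfying assignments bounds the 2-SAT threshold
  only by log 2 / log(4/3), about 2.41. Snakes certify unsatisfiability already at density 1.1.
  Their length is logarithmic, but large enough for c^t to exceed 2n: a chain then has forgotten its
  origin, the entries of the t-th power of p J + B are at most a constant times c^t / 2n, as for B =
  0, and conditioning on one snake raises the expected number of others by at most a constant
  factor. The resulting probability 1 / 128000000 is tiny, but a sharp threshold turns any fixed
  positive bound into a bound on its location. Eigenvectors never appear: test vectors that satisfy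
  a matrix inequality replace them, so that all numerical conditions are rational.\<close>

lemma prob_bind_pmf:
  "measure_pmf.prob (bind_pmf p f) A = measure_pmf.expectation p (\<lambda>x. measure_pmf.prob (f x) A)"
proof -
  have "ennreal (measure_pmf.prob (bind_pmf p f) A) = (\<integral>\<^sup>+x. ennreal (measure_pmf.prob (f x) A) \<partial>measure_pmf p)"
    by (simp flip: measure_pmf.emeasure_eq_measure)
  also have "\<dots> = ennreal (measure_pmf.expectation p (\<lambda>x. measure_pmf.prob (f x) A))"
    by (intro nn_integral_eq_integral measure_pmf.integrable_const_bound[where B = 1]) auto
  finally show ?thesis
    by (subst (asm) ennreal_inj) (auto intro!: integral_nonneg_AE)
qed

lemma prob_replicate_pmf_Suc:
  "measure_pmf.prob (replicate_pmf (Suc m) p) A =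
     measure_pmf.expectation p (\<lambda>x. measure_pmf.prob (replicate_pmf m p) ((#) x -` A))"
  by (simp add: prob_bind_pmf flip: map_pmf_def)

text \<open>The process appends each chosen clause at the end, whereas \<open>replicate_pmf\<close>
  prepends; independence makes both orders agree.\<close>

lemma prob_replicate_pmf_Suc_commute:
  "replicate_pmf (Suc m) p = do {xs \<leftarrow> replicate_pmf m p; x \<leftarrow> p; return_pmf (xs @ [x])}"
  using replicate_pmf_distrib[of m 1 p]
  by (simp add: bind_assoc_pmf bind_return_pmf replicate_pmf_1 bind_map_pmf)

lemma map_replicate_pmf: "map_pmf (map f) (replicate_pmf m p) = replicate_pmf m (map_pmf f p)"
proof (induction m)
  case (Suc m)
  have "map_pmf (map f) (replicate_pmf (Suc m) p) =
      p \<bind> (\<lambda>x. map_pmf ((#) (f x)) (map_pmf (map f) (replicate_pmf m p)))"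
    by (simp add: map_bind_pmf pmf.map_comp o_def flip: map_pmf_def)
  also have "\<dots> = replicate_pmf (Suc m) (map_pmf f p)"
    unfolding Suc by (simp add: bind_map_pmf flip: map_pmf_def)
  finally show ?case .
qed simp

lemma prob_replicate_pmf_all:
  "measure_pmf.prob (replicate_pmf m p) {xs. set xs \<subseteq> A} = measure_pmf.prob p A ^ m"
proof (induction m)
  case (Suc m)
  have "(#) x -` {xs. set xs \<subseteq> A} = (if x \<in> A then {xs. set xs \<subseteq> A} else {})" for x
    by auto
  then have "measure_pmf.prob (replicate_pmf m p) ((#) x -` {xs. set xs \<subseteq> A}) =
      indicator A x * measure_pmf.prob p A ^ m" for x
    by (simp add: Suc)
  then show ?case unfolding prob_replicate_pmf_Suc by simp
qed simp

text \<open>Condition on the head of the list: if it lies outside \<open>S\<close>, the tail must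
  still cover \<open>S\<close>; if it is some \<open>C\<close> in \<open>S\<close>, the tail must
  cover only \<open>S - {C}\<close>. The upper and the lower bound below are both inductions on this
  recursion.\<close>

lemma prob_replicate_pmf_superset_Suc:
  assumes "finite S"
  shows "measure_pmf.prob (replicate_pmf (Suc m) p) {xs. S \<subseteq> set xs} =
    (1 - (\<Sum>C\<in>S. pmf p C)) * measure_pmf.prob (replicate_pmf m p) {xs. S \<subseteq> set xs} +
    (\<Sum>C\<in>S. pmf p C * measure_pmf.prob (replicate_pmf m p) {xs. S - {C} \<subseteq> set xs})"
proof -
  define P where "P = (\<lambda>S. measure_pmf.prob (replicate_pmf m p) {xs. S \<subseteq> set xs})"
  have "measure_pmf.prob (replicate_pmf m p) ((#) x -` {xs. S \<subseteq> set xs}) =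
      P S + (\<Sum>C\<in>S. indicator {C} x * (P (S - {C}) - P S))" for x
  proof -
    have "(#) x -` {xs. S \<subseteq> set xs} = {xs. S - {x} \<subseteq> set xs}" by auto
    then have "measure_pmf.prob (replicate_pmf m p) ((#) x -` {xs. S \<subseteq> set xs}) = P (S - {x})"
      by (simp add: P_def)
    also have "\<dots> = P S + (\<Sum>C\<in>S. if x = C then P (S - {x}) - P S else 0)"
      using assms by (simp add: sum.delta')
    also have "(\<Sum>C\<in>S. if x = C then P (S - {x}) - P S else 0) =
        (\<Sum>C\<in>S. indicator {C} x * (P (S - {C}) - P S))"
      by (intro sum.cong) auto
    finally show ?thesis .
  qed
  then have "measure_pmf.prob (replicate_pmf (Suc m) p) {xs. S \<subseteq> set xs} =
      measure_pmf.expectation p (\<lambda>x. P S + (\<Sum>C\<in>S. indicator {C} x * (P (S - {C}) - P S)))"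
    unfolding prob_replicate_pmf_Suc by (simp only:)
  also have "\<dots> = P S + (\<Sum>C\<in>S. pmf p C * (P (S - {C}) - P S))"
  proof -
    have int: "integrable (measure_pmf p) (\<lambda>x. indicator {C} x * (P (S - {C}) - P S))" for C
      by (intro integrable_mult_left measure_pmf.integrable_const_bound[where B = 1]) auto
    show ?thesis
      using int by (subst Bochner_Integration.integral_add)
        (auto simp: measure_pmf_single Bochner_Integration.integral_sum)
  qed
  also have "\<dots> = (1 - (\<Sum>C\<in>S. pmf p C)) * P S + (\<Sum>C\<in>S. pmf p C * P (S - {C}))"
    by (simp add: algebra_simps sum_subtractf sum_distrib_left)
  finally show ?thesis by (simp only: P_def)
qed

lemma prob_superset_0:
  "finite S \<Longrightarrow> measure_pmf.prob (replicate_pmf 0 p) {xs. S \<subseteq> set xs} = (if S = {} then 1 else 0)"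
  by simp

lemma sum_pmf_le_1: "finite S \<Longrightarrow> (\<Sum>C\<in>S. pmf p C) \<le> 1"
  by (simp flip: measure_measure_pmf_finite)

text \<open>In substance the union bound over the \<open>m ^ card S\<close> ways to place the
  elements of \<open>S\<close> in the list. The induction needs only the first two terms of the
  binomial expansion of \<open>(m + 1) ^ q\<close>.\<close>

lemma prob_replicate_pmf_superset_le:
  assumes "finite S"
  shows "measure_pmf.prob (replicate_pmf m p) {xs. S \<subseteq> set xs} \<le> (\<Prod>C\<in>S. real m * pmf p C)"
  using assms
proof (induction m arbitrary: S)
  case 0
  then show ?case by (cases "S = {}") (simp_all add: prob_superset_0)
next
  case (Suc m)
  define q where "q = card S"
  define pp where "pp = (\<Prod>C\<in>S. pmf p C)"
  have pi0: "pp \<ge> 0" by (simp add: pp_def prod_nonneg)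
  have prod: "(\<Prod>C\<in>S. real j * pmf p C) = real j ^ q * pp" for j
    by (simp add: prod.distrib q_def pp_def)
  have rem: "pmf p C * (\<Prod>D\<in>S - {C}. real m * pmf p D) = real m ^ (q - 1) * pp" if "C \<in> S" for C
    using that Suc.prems by (simp add: prod.distrib q_def pp_def prod.remove[of S C "pmf p"])
  have "measure_pmf.prob (replicate_pmf (Suc m) p) {xs. S \<subseteq> set xs} \<le>
      1 * (\<Prod>C\<in>S. real m * pmf p C) + (\<Sum>C\<in>S. pmf p C * (\<Prod>D\<in>S - {C}. real m * pmf p D))"
    unfolding prob_replicate_pmf_superset_Suc[OF Suc.prems]
    using Suc sum_pmf_le_1[OF Suc.prems]
    by (intro add_mono mult_mono sum_mono) (auto simp: sum_nonneg)
  also have "\<dots> = (real m ^ q + real q * real m ^ (q - 1)) * pp"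
    by (simp add: prod rem algebra_simps flip: q_def)
  also have "\<dots> \<le> real (Suc m) ^ q * pp"
  proof (intro mult_right_mono pi0)
    have "m ^ q + q * m ^ (q - 1) \<le> Suc m ^ q"
    proof (induction q)
      case (Suc q)
      have "m ^ Suc q + Suc q * m ^ q \<le> m ^ q * (m + 1) + q * m ^ (q - 1) * (m + 1)"
        by (cases q) (auto simp: algebra_simps)
      also have "\<dots> = (m ^ q + q * m ^ (q - 1)) * (m + 1)" by (simp add: algebra_simps)
      also have "\<dots> \<le> Suc m ^ q * (m + 1)" using Suc by (intro mult_right_mono) auto
      finally show ?case by (simp add: algebra_simps)
    qed simp
    then show "real m ^ q + real q * real m ^ (q - 1) \<le> real (Suc m) ^ q"
      by (metis of_nat_add of_nat_le_iff of_nat_mult of_nat_power)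
  qed
  finally show ?case by (simp only: prod)
qed

text \<open>The bound is the probability that every element of \<open>S\<close> occurs exactly once, up to the
  exponent \<open>m\<close> in place of \<open>m - card S\<close>.\<close>
lemma prob_replicate_pmf_superset_ge:
  assumes "finite K" "K \<noteq> {}" "S \<subseteq> K"
  shows "measure_pmf.prob (replicate_pmf m (pmf_of_set K)) {xs. S \<subseteq> set xs} \<ge>
     (\<Prod>i<card S. (real m - real i) / real (card K)) * (1 - real (card S) / real (card K)) ^ m"
  using assms(3)
proof (induction m arbitrary: S)
  case 0
  have fin: "finite S" using 0 assms finite_subset by blast
  show ?case
  proof (cases "S = {}")
    case False
    then have "(\<Prod>i<card S. (real 0 - real i) / real (card K)) = 0"
      using fin by (intro prod_zero) (auto simp: card_gt_0_iff)
    then show ?thesis by (metis measure_nonneg mult_zero_left)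
  qed simp
next
  case (Suc m)
  define N where "N = real (card K)"
  define q where "q = card S"
  \<comment> \<open>The falling factorial (m)_q divided by N^q; \<open>ffS\<close> below is its rule
    (m+1)_q = (m)_q + q (m)_(q-1).\<close>
  define ff where "ff = (\<lambda>m q. \<Prod>i<q. (real m - real i) / N)"
  have fin: "finite S" using Suc assms finite_subset by blast
  have N0: "N > 0" using assms by (simp add: N_def card_gt_0_iff)
  have qN: "real q \<le> N" unfolding q_def N_def using assms Suc.prems by (simp add: card_mono)
  have pmf: "pmf (pmf_of_set K) C = 1 / N" if "C \<in> S" for C
    using that Suc.prems assms by (auto simp: N_def)
  have IH2: "measure_pmf.prob (replicate_pmf m (pmf_of_set K)) {xs. S - {C} \<subseteq> set xs} \<ge>
      ff m (q - 1) * (1 - real q / N) ^ m" if "C \<in> S" for C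
  proof (cases "ff m (q - 1) \<ge> 0")
    case True
    have "ff m (q - 1) * (1 - real q / N) ^ m \<le> ff m (q - 1) * (1 - real (q - 1) / N) ^ m"
      using True qN N0 by (intro mult_left_mono power_mono) (auto simp: field_simps)
    also have "\<dots> \<le> measure_pmf.prob (replicate_pmf m (pmf_of_set K)) {xs. S - {C} \<subseteq> set xs}"
      using Suc.IH[of "S - {C}"] Suc.prems that fin by (auto simp: ff_def q_def N_def)
    finally show ?thesis .
  next
    case False
    then have "ff m (q - 1) * (1 - real q / N) ^ m \<le> 0"
      using qN N0 by (intro mult_nonpos_nonneg) (auto simp: field_simps)
    then show ?thesis using measure_nonneg order_trans by blast
  qed
  have ff0: "ff m 0 = 1" by (simp add: ff_def)
  have ffS: "ff (Suc m) q = ff m q + real q / N * ff m (q - 1)"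
  proof (cases q)
    case (Suc q')
    have "N * (\<Prod>i<Suc q'. (real (Suc m) - real i) / N) = (real m + 1) * ff m q'"
      unfolding prod.lessThan_Suc_shift using N0 by (simp add: ff_def)
    moreover have "N * ff m (Suc q') = (real m - real q') * ff m q'"
      using N0 by (simp add: ff_def)
    ultimately show ?thesis using N0 Suc by (simp add: ff_def field_simps)
  qed (simp add: ff_def)
  have e: "ff (Suc m) q * (1 - real q / N) ^ Suc m \<le>
      (1 - real q / N) * (ff m q * (1 - real q / N) ^ m) + real q / N * (ff m (q - 1) * (1 - real q / N) ^ m)"
  proof (cases "q = 0 \<or> ff m (q - 1) \<ge> 0")
    case True
    have "real q / N * ff m (q - 1) * (1 - real q / N) ^ m * (1 - real q / N)
        \<le> real q / N * ff m (q - 1) * (1 - real q / N) ^ m * 1"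
      using ff0 True qN N0 by (intro mult_left_mono mult_nonneg_nonneg) (auto simp: field_simps)
    moreover define A where "A = real q / N"
    ultimately show ?thesis unfolding ffS A_def[symmetric] by (simp add: algebra_simps)
  next
    case False
    \<comment> \<open>This case is void: for \<open>q - 1 > m\<close> the product contains the
      factor with \<open>i = m\<close>, which is 0.\<close>
    have "ff m (q - 1) \<ge> 0"
    proof (cases "q - 1 \<le> m")
      case True
      then have "(real m - real i) / N \<ge> 0" if "i < q - 1" for i using N0 that by simp
      then show ?thesis unfolding ff_def by (intro prod_nonneg) auto
    next
      case False
      then have "ff m (q - 1) = 0" unfolding ff_def by (intro prod_zero) (auto intro!: bexI[of _ m])
      then show ?thesis by simp
    qed
    with False show ?thesis by simp
  qed
  also have "\<dots> \<le> (1 - (\<Sum>C\<in>S. pmf (pmf_of_set K) C)) * measure_pmf.prob (replicate_pmf m (pmf_of_set K)) {xs. S \<subseteq> set xs}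
      + (\<Sum>C\<in>S. pmf (pmf_of_set K) C * measure_pmf.prob (replicate_pmf m (pmf_of_set K)) {xs. S - {C} \<subseteq> set xs})"
  proof (rule add_mono)
    show "(1 - real q / N) * (ff m q * (1 - real q / N) ^ m) \<le>
        (1 - (\<Sum>C\<in>S. pmf (pmf_of_set K) C)) * measure_pmf.prob (replicate_pmf m (pmf_of_set K)) {xs. S \<subseteq> set xs}"
    proof -
      have "(\<Sum>C\<in>S. pmf (pmf_of_set K) C) = real q / N" using pmf by (simp add: q_def)
      moreover have "1 - real q / N \<ge> 0" using qN N0 by simp
      ultimately show ?thesis
        using mult_left_mono[OF Suc.IH[OF Suc.prems]] by (simp only: ff_def N_def q_def)
    qed
    have "real q / N * (ff m (q - 1) * (1 - real q / N) ^ m) = (\<Sum>C\<in>S. 1 / N * (ff m (q - 1) * (1 - real q / N) ^ m))"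
      by (simp add: q_def)
    also have "\<dots> \<le> (\<Sum>C\<in>S. pmf (pmf_of_set K) C * measure_pmf.prob (replicate_pmf m (pmf_of_set K)) {xs. S - {C} \<subseteq> set xs})"
      using IH2 pmf N0 by (intro sum_mono) (auto intro!: divide_right_mono)
    finally show "real q / N * (ff m (q - 1) * (1 - real q / N) ^ m) \<le> \<dots>" .
  qed
  also have "\<dots> = measure_pmf.prob (replicate_pmf (Suc m) (pmf_of_set K)) {xs. S \<subseteq> set xs}"
    by (rule prob_replicate_pmf_superset_Suc[OF fin, symmetric])
  finally show ?case by (simp add: ff_def N_def q_def)
qed

subsection \<open>Unsatisfiable 2-SAT formulas contain bicycles\<close>

definition neg :: "lit \<Rightarrow> lit" where "neg u = (fst u, \<not> snd u)"

lemma neg_neg [simp]: "neg (neg u) = u" by (simp add: neg_def)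
lemma fst_neg [simp]: "fst (neg u) = fst u" by (simp add: neg_def)
lemma snd_neg [simp]: "snd (neg u) = (\<not> snd u)" by (simp add: neg_def)
lemma neg_neq [simp]: "neg u \<noteq> u" "u \<noteq> neg u" by (auto simp: neg_def prod_eq_iff)
lemma neg_eq_iff [simp]: "neg u = neg v \<longleftrightarrow> u = v" by (auto simp: neg_def prod_eq_iff)
lemma neg_eq_swap: "neg u = v \<longleftrightarrow> u = neg v" by (auto simp: neg_def prod_eq_iff)
lemma same_var_cases: "fst u = fst v \<Longrightarrow> u = v \<or> u = neg v" by (auto simp: neg_def prod_eq_iff)
lemma comp_fst_neg [simp]: "fst \<circ> neg = fst" by auto

definition lits :: "nat \<Rightarrow> lit set" where "lits n = {1..n} \<times> UNIV"

lemma finite_lits [simp]: "finite (lits n)" by (simp add: lits_def)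
lemma card_lits [simp]: "card (lits n) = 2 * n" by (simp add: lits_def)
lemma neg_in_lits [simp]: "neg u \<in> lits n \<longleftrightarrow> u \<in> lits n" by (simp add: lits_def neg_def mem_Times_iff)

lemma kclauses_2: "kclauses n 2 = {{u, v} |u v. u \<in> lits n \<and> v \<in> lits n \<and> fst u \<noteq> fst v}"
proof (intro equalityI subsetI)
  fix C assume C: "C \<in> kclauses n 2"
  then obtain u v where "C = {u, v}" "u \<noteq> v" by (auto simp: kclauses_def card_2_iff)
  moreover from this C have "fst u \<noteq> fst v" "u \<in> lits n" "v \<in> lits n"
    by (simp_all add: kclauses_def lits_def)
  ultimately show "C \<in> {{u, v} |u v. u \<in> lits n \<and> v \<in> lits n \<and> fst u \<noteq> fst v}" by blast
next
  fix C assume "C \<in> {{u, v} |u v. u \<in> lits n \<and> v \<in> lits n \<and> fst u \<noteq> fst v}"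
  then obtain u v where "C = {u, v}" "u \<in> lits n" "v \<in> lits n" "fst u \<noteq> fst v" by blast
  moreover from this have "u \<noteq> v" by auto
  ultimately show "C \<in> kclauses n 2" by (simp add: kclauses_def lits_def)
qed

lemma pair_in_kclauses_2:
  "{u, v} \<in> kclauses n 2 \<longleftrightarrow> u \<in> lits n \<and> v \<in> lits n \<and> fst u \<noteq> fst v"
  unfolding kclauses_2 mem_Collect_eq doubleton_eq_iff by metis

lemma finite_kclauses [simp]: "finite (kclauses n k)"
  by (rule finite_subset[of _ "Pow (lits n)"]) (auto simp: kclauses_def lits_def)

section \<open>The implication digraph of a 2-CNF and its contradictory cycles\<close>

definition imp_arcs :: "clause set \<Rightarrow> (lit \<times> lit) set" where
  "imp_arcs G = {(u, v). {neg u, v} \<in> G}"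

lemma imp_arcs_contrapos: "(u, v) \<in> imp_arcs G \<longleftrightarrow> (neg v, neg u) \<in> imp_arcs G"
  by (simp add: imp_arcs_def insert_commute)

lemma imp_arcs_rtrancl_contrapos:
  assumes "(u, v) \<in> (imp_arcs G)\<^sup>*"
  shows "(neg v, neg u) \<in> (imp_arcs G)\<^sup>*"
  using assms by induction (use imp_arcs_contrapos in \<open>auto intro: converse_rtrancl_into_rtrancl\<close>)

lemma imp_arcs_in_lits: "G \<subseteq> kclauses n 2 \<Longrightarrow> (u, v) \<in> imp_arcs G \<Longrightarrow> u \<in> lits n \<and> v \<in> lits n"
  by (auto simp: imp_arcs_def pair_in_kclauses_2 dest!: subsetD)

lemma imp_arcs_rtrancl_in_lits:
  "(u, v) \<in> (imp_arcs G)\<^sup>* \<Longrightarrow> G \<subseteq> kclauses n 2 \<Longrightarrow> u \<in> lits n \<Longrightarrow> v \<in> lits n"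
  by (induction rule: rtrancl_induct) (auto dest: imp_arcs_in_lits)

text \<open>A maximal set \<open>A\<close> of literals that is closed under implication and free of
  complementary pairs decides every variable: otherwise an undecided literal that does not imply its
  own negation could be added together with everything it implies. Closedness then turns
  \<open>A\<close> into a satisfying assignment.\<close>

lemma unsat_contradiction_cycle:
  assumes F: "set F \<subseteq> kclauses n 2" and unsat: "\<not> satisfiable F"
  obtains (cycle) x where "x \<in> lits n" "(x, neg x) \<in> (imp_arcs (set F))\<^sup>*" "(neg x, x) \<in> (imp_arcs (set F))\<^sup>*"
proof (rule ccontr)
  assume *: "\<not> thesis"
  let ?R = "(imp_arcs (set F))\<^sup>*"
  have nocyc: "\<not> ((x, neg x) \<in> ?R \<and> (neg x, x) \<in> ?R)" if "x \<in> lits n" for x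
    using * cycle[OF that] by blast
  define Q where "Q = {A. A \<subseteq> lits n \<and> (\<forall>u\<in>A. \<forall>v. (u, v) \<in> imp_arcs (set F) \<longrightarrow> v \<in> A) \<and> (\<forall>u\<in>A. neg u \<notin> A)}"
  have "finite Q" by (rule finite_subset[of _ "Pow (lits n)"]) (auto simp: Q_def)
  moreover have "{} \<in> Q" by (simp add: Q_def)
  ultimately obtain A where A: "A \<in> Q" and max: "\<And>B. B \<in> Q \<Longrightarrow> A \<subseteq> B \<Longrightarrow> A = B"
    by (metis finite_has_maximal empty_iff)
  have closed: "v \<in> A" if "u \<in> A" "(u, v) \<in> ?R" for u v
    using that(2,1) A by (induction rule: rtrancl_induct) (auto simp: Q_def)
  have total: "u \<in> A \<or> neg u \<in> A" if u: "u \<in> lits n" for u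
  proof (rule ccontr)
    assume nA: "\<not> (u \<in> A \<or> neg u \<in> A)"
    obtain y where y: "y \<in> lits n" "y \<notin> A" "neg y \<notin> A" "(y, neg y) \<notin> ?R"
      using nocyc[OF u] u nA by (metis neg_in_lits neg_neg)
    define B where "B = A \<union> {z. (y, z) \<in> ?R}"
    have "B \<subseteq> lits n" using A imp_arcs_rtrancl_in_lits[OF _ F y(1)] unfolding B_def Q_def by blast
    moreover have "v \<in> B" if "u \<in> B" "(u, v) \<in> imp_arcs (set F)" for u v
      using that closed[of u v] unfolding B_def by (blast intro: rtrancl_into_rtrancl)
    moreover have "neg z \<notin> B" if "z \<in> B" for z
    proof
      assume nz: "neg z \<in> B"
      \<comment> \<open>If \<open>y\<close> reaches \<open>w\<close> and \<open>neg w\<close> is in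
        \<open>A\<close>, contraposition leads from \<open>neg w\<close> to \<open>neg y\<close>, so
        \<open>neg y\<close> would be in \<open>A\<close>. If \<open>y\<close> reaches both
        \<open>w\<close> and \<open>neg w\<close>, then it reaches \<open>neg y\<close> through
        \<open>w\<close>.\<close>
      have out: False if "(y, w) \<in> ?R" "neg w \<in> A" for w
        using closed[OF that(2)] imp_arcs_rtrancl_contrapos[OF that(1)] y by auto
      have out2: False if "(y, w) \<in> ?R" "(y, neg w) \<in> ?R" for w
        using that imp_arcs_rtrancl_contrapos[OF that(2)] y by (auto dest: rtrancl_trans)
      have no: "\<not> (z \<in> A \<and> neg z \<in> A)" using A unfolding Q_def by blast
      have "z \<in> A \<or> (y, z) \<in> ?R" "neg z \<in> A \<or> (y, neg z) \<in> ?R"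
        using that nz unfolding B_def by simp_all
      then show False using out[of z] out[of "neg z"] out2[of z] no by (metis neg_neg)
    qed
    ultimately have "B \<in> Q" by (auto simp: Q_def)
    then have "A = B" by (rule max) (auto simp: B_def)
    then show False using y by (auto simp: B_def)
  qed
  have "satisfiable F"
    unfolding satisfiable_def
  proof (intro exI[of _ "\<lambda>i. (i, True) \<in> A"] ballI)
    fix C assume C: "C \<in> set F"
    then obtain u v where uv: "C = {u, v}" "u \<in> lits n" "v \<in> lits n"
      using F by (auto simp: kclauses_2)
    have true: "\<exists>(i, b)\<in>C. ((i, True) \<in> A) = b" if "w \<in> A" "w \<in> C" for w
    proof (cases w)
      case (Pair i b)
      have "neg w \<notin> A" using that A by (auto simp: Q_def)
      then have "((i, True) \<in> A) = b" using that Pair by (cases b) (auto simp: neg_def)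
      then show ?thesis using that Pair by blast
    qed
    have "(neg u, v) \<in> imp_arcs (set F)" using C uv by (simp add: imp_arcs_def)
    then have "u \<in> A \<or> v \<in> A"
      using total[OF uv(2)] closed[of "neg u" v] by blast
    then show "\<exists>(i, b)\<in>C. ((i, True) \<in> A) = b" using true uv by blast
  qed
  with unsat show False by blast
qed

section \<open>Implication walks and bicycles as lists of literals\<close>

fun walk_clauses :: "lit list \<Rightarrow> clause list" where
  "walk_clauses (u # v # W) = {neg u, v} # walk_clauses (v # W)"
| "walk_clauses _ = []"

lemma length_walk_clauses: "length (walk_clauses W) = length W - 1"
  by (induction W rule: walk_clauses.induct) auto

lemma walk_clauses_nth: "Suc i < length W \<Longrightarrow> walk_clauses W ! i = {neg (W ! i), W ! Suc i}"
  by (induction W arbitrary: i rule: walk_clauses.induct) (auto simp: nth_Cons split: nat.splits)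

lemma walk_clauses_append:
  "walk_clauses (xs @ y # ys) = walk_clauses (xs @ [y]) @ walk_clauses (y # ys)"
  by (induction xs rule: walk_clauses.induct) auto

lemma walk_clauses_rev: "walk_clauses (rev (map neg W)) = rev (walk_clauses W)"
proof (induction W rule: walk_clauses.induct)
  case (1 u v W)
  then show ?case
    using walk_clauses_append[of "rev (map neg W)" "neg v" "[neg u]"]
    by (simp add: insert_commute)
qed auto

text \<open>There is one clause more than there are variables, which makes the expected number of
  order 1/n. The first literal is the negation of an entry of \<open>w\<close>: with
  \<open>w ! p\<close> itself in front, the first and the last clause could coincide, as on a plain
  cycle.\<close>

definition bicycle :: "lit list \<Rightarrow> nat \<Rightarrow> lit \<Rightarrow> clause list" where
  "bicycle w p v = walk_clauses (neg (w ! p) # w @ [v])"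

lemma length_bicycle [simp]: "length (bicycle w p v) = Suc (length w)"
  by (simp add: bicycle_def length_walk_clauses)

text \<open>For \<open>j > 0\<close> the clause with index \<open>j\<close> contains
  \<open>neg (w ! (j - 1))\<close>, and no earlier clause does. Distinctness lets the probability
  bound for a bicycle factor over its arcs.\<close>

lemma distinct_bicycle:
  assumes "distinct (map fst w)" "p < length w"
  shows "distinct (bicycle w p v)"
proof -
  let ?W = "neg (w ! p) # w @ [v]"
  have eq: "i = j" if "fst (w ! i) = fst (w ! j)" "i < length w" "j < length w" for i j
    using that assms(1) by (metis distinct_conv_nth length_map nth_map)
  have "False" if ij: "i < j" "j < Suc (length w)"
    and c: "{neg (?W ! i), ?W ! Suc i} = {neg (?W ! j), ?W ! Suc j}" for i j
  proof -
    obtain j' where j': "j = Suc j'" using ij by (cases j) auto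
    have Wj: "?W ! j = w ! j'" using ij j' by (simp add: nth_append)
    have Wi: "?W ! Suc i = w ! i" using ij by (simp add: nth_append)
    have "neg (w ! j') = neg (?W ! i) \<or> neg (w ! j') = w ! i"
      using c unfolding Wi Wj by (auto simp: doubleton_eq_iff)
    then show False
    proof
      assume "neg (w ! j') = neg (?W ! i)"
      then have e: "w ! j' = ?W ! i" by simp
      show False
      proof (cases i)
        case 0
        then have "w ! j' = neg (w ! p)" using e by simp
        then show False using eq[of j' p] assms(2) ij j' by (auto simp: )
      next
        case (Suc i')
        then show False using e eq[of j' i'] ij j' by (auto simp: nth_append)
      qed
    next
      assume n: "neg (w ! j') = w ! i"
      then have "fst (w ! j') = fst (w ! i)" by (metis fst_neg)
      then have "j' = i" using eq ij j' by auto
      then show False using n by simp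
    qed
  qed
  then have "bicycle w p v ! i \<noteq> bicycle w p v ! j" if "i < j" "j < length (bicycle w p v)" for i j
    using that by (auto simp: bicycle_def length_walk_clauses walk_clauses_nth simp del: nth_Cons_Suc)
  then show ?thesis
    by (simp add: distinct_conv_nth) (metis length_bicycle linorder_neqE_nat)
qed

lemma walk_clauses_in_lits:
  "set (walk_clauses us) \<subseteq> kclauses n 2 \<Longrightarrow> us \<noteq> [] \<Longrightarrow> hd us \<in> lits n \<Longrightarrow> set us \<subseteq> lits n"
  by (induction us rule: walk_clauses.induct) (auto simp: pair_in_kclauses_2)

lemma rtrancl_distinct_path:
  assumes "(x, y) \<in> (imp_arcs G)\<^sup>*"
  shows "\<exists>xs. distinct xs \<and> xs \<noteq> [] \<and> hd xs = x \<and> last xs = y \<and> set (walk_clauses xs) \<subseteq> G"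
  using assms
proof (induction rule: rtrancl_induct)
  case base
  show ?case by (intro exI[of _ "[x]"]) auto
next
  case (step y z)
  then obtain xs where xs: "distinct xs" "xs \<noteq> []" "hd xs = x" "last xs = y" "set (walk_clauses xs) \<subseteq> G"
    by blast
  show ?case
  proof (cases "z \<in> set xs")
    case True
    then obtain as bs where "xs = as @ z # bs" by (auto simp: in_set_conv_decomp)
    with xs show ?thesis
      by (intro exI[of _ "as @ [z]"]) (auto simp: hd_append walk_clauses_append[of as z bs])
  next
    case False
    have "xs = butlast xs @ [y]" using xs append_butlast_last_id by metis
    then have "walk_clauses (xs @ [z]) = walk_clauses xs @ [{neg y, z}]"
      by (metis append.assoc append_Cons append_Nil walk_clauses.simps walk_clauses_append)
    with xs False step(2) show ?thesis
      by (intro exI[of _ "xs @ [z]"]) (auto simp: imp_arcs_def)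
  qed
qed

text \<open>Append the literals of the path to \<open>w\<close> while their variables are new. The
  variable of \<open>target\<close> already occurs in \<open>w\<close>, so at the latest there some
  literal \<open>v\<close> on an old variable stops the process.\<close>

lemma extend_chain:
  assumes "(u, target) \<in> (imp_arcs G)\<^sup>+" "G \<subseteq> kclauses n 2"
    and "w \<noteq> []" "last w = u" "distinct (map fst w)" "fst target \<in> fst ` set w" "set w \<subseteq> lits n"
    "set (walk_clauses w) \<subseteq> G"
  shows "\<exists>e v. distinct (map fst (w @ e)) \<and> set (w @ e) \<subseteq> lits n \<and> fst v \<in> fst ` set (w @ e) \<and>
           set (walk_clauses (w @ e @ [v])) \<subseteq> G"
  using assms(1,3-)
proof (induction arbitrary: w rule: converse_trancl_induct)
  case (base u)
  then have "w = butlast w @ [u]" by (metis append_butlast_last_id)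
  then have "walk_clauses (w @ [target]) = walk_clauses w @ [{neg u, target}]"
    by (metis append.assoc append_Cons append_Nil walk_clauses.simps walk_clauses_append)
  with base show ?case
    by (intro exI[of _ "[]"] exI[of _ target]) (auto simp: imp_arcs_def)
next
  case (step u y)
  then have "w = butlast w @ [u]" by (metis append_butlast_last_id)
  then have wy: "walk_clauses (w @ [y]) = walk_clauses w @ [{neg u, y}]"
    by (metis append.assoc append_Cons append_Nil walk_clauses.simps walk_clauses_append)
  have G: "{neg u, y} \<in> G" using step(1) by (simp add: imp_arcs_def)
  show ?case
  proof (cases "fst y \<in> fst ` set w")
    case True
    with step wy G show ?thesis by (intro exI[of _ "[]"] exI[of _ y]) auto
  next
    case False
    have "\<exists>e v. distinct (map fst ((w @ [y]) @ e)) \<and> set ((w @ [y]) @ e) \<subseteq> lits n \<and>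
        fst v \<in> fst ` set ((w @ [y]) @ e) \<and> set (walk_clauses ((w @ [y]) @ e @ [v])) \<subseteq> G"
      using step False wy G imp_arcs_in_lits[OF assms(2) step(1)] by (intro step.IH) auto
    then obtain e v where "distinct (map fst ((w @ [y]) @ e)) \<and> set ((w @ [y]) @ e) \<subseteq> lits n \<and>
        fst v \<in> fst ` set ((w @ [y]) @ e) \<and> set (walk_clauses ((w @ [y]) @ e @ [v])) \<subseteq> G" by blast
    then show ?thesis by (intro exI[of _ "y # e"] exI[of _ v]) auto
  qed
qed

text \<open>A literal-repetition-free path from \<open>x\<close> to its negation, cut at the first repeated variable,
  ends in the negation of an earlier literal; reversed, it starts the bicycle. The path
  back to \<open>x\<close> closes its other end.\<close>
lemma unsat_bicycle:
  assumes F: "set F \<subseteq> kclauses n 2" and unsat: "\<not> satisfiable F"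
  obtains w p v where "distinct (map fst w)" "set w \<subseteq> lits n" "p < length w" "v \<in> lits n"
    "fst v \<in> fst ` set w" "set (bicycle w p v) \<subseteq> set F"
proof -
  obtain x where x: "x \<in> lits n" "(x, neg x) \<in> (imp_arcs (set F))\<^sup>*" "(neg x, x) \<in> (imp_arcs (set F))\<^sup>*"
    using unsat_contradiction_cycle[OF assms] .
  obtain xs where xs: "distinct xs" "xs \<noteq> []" "hd xs = x" "last xs = neg x" "set (walk_clauses xs) \<subseteq> set F"
    using rtrancl_distinct_path[OF x(2)] by blast
  have "\<not> distinct (map fst xs)"
  proof
    assume d: "distinct (map fst xs)"
    have "hd xs \<in> set xs" "last xs \<in> set xs" using xs(2) by auto
    moreover have "fst (hd xs) = fst (last xs)" using xs by simp
    ultimately have "hd xs = last xs" using d by (auto simp: distinct_map dest: inj_onD)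
    then show False using xs by simp
  qed
  then obtain as a bs where abs: "a \<in> set as" "distinct as" "map fst xs = as @ a # bs"
    by (auto simp: not_distinct_conv_prefix)
  then obtain zs y ys where zs: "xs = zs @ y # ys" "map fst zs = as" "fst y = a"
    by (auto simp: map_eq_append_conv map_eq_Cons_conv)
  have ne: "zs \<noteq> []" using abs zs by auto
  obtain z where z: "z \<in> set zs" "fst z = fst y" using abs zs by auto
  have yz: "y = neg z" using same_var_cases[of y z] z xs(1) zs by auto
  have hdz: "hd zs = x" using xs zs ne by simp
  have sub: "set (walk_clauses (zs @ [y])) \<subseteq> set F" using xs(5) by (simp add: zs walk_clauses_append[of zs y ys])
  define w where "w = rev (map neg zs)"
  have w: "distinct (map fst w)" "w \<noteq> []" "last w = neg x"
    using abs zs ne hdz by (auto simp: w_def last_rev hd_map simp flip: rev_map)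
  have wz: "walk_clauses (z # w) = rev (walk_clauses (zs @ [y]))"
    using yz by (simp add: w_def flip: walk_clauses_rev)
  then have swz: "set (walk_clauses (z # w)) \<subseteq> set F" using sub by simp
  have "set (walk_clauses w) \<subseteq> set (walk_clauses (z # w))" using w(2) by (cases w) auto
  then have sw: "set (walk_clauses w) \<subseteq> set F" using swz by blast
  have xl: "set xs \<subseteq> lits n" using walk_clauses_in_lits[of xs n] xs x F by auto
  then have wl: "set w \<subseteq> lits n" using zs by (auto simp: w_def)
  \<comment> \<open>\<open>w\<close> ends in \<open>neg x\<close>, so the second half of the
    contradiction, from \<open>neg x\<close> back to \<open>x\<close>, continues it until a variable
    repeats.\<close>
  have "(neg x, x) \<in> (imp_arcs (set F))\<^sup>+" using x(3) by (metis neg_neq(1) rtranclD)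
  moreover have "fst x \<in> fst ` set w" using w by (metis fst_neg image_eqI last_in_set)
  ultimately obtain e v where ev: "distinct (map fst (w @ e))" "set (w @ e) \<subseteq> lits n"
      "fst v \<in> fst ` set (w @ e)" "set (walk_clauses (w @ e @ [v])) \<subseteq> set F"
    using extend_chain[of "neg x" x "set F" n w] F w wl sw by blast
  have "neg z \<in> set w" using z by (auto simp: w_def)
  then obtain p where p: "p < length w" "w ! p = neg z" by (auto simp: in_set_conv_nth)
  obtain h t where ht: "w = h # t" using w(2) by (cases w) auto
  have "set (bicycle (w @ e) p v) \<subseteq> set F"
    using swz ev(4) p unfolding bicycle_def nth_append_left[OF p(1)] p(2) by (auto simp: ht)
  moreover have "v \<in> lits n" using ev(2,3) by (auto simp: lits_def mem_Times_iff)
  ultimately show thesis using that[of "w @ e" p v] ev p by auto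
qed

subsection \<open>First moment of bicycles\<close>

definition tuples :: "'a set \<Rightarrow> nat \<Rightarrow> 'a list set" where
  "tuples A j = {w. set w \<subseteq> A \<and> length w = j}"

lemma finite_tuples [simp]: "finite A \<Longrightarrow> finite (tuples A j)"
  by (simp add: tuples_def finite_lists_length_eq)

lemma tuples_0 [simp]: "tuples A 0 = {[]}" by (auto simp: tuples_def)

lemma sum_tuples_Suc: "(\<Sum>w\<in>tuples A (Suc j). f w) = (\<Sum>x\<in>A. \<Sum>w\<in>tuples A j. f (x # w))"
proof -
  have "(\<Sum>w\<in>tuples A (Suc j). f w) = (\<Sum>(x, w)\<in>A \<times> tuples A j. f (x # w))"
    by (rule sum.reindex_bij_witness[where i = "\<lambda>(x, w). x # w" and j = "\<lambda>w. (hd w, tl w)"])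
       (auto simp: tuples_def length_Suc_conv)
  then show ?thesis by (simp add: sum.cartesian_product)
qed

section \<open>Weighted sums over walks\<close>

fun walk_prod :: "('a \<Rightarrow> 'a \<Rightarrow> real) \<Rightarrow> 'a list \<Rightarrow> real" where
  "walk_prod f (u # v # W) = f u v * walk_prod f (v # W)"
| "walk_prod f _ = 1"

lemma walk_prod_append:
  "walk_prod f (xs @ y # ys) = walk_prod f (xs @ [y]) * walk_prod f (y # ys)"
  by (induction f xs rule: walk_prod.induct) auto

lemma walk_prod_nonneg: "(\<And>u v. f u v \<ge> 0) \<Longrightarrow> walk_prod f W \<ge> 0"
  by (induction f W rule: walk_prod.induct) auto

lemma prod_walk_clauses:
  "distinct (walk_clauses W) \<Longrightarrow> (\<Prod>C\<in>set (walk_clauses W). g C) = walk_prod (\<lambda>u v. g {neg u, v}) W"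
  by (induction W rule: walk_clauses.induct) auto

text \<open>\<open>h\<close> stands in for a Perron eigenvector: the inequality f h \<le> lam h is
  iterated along the walk, and h \<ge> 1 absorbs the free end point.\<close>

lemma sum_walk_prod_le:
  assumes "\<And>u v. f u v \<ge> 0" "\<And>u. u \<in> L \<Longrightarrow> (\<Sum>v\<in>L. f u v * h v) \<le> lam * h u" "\<And>u. h u \<ge> 1" "lam \<ge> 0" "u \<in> L"
  shows "(\<Sum>w\<in>tuples L j. walk_prod f (u # w)) \<le> lam ^ j * h u"
  using assms(5)
proof (induction j arbitrary: u)
  case 0
  then show ?case using assms(3)[of u] by simp
next
  case (Suc j)
  have "(\<Sum>w\<in>tuples L (Suc j). walk_prod f (u # w)) = (\<Sum>v\<in>L. f u v * (\<Sum>w\<in>tuples L j. walk_prod f (v # w)))"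
    by (simp add: sum_tuples_Suc sum_distrib_left)
  also have "\<dots> \<le> (\<Sum>v\<in>L. f u v * (lam ^ j * h v))"
    using Suc by (intro sum_mono mult_left_mono assms(1)) auto
  also have "\<dots> = lam ^ j * (\<Sum>v\<in>L. f u v * h v)" by (simp add: sum_distrib_left algebra_simps)
  also have "\<dots> \<le> lam ^ j * (lam * h u)"
    using assms(4) by (intro mult_left_mono assms(2) Suc) auto
  finally show ?case by (simp add: algebra_simps)
qed

lemma card_lits_on_vars: "card {v \<in> lits n. fst v \<in> fst ` set w} \<le> 2 * length w"
proof -
  have "{v \<in> lits n. fst v \<in> fst ` set w} \<subseteq> fst ` set w \<times> (UNIV :: bool set)" by force
  then have "card {v \<in> lits n. fst v \<in> fst ` set w} \<le> card (fst ` set w \<times> (UNIV :: bool set))"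
    by (intro card_mono) auto
  also have "\<dots> = 2 * card (fst ` set w)" by (simp add: card_cartesian_product)
  also have "card (fst ` set w) \<le> length w" using card_image_le[of "set w" fst] card_length[of w] by simp
  finally show ?thesis by simp
qed

lemma length_le_if_distinct_vars:
  assumes "distinct (map fst w)" "set w \<subseteq> lits n"
  shows "length w \<le> n"
proof -
  have "length w = card (fst ` set w)" using assms(1) distinct_card by fastforce
  also have "\<dots> \<le> card {1..n}" using assms(2) by (intro card_mono) (auto simp: lits_def)
  finally show ?thesis by simp
qed

text \<open>The square will count the choices of \<open>p\<close> and \<open>v\<close> in a bicycle
  on s + 1 literals, up to a factor 2.\<close>

lemma summable_square_powser:
  fixes x :: real
  assumes "0 \<le> x" "x < 1"
  shows "summable (\<lambda>s. real (Suc s) ^ 2 * x ^ s)"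
proof -
  have "(\<lambda>s. (real s + 2)\<^sup>2 / (real s + 1)\<^sup>2 * x) \<longlonglongrightarrow> 1 * x"
    by (intro tendsto_mult_right) real_asymp
  then have "\<forall>\<^sub>F s in sequentially. (real s + 2)\<^sup>2 / (real s + 1)\<^sup>2 * x < (1 + x) / 2"
    using assms by (intro order_tendstoD) auto
  then obtain N where N: "(real s + 2)\<^sup>2 / (real s + 1)\<^sup>2 * x < (1 + x) / 2" if "s \<ge> N" for s
    by (auto simp: eventually_sequentially)
  show ?thesis
  proof (rule summable_ratio_test[of "(1 + x) / 2" N])
    fix s assume "s \<ge> N"
    then have "(real s + 2)\<^sup>2 / (real s + 1)\<^sup>2 * x * ((real s + 1)\<^sup>2 * x ^ s) \<le> (1 + x) / 2 * ((real s + 1)\<^sup>2 * x ^ s)"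
      using N assms by (intro mult_right_mono) (auto intro: less_imp_le)
    then show "norm (real (Suc (Suc s)) ^ 2 * x ^ Suc s) \<le> (1 + x) / 2 * norm (real (Suc s) ^ 2 * x ^ s)"
      using assms by (simp add: abs_mult add.commute mult_ac)
  qed (use assms in auto)
qed

text \<open>Union bound over bicycles. The matrix \<open>b\<close>, indexed by the signs at the two
  ends of an arc, bounds the expected number of arcs from one literal to all literals of a given
  sign, and \<open>h\<close> is its test vector. All walks of s + 1 literals together weigh at most
  2n H lam^s; the two end clauses add G / (n - 1) each, and \<open>p\<close> and \<open>v\<close>
  have s + 1 and at most 2(s + 1) choices.\<close>

lemma prob_unsat_le:
  fixes q :: "clause pmf" and h :: "bool \<Rightarrow> real"
  assumes q: "set_pmf q \<subseteq> kclauses n 2" and n: "n \<ge> 2"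
    and b: "\<And>u v. u \<in> lits n \<Longrightarrow> v \<in> lits n \<Longrightarrow> fst u \<noteq> fst v \<Longrightarrow>
              real m * pmf q {neg u, v} \<le> b (snd u) (snd v) / (real n - 1)"
    and b0: "\<And>s t. b s t \<ge> 0" and G: "\<And>s t. b s t \<le> G"
    and h: "\<And>s. h s \<ge> 1" "\<And>s. h s \<le> H"
    and lam: "0 \<le> lam" "lam < 1" "\<And>s. b s True * h True + b s False * h False \<le> lam * h s"
  shows "measure_pmf.prob (replicate_pmf m q) {F. \<not> satisfiable F} \<le>
    (\<Sum>s. real (Suc s) ^ 2 * lam ^ s) * (4 * H * G\<^sup>2 * real n / (real n - 1)\<^sup>2)"
proof -
  define om where "om = (\<lambda>u v. real m * pmf q {neg u, v})"
  define V where "V = (\<lambda>w :: lit list. {v \<in> lits n. fst v \<in> fst ` set w})"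
  define P where "P = measure_pmf.prob (replicate_pmf m q)"
  define ev where "ev = (\<lambda>w p v. {F. set (bicycle w p v) \<subseteq> set F})"
  have G0: "G \<ge> 0" using b0 G order_trans by blast
  have H0: "H \<ge> 1" using h order_trans by blast
  have om0: "om u v \<ge> 0" for u v by (simp add: om_def)
  \<comment> \<open>Arcs within one variable have weight 0, so walks may run over all tuples, while
    a sum over \<open>lits n\<close> sees only the n - 1 other variables.\<close>
  have omzero: "om u v = 0" if "fst u = fst v" for u v
  proof -
    have "{neg u, v} \<notin> kclauses n 2" using that by (simp add: pair_in_kclauses_2)
    then show ?thesis using q by (auto simp: om_def set_pmf_iff)
  qed
  have omG: "om u v \<le> G / (real n - 1)" if "u \<in> lits n" "v \<in> lits n" for u v
  proof (cases "fst u = fst v")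
    case False
    have "om u v \<le> b (snd u) (snd v) / (real n - 1)" using b[OF that False] by (simp add: om_def)
    also have "\<dots> \<le> G / (real n - 1)" using n G by (intro divide_right_mono) auto
    finally show ?thesis .
  qed (use omzero n G0 in auto)
  have omsum: "(\<Sum>v\<in>lits n. om u v * h (snd v)) \<le> lam * h (snd u)" if u: "u \<in> lits n" for u
  proof -
    have "(\<Sum>v\<in>lits n. om u v * h (snd v)) =
        (\<Sum>v\<in>({1..n} - {fst u}) \<times> UNIV. om u v * h (snd v))"
      by (intro sum.mono_neutral_right) (auto simp: lits_def omzero mem_Times_iff)
    also have "\<dots> \<le> (\<Sum>v\<in>({1..n} - {fst u}) \<times> UNIV. b (snd u) (snd v) / (real n - 1) * h (snd v))"
      using u h(1) by (intro sum_mono mult_right_mono)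
        (auto simp: om_def lits_def intro!: b order_trans[OF _ h(1)] )
    also have "\<dots> = (\<Sum>i\<in>{1..n} - {fst u}. \<Sum>t\<in>UNIV. b (snd u) t / (real n - 1) * h t)"
      by (simp add: sum.cartesian_product')
    also have "\<dots> = (real n - 1) * (\<Sum>t\<in>UNIV. b (snd u) t / (real n - 1) * h t)"
      using u n by (auto simp: lits_def mem_Times_iff of_nat_diff)
    also have "\<dots> = b (snd u) True * h True + b (snd u) False * h False"
    proof -
      define N where "N = real n - 1"
      have "N \<noteq> 0" using n by (simp add: N_def)
      then show ?thesis by (simp add: UNIV_bool distrib_left flip: N_def)
    qed
    also have "\<dots> \<le> lam * h (snd u)" by (rule lam)
    finally show ?thesis .
  qed
  have walks: "(\<Sum>w\<in>tuples (lits n) (Suc j). walk_prod om w) \<le> 2 * real n * (lam ^ j * H)" for j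
  proof -
    have "(\<Sum>w\<in>tuples (lits n) (Suc j). walk_prod om w) =
        (\<Sum>u\<in>lits n. \<Sum>w\<in>tuples (lits n) j. walk_prod om (u # w))" by (rule sum_tuples_Suc)
    also have "\<dots> \<le> (\<Sum>u\<in>lits n. lam ^ j * H)"
    proof (rule sum_mono)
      fix u assume "u \<in> lits n"
      then have "(\<Sum>w\<in>tuples (lits n) j. walk_prod om (u # w)) \<le> lam ^ j * h (snd u)"
        using h omsum om0 lam by (intro sum_walk_prod_le) auto
      also have "\<dots> \<le> lam ^ j * H" using lam h by (intro mult_left_mono) auto
      finally show "(\<Sum>w\<in>tuples (lits n) j. walk_prod om (u # w)) \<le> lam ^ j * H" .
    qed
    finally show ?thesis by simp
  qed
  have one: "P (ev w p v) \<le> (G / (real n - 1))\<^sup>2 * walk_prod om w"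
    if w: "w \<in> tuples (lits n) s" "distinct (map fst w)" "p < s" "v \<in> V w" for w p v s
  proof -
    have len: "p < length w" "set w \<subseteq> lits n" using w by (auto simp: tuples_def)
    obtain a y where ay: "w = a @ [y]" using len by (cases w rule: rev_cases) auto
    obtain z c where zc: "w = z # c" using len by (cases w) auto
    have "P (ev w p v) \<le> (\<Prod>C\<in>set (bicycle w p v). real m * pmf q C)"
      unfolding P_def ev_def by (rule prob_replicate_pmf_superset_le) auto
    also have "\<dots> = walk_prod om (neg (w ! p) # w @ [v])"
      unfolding bicycle_def om_def
      by (rule prod_walk_clauses) (use distinct_bicycle[OF w(2) len(1)] in \<open>simp add: bicycle_def\<close>)
    also have "\<dots> = om (neg (w ! p)) z * (walk_prod om w * om y v)"
    proof -
      have "walk_prod om (neg (w ! p) # w @ [v]) = om (neg (w ! p)) z * walk_prod om (w @ [v])"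
        by (simp add: zc)
      also have "walk_prod om (w @ [v]) = walk_prod om w * om y v"
        using walk_prod_append[of om a y "[v]"] by (simp add: ay)
      finally show ?thesis .
    qed
    also have "\<dots> \<le> (G / (real n - 1)) * (walk_prod om w * (G / (real n - 1)))"
    proof (intro mult_mono omG order_refl mult_nonneg_nonneg walk_prod_nonneg om0)
      show "neg (w ! p) \<in> lits n" using len nth_mem[of p w] by (simp add: subset_eq del: nth_mem)
      have "z \<in> set w" by (simp add: zc)
      then show "z \<in> lits n" using len by blast
      have "y \<in> set w" by (simp add: ay)
      then show "y \<in> lits n" using len by blast
      show "v \<in> lits n" using w by (simp add: V_def)
      show "G / (real n - 1) \<ge> 0" using G0 n by simp
    qed
    finally show ?thesis by (simp add: power2_eq_square algebra_simps)
  qed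
  have summ: "summable (\<lambda>s. real (Suc s) ^ 2 * lam ^ s)"
    using lam by (intro summable_square_powser) auto
  have "P {F. \<not> satisfiable F} = P ({F. \<not> satisfiable F} \<inter> set_pmf (replicate_pmf m q))"
    unfolding P_def by (rule measure_Int_set_pmf[symmetric])
  also have "\<dots> \<le> P (\<Union>s\<in>{..<n}. \<Union>w\<in>{w \<in> tuples (lits n) (Suc s). distinct (map fst w)}.
      \<Union>(p, v)\<in>{..<Suc s} \<times> V w. ev w p v)"
    unfolding P_def
  proof (intro measure_pmf.finite_measure_mono subsetI)
    fix F assume F: "F \<in> {F. \<not> satisfiable F} \<inter> set_pmf (replicate_pmf m q)"
    then have Fk: "set F \<subseteq> kclauses n 2" and Fu: "\<not> satisfiable F"
      using q by (auto simp: set_replicate_pmf)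
    obtain w p v where w: "distinct (map fst w)" "set w \<subseteq> lits n" "p < length w" "v \<in> lits n"
        "fst v \<in> fst ` set w" "set (bicycle w p v) \<subseteq> set F"
      by (rule unsat_bicycle[OF Fk Fu])
    have "length w \<le> n" using length_le_if_distinct_vars w by blast
    moreover obtain s where "length w = Suc s" using w by (cases "length w") auto
    ultimately show "F \<in> (\<Union>s\<in>{..<n}. \<Union>w\<in>{w \<in> tuples (lits n) (Suc s). distinct (map fst w)}.
      \<Union>(p, v)\<in>{..<Suc s} \<times> V w. ev w p v)"
      using w by (intro UN_I[of s] UN_I[of w] UN_I[of "(p, v)"]) (auto simp: tuples_def V_def ev_def)
  qed auto
  also have "\<dots> \<le> (\<Sum>s<n. \<Sum>w\<in>{w \<in> tuples (lits n) (Suc s). distinct (map fst w)}.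
      \<Sum>(p, v)\<in>{..<Suc s} \<times> V w. P (ev w p v))"
    unfolding P_def
    by (intro order_trans[OF measure_UNION_le] sum_mono order_refl)
       (auto simp: V_def case_prod_beta intro!: order_trans[OF measure_UNION_le])
  also have "\<dots> \<le> (\<Sum>s<n. \<Sum>w\<in>tuples (lits n) (Suc s). 2 * real (Suc s) ^ 2 * ((G / (real n - 1))\<^sup>2 * walk_prod om w))"
  proof (intro sum_mono)
    fix s
    have "(\<Sum>(p, v)\<in>{..<Suc s} \<times> V w. P (ev w p v)) \<le> 2 * real (Suc s) ^ 2 * ((G / (real n - 1))\<^sup>2 * walk_prod om w)"
      if w: "w \<in> tuples (lits n) (Suc s)" "distinct (map fst w)" for w
    proof -
      have "(\<Sum>(p, v)\<in>{..<Suc s} \<times> V w. P (ev w p v)) \<le> (\<Sum>(p, v)\<in>{..<Suc s} \<times> V w. (G / (real n - 1))\<^sup>2 * walk_prod om w)"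
        using one[OF w] by (intro sum_mono) auto
      also have "\<dots> = real (Suc s) * real (card (V w)) * ((G / (real n - 1))\<^sup>2 * walk_prod om w)"
        by (simp add: card_cartesian_product algebra_simps)
      also have "\<dots> \<le> real (Suc s) * (2 * real (Suc s)) * ((G / (real n - 1))\<^sup>2 * walk_prod om w)"
      proof (intro mult_right_mono mult_left_mono mult_nonneg_nonneg walk_prod_nonneg om0)
        have "card (V w) \<le> 2 * Suc s" using card_lits_on_vars[of n w] w by (auto simp: V_def tuples_def)
        then show "real (card (V w)) \<le> 2 * real (Suc s)" by linarith
      qed auto
      finally show ?thesis by (simp add: power2_eq_square algebra_simps)
    qed
    then have "(\<Sum>w\<in>{w \<in> tuples (lits n) (Suc s). distinct (map fst w)}. \<Sum>(p, v)\<in>{..<Suc s} \<times> V w. P (ev w p v))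
       \<le> (\<Sum>w\<in>{w \<in> tuples (lits n) (Suc s). distinct (map fst w)}. 2 * real (Suc s) ^ 2 * ((G / (real n - 1))\<^sup>2 * walk_prod om w))"
      by (intro sum_mono) auto
    also have "\<dots> \<le> (\<Sum>w\<in>tuples (lits n) (Suc s). 2 * real (Suc s) ^ 2 * ((G / (real n - 1))\<^sup>2 * walk_prod om w))"
      by (intro sum_mono2 mult_nonneg_nonneg walk_prod_nonneg om0) auto
    finally show "(\<Sum>w\<in>{w \<in> tuples (lits n) (Suc s). distinct (map fst w)}. \<Sum>(p, v)\<in>{..<Suc s} \<times> V w. P (ev w p v)) \<le> \<dots>" .
  qed
  also have "\<dots> \<le> (\<Sum>s<n. 2 * real (Suc s) ^ 2 * ((G / (real n - 1))\<^sup>2 * (2 * real n * (lam ^ s * H))))"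
    unfolding sum_distrib_left[symmetric]
    by (intro sum_mono mult_left_mono walks) auto
  also have "\<dots> = (\<Sum>s<n. real (Suc s) ^ 2 * lam ^ s) * (4 * H * G\<^sup>2 * real n / (real n - 1)\<^sup>2)"
    unfolding sum_distrib_right by (intro sum.cong) (auto simp: power_divide)
  also have "\<dots> \<le> (\<Sum>s. real (Suc s) ^ 2 * lam ^ s) * (4 * H * G\<^sup>2 * real n / (real n - 1)\<^sup>2)"
    using H0 lam by (intro mult_right_mono sum_le_suminf summ) auto
  finally show ?thesis by (simp only: P_def)
qed

subsection \<open>A symmetric rule preferring positive literals\<close>

definition npos :: "clause \<Rightarrow> nat" where "npos C = card {x \<in> C. snd x}"

lemma card_kclauses_npos:
  "card {C \<in> kclauses n k. npos C = j} = (n choose k) * (k choose j)"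
proof -
  define A where "A = (SIGMA S:{S. S \<subseteq> {1..n} \<and> card S = k}. {T. T \<subseteq> S \<and> card T = j})"
  define f :: "nat set \<times> nat set \<Rightarrow> clause" where "f = (\<lambda>(S, T). (\<lambda>i. (i, i \<in> T)) ` S)"
  define g :: "clause \<Rightarrow> nat set \<times> nat set" where "g = (\<lambda>C. (fst ` C, fst ` {x \<in> C. snd x}))"
  have "bij_betw f A {C \<in> kclauses n k. npos C = j}"
  proof (rule bij_betw_byWitness[where f' = g])
    show "\<forall>a\<in>A. g (f a) = a"
      by (force simp: A_def f_def g_def image_image)
    show "\<forall>C\<in>{C \<in> kclauses n k. npos C = j}. f (g C) = C"
    proof
      fix C assume "C \<in> {C \<in> kclauses n k. npos C = j}"
      then have inj: "inj_on fst C" by (simp add: kclauses_def)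
      have "(fst x, fst x \<in> fst ` {x \<in> C. snd x}) = x" if "x \<in> C" for x
      proof -
        have "y = x" if "y \<in> C" "fst y = fst x" for y
          using inj_onD[OF inj that(2) that(1) \<open>x \<in> C\<close>] .
        then have "fst x \<in> fst ` {x \<in> C. snd x} \<longleftrightarrow> snd x"
          using \<open>x \<in> C\<close> unfolding image_iff by (metis (mono_tags, lifting) mem_Collect_eq)
        then show ?thesis by (simp add: prod_eq_iff)
      qed
      then have "(\<lambda>x. (fst x, fst x \<in> fst ` {x \<in> C. snd x})) ` C = id ` C"
        by (intro image_cong) auto
      then show "f (g C) = C" by (simp add: f_def g_def image_image)
    qed
    show "f ` A \<subseteq> {C \<in> kclauses n k. npos C = j}"
    proof (intro subsetI CollectI conjI; elim imageE)
      fix C a assume "a \<in> A" "C = f a"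
      moreover obtain S T where "a = (S, T)" by (cases a)
      ultimately have ST: "(S, T) \<in> A" and C: "C = f (S, T)" by auto
      have inj: "inj_on (\<lambda>i. (i, i \<in> T)) S" by (auto simp: inj_on_def)
      show "C \<in> kclauses n k"
        using ST inj unfolding C by (auto simp: A_def f_def kclauses_def inj_on_def card_image)
      have "{x \<in> f (S, T). snd x} = (\<lambda>i. (i, True)) ` T" using ST by (auto simp: A_def f_def)
      then show "npos C = j" using ST unfolding C by (simp add: npos_def A_def card_image inj_on_def)
    qed
    show "g ` {C \<in> kclauses n k. npos C = j} \<subseteq> A"
    proof (intro subsetI; elim imageE)
      fix a C assume "C \<in> {C \<in> kclauses n k. npos C = j}" and a: "a = g C"
      then have C: "C \<in> kclauses n k" "j = npos C" by auto
      then have "inj_on fst C" "inj_on fst {x \<in> C. snd x}"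
        by (auto simp: kclauses_def intro: inj_on_subset)
      then show "a \<in> A" using C unfolding a by (auto simp: A_def g_def kclauses_def card_image npos_def)
    qed
  qed
  then have "card {C \<in> kclauses n k. npos C = j} = card A" by (simp add: bij_betw_same_card)
  also have "\<dots> = (\<Sum>S\<in>{S. S \<subseteq> {1..n} \<and> card S = k}. card {T. T \<subseteq> S \<and> card T = j})"
  proof -
    have "finite {T. T \<subseteq> S \<and> card T = j}" if "S \<subseteq> {1..n}" for S
    proof (rule finite_subset[of _ "Pow S"])
      show "finite (Pow S)" using finite_subset[OF that] by simp
    qed auto
    then show ?thesis unfolding A_def by (intro card_SigmaI) auto
  qed
  also have "\<dots> = (\<Sum>S\<in>{S. S \<subseteq> {1..n} \<and> card S = k}. k choose j)"
    by (intro sum.cong) (auto simp: n_subsets finite_subset)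
  also have "\<dots> = (n choose k) * (k choose j)"
    by (simp add: n_subsets)
  finally show ?thesis .
qed

lemma kclauses_nonempty: "k \<le> n \<Longrightarrow> kclauses n k \<noteq> {}"
  using card_kclauses[of n k] by (metis card.empty mult_is_0 power_eq_0_iff zero_less_binomial_iff less_irrefl zero_neq_numeral)

lemma set_pmf_kclauses: "k \<le> n \<Longrightarrow> set_pmf (pmf_of_set (kclauses n k)) = kclauses n k"
  using kclauses_nonempty by (simp add: set_pmf_of_set)

lemma prob_npos:
  assumes "k \<le> n"
  shows "measure_pmf.prob (pmf_of_set (kclauses n k)) {C. npos C = j} = real (k choose j) / 2 ^ k"
proof -
  have "kclauses n k \<inter> {C. npos C = j} = {C \<in> kclauses n k. npos C = j}" by auto
  then show ?thesis
    using assms kclauses_nonempty[OF assms]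
    by (simp add: measure_pmf_of_set card_kclauses_npos card_kclauses)
qed

lemma prob_npos_le_1:
  assumes "k \<le> n"
  shows "measure_pmf.prob (pmf_of_set (kclauses n k)) {C. npos C \<le> 1} = (real k + 1) / 2 ^ k"
proof -
  have "{C. npos C \<le> 1} = {C. npos C = 0} \<union> {C. npos C = 1}" by auto
  then show ?thesis
    using prob_npos[OF assms, of 0] prob_npos[OF assms, of 1]
    by (simp only:) (subst measure_pmf.finite_measure_Union, auto simp: add_divide_distrib)
qed

text \<open>Capped at 2 because only two literals of the chosen clause are kept.\<close>

definition score :: "clause \<Rightarrow> nat" where "score C = min 2 (npos C)"

text \<open>Ties are broken by position and clauses enter only through their scores, so renaming
  variables does not change the index.\<close>

definition best :: "clause list \<Rightarrow> nat" where
  "best cs = (LEAST j. j < length cs \<and> (\<forall>C\<in>set cs. score C \<le> score (cs ! j)))"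

lemma best_works:
  assumes "cs \<noteq> []"
  shows "best cs < length cs" "\<forall>C\<in>set cs. score C \<le> score (cs ! best cs)"
proof -
  have "Max (score ` set cs) \<in> score ` set cs" using assms by (intro Max_in) auto
  then obtain C where C: "C \<in> set cs" "score C = Max (score ` set cs)" by auto
  then obtain j where "j < length cs" "cs ! j = C" by (auto simp: in_set_conv_nth)
  then have "j < length cs \<and> (\<forall>C\<in>set cs. score C \<le> score (cs ! j))" using C by auto
  then have "best cs < length cs \<and> (\<forall>C\<in>set cs. score C \<le> score (cs ! best cs))"
    unfolding best_def by (rule LeastI)
  then show "best cs < length cs" "\<forall>C\<in>set cs. score C \<le> score (cs ! best cs)" by auto
qed

definition best_rule :: choice_rule where "best_rule n h cs = return_pmf (best cs)"

lemma achlioptas_best_rule: "l > 0 \<Longrightarrow> achlioptas_rule l best_rule"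
  using best_works(1) by (force simp: achlioptas_rule_def best_rule_def)

definition best_clause :: "nat \<Rightarrow> nat \<Rightarrow> nat \<Rightarrow> clause pmf" where
  "best_clause k l n = map_pmf (\<lambda>cs. cs ! best cs) (replicate_pmf l (pmf_of_set (kclauses n k)))"

lemma achlioptas_formula_best_rule:
  "achlioptas_formula k l best_rule n m = replicate_pmf m (best_clause k l n)"
proof (induction m)
  case 0
  show ?case by (simp add: achlioptas_formula_def chosen_formula_def)
next
  case (Suc m)
  have "achlioptas_formula k l best_rule n (Suc m) =
      achlioptas_formula k l best_rule n m \<bind> (\<lambda>F. best_clause k l n \<bind> (\<lambda>C. return_pmf (F @ [C])))"
    by (simp add: achlioptas_formula_def best_clause_def best_rule_def map_bind_pmf bind_map_pmf
        bind_return_pmf chosen_formula_def)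
  then show ?case by (simp only: Suc prob_replicate_pmf_Suc_commute)
qed

lemma set_best_clause:
  assumes "k \<le> n" "l > 0"
  shows "set_pmf (best_clause k l n) \<subseteq> kclauses n k"
proof
  fix C assume "C \<in> set_pmf (best_clause k l n)"
  then obtain cs where cs: "set cs \<subseteq> kclauses n k" "length cs = l" "C = cs ! best cs"
    using assms by (auto simp: best_clause_def set_replicate_pmf set_pmf_kclauses)
  then have "C \<in> set cs" using best_works(1)[of cs] assms by (cases "cs = []") auto
  then show "C \<in> kclauses n k" using cs by auto
qed

lemma prob_best_clause_score_le:
  assumes "l > 0"
  shows "measure_pmf.prob (best_clause k l n) {C. score C \<le> j} =
         measure_pmf.prob (pmf_of_set (kclauses n k)) {C. score C \<le> j} ^ l"
proof -
  let ?M = "replicate_pmf l (pmf_of_set (kclauses n k))"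
  have iff: "score (cs ! best cs) \<le> j \<longleftrightarrow> set cs \<subseteq> {C. score C \<le> j}" if "cs \<in> set_pmf ?M" for cs
  proof -
    have "cs \<noteq> []" using that assms by (auto simp: set_replicate_pmf)
    note b = best_works[OF this]
    show ?thesis
    proof
      assume "score (cs ! best cs) \<le> j"
      then show "set cs \<subseteq> {C. score C \<le> j}" using b(2) by (auto dest: bspec)
    next
      assume "set cs \<subseteq> {C. score C \<le> j}"
      then show "score (cs ! best cs) \<le> j" using nth_mem[OF b(1)] by blast
    qed
  qed
  have "measure_pmf.prob (best_clause k l n) {C. score C \<le> j} =
      measure_pmf.prob ?M ({cs. score (cs ! best cs) \<le> j} \<inter> set_pmf ?M)"
    unfolding best_clause_def measure_map_pmf measure_Int_set_pmf by (simp add: vimage_def)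
  also have "{cs. score (cs ! best cs) \<le> j} \<inter> set_pmf ?M = {cs. set cs \<subseteq> {C. score C \<le> j}} \<inter> set_pmf ?M"
    using iff by auto
  also have "measure_pmf.prob ?M \<dots> = measure_pmf.prob (pmf_of_set (kclauses n k)) {C. score C \<le> j} ^ l"
    by (simp only: measure_Int_set_pmf prob_replicate_pmf_all)
  finally show ?thesis .
qed

text \<open>The law of the largest of \<open>l\<close> independent scores, as differences of l-th
  powers of the distribution function of one score, whose values at 0 and 1 are 1 / 2^k and (k + 1)
  / 2^k.\<close>

definition score_prob :: "nat \<Rightarrow> nat \<Rightarrow> nat \<Rightarrow> real" where
  "score_prob k l s =
     (if s = 0 then (1 / 2 ^ k) ^ l
      else if s = 1 then ((real k + 1) / 2 ^ k) ^ l - (1 / 2 ^ k) ^ l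
      else 1 - ((real k + 1) / 2 ^ k) ^ l)"

lemma prob_best_clause_score:
  assumes "k \<le> n" "l > 0" "s \<le> 2"
  shows "measure_pmf.prob (best_clause k l n) {C. score C = s} = score_prob k l s"
proof -
  let ?P = "\<lambda>A. measure_pmf.prob (best_clause k l n) A"
  have s0: "{C. score C \<le> 0} = {C. npos C = 0}" and s1: "{C. score C \<le> 1} = {C. npos C \<le> 1}"
    by (auto simp: score_def)
  have p0: "?P {C. score C \<le> 0} = (1 / 2 ^ k) ^ l"
    unfolding prob_best_clause_score_le[OF assms(2)] unfolding s0 prob_npos[OF assms(1)] by simp
  have p1: "?P {C. score C \<le> 1} = ((real k + 1) / 2 ^ k) ^ l"
    unfolding prob_best_clause_score_le[OF assms(2)] unfolding s1 prob_npos_le_1[OF assms(1)] by simp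
  consider "s = 0" | "s = 1" | "s = 2" using assms(3) by linarith
  then show ?thesis
  proof cases
    case 1
    then show ?thesis using p0 by (simp add: score_prob_def)
  next
    case 2
    have "{C. score C = 1} = {C. score C \<le> 1} - {C. score C \<le> 0}" by auto
    moreover have "?P ({C. score C \<le> 1} - {C. score C \<le> 0}) = ?P {C. score C \<le> 1} - ?P {C. score C \<le> 0}"
      by (intro measure_pmf.finite_measure_Diff) auto
    ultimately have "?P {C. score C = 1} = ?P {C. score C \<le> 1} - ?P {C. score C \<le> 0}" by (simp only:)
    then show ?thesis using 2 p0 p1 by (simp add: score_prob_def)
  next
    case 3
    have "{C. score C = 2} = UNIV - {C. score C \<le> 1}" by (auto simp: score_def)
    moreover have "?P (UNIV - {C. score C \<le> 1}) = ?P UNIV - ?P {C. score C \<le> 1}"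
      by (intro measure_pmf.finite_measure_Diff) auto
    ultimately have "?P {C. score C = 2} = 1 - ?P {C. score C \<le> 1}"
      by (simp only: measure_pmf.prob_space[unfolded space_measure_pmf])
    then show ?thesis using 3 p1 by (simp add: score_prob_def)
  qed
qed

section \<open>Passing to a random 2-clause inside the chosen clause\<close>

definition subpairs :: "clause \<Rightarrow> clause set" where
  "subpairs C = {D. D \<subseteq> C \<and> card D = 2 \<and> npos D = score C}"

lemma subpairs_nonempty:
  assumes "C \<in> kclauses n k" "k \<ge> 2"
  shows "subpairs C \<noteq> {}"
proof -
  have fin: "finite C" using assms by (auto simp: kclauses_def intro: card_ge_0_finite)
  have card: "card {x \<in> C. \<not> snd x} + npos C = k"
  proof -
    have "card C = card ({x \<in> C. \<not> snd x} \<union> {x \<in> C. snd x})" by (rule arg_cong[of _ _ card]) auto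
    also have "\<dots> = card {x \<in> C. \<not> snd x} + npos C"
      unfolding npos_def using fin by (intro card_Un_disjoint) auto
    finally show ?thesis using assms by (simp add: kclauses_def)
  qed
  obtain P where P: "P \<subseteq> {x \<in> C. snd x}" "card P = score C"
    using obtain_subset_with_card_n[of "score C" "{x \<in> C. snd x}"] by (auto simp: score_def npos_def)
  have "2 - score C \<le> card {x \<in> C. \<not> snd x}" using card assms(2) unfolding score_def by linarith
  then obtain N where N: "N \<subseteq> {x \<in> C. \<not> snd x}" "card N = 2 - score C"
    by (rule obtain_subset_with_card_n)
  have "finite P" "finite N" using P N fin by (auto intro: finite_subset)
  moreover have "P \<inter> N = {}" using P N by auto
  ultimately have "card (P \<union> N) = 2" using P N by (simp add: card_Un_disjoint score_def)
  moreover have "{x \<in> P \<union> N. snd x} = P" using P N by auto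
  ultimately have "P \<union> N \<in> subpairs C" using P N by (auto simp: subpairs_def npos_def)
  then show ?thesis by blast
qed

lemma finite_subpairs: "C \<in> kclauses n k \<Longrightarrow> k \<ge> 2 \<Longrightarrow> finite (subpairs C)"
  by (rule finite_subset[of _ "Pow C"]) (auto simp: subpairs_def kclauses_def intro: card_ge_0_finite)

lemma subpairs_kclauses: "C \<in> kclauses n k \<Longrightarrow> D \<in> subpairs C \<Longrightarrow> D \<in> kclauses n 2"
  by (auto simp: subpairs_def kclauses_def intro: inj_on_subset)

text \<open>A uniform choice among all admissible pairs, rather than a fixed one, keeps the law
  invariant under renaming of variables.\<close>

definition sub_clause :: "nat \<Rightarrow> nat \<Rightarrow> nat \<Rightarrow> clause pmf" where
  "sub_clause k l n = best_clause k l n \<bind> (\<lambda>C. pmf_of_set (subpairs C))"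

lemma set_sub_clause:
  assumes "2 \<le> k" "k \<le> n" "l > 0"
  shows "set_pmf (sub_clause k l n) \<subseteq> kclauses n 2"
  using set_best_clause[OF assms(2,3)] subpairs_nonempty[of _ n k] finite_subpairs[of _ n k] assms(1)
  by (auto simp: sub_clause_def intro!: subpairs_kclauses)

text \<open>\<open>J\<close> couples each chosen clause with a pair inside it; an assignment that
  satisfies all the pairs satisfies all the clauses.\<close>

lemma prob_unsat_best_clause_le:
  assumes "2 \<le> k" "k \<le> n" "l > 0"
  shows "measure_pmf.prob (replicate_pmf m (best_clause k l n)) {F. \<not> satisfiable F} \<le>
         measure_pmf.prob (replicate_pmf m (sub_clause k l n)) {F. \<not> satisfiable F}"
proof -
  define J where "J = best_clause k l n \<bind> (\<lambda>C. map_pmf (Pair C) (pmf_of_set (subpairs C)))"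
  have 1: "best_clause k l n = map_pmf fst J"
    by (simp add: J_def map_bind_pmf pmf.map_comp o_def bind_return_pmf')
  have 2: "sub_clause k l n = map_pmf snd J"
    by (simp add: J_def sub_clause_def map_bind_pmf pmf.map_comp o_def pmf.map_ident)
  have J: "D \<subseteq> C" if "(C, D) \<in> set_pmf J" for C D
  proof -
    have "C \<in> kclauses n k" "D \<in> set_pmf (pmf_of_set (subpairs C))"
      using that set_best_clause[OF assms(2,3)] by (auto simp: J_def)
    then have "D \<in> subpairs C" using subpairs_nonempty finite_subpairs assms(1) by simp
    then show ?thesis unfolding subpairs_def by blast
  qed
  have sat: "satisfiable (map fst xs)" if xs: "xs \<in> set_pmf (replicate_pmf m J)" "satisfiable (map snd xs)" for xs
  proof -
    obtain \<sigma> where \<sigma>: "\<forall>C\<in>set (map snd xs). \<exists>(i, b)\<in>C. \<sigma> i = b"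
      using xs(2) unfolding satisfiable_def by blast
    have "\<exists>(i, b)\<in>C. \<sigma> i = b" if "C \<in> set (map fst xs)" for C
    proof -
      obtain D where D: "(C, D) \<in> set xs" using \<open>C \<in> set (map fst xs)\<close> by auto
      then have "D \<subseteq> C" using xs(1) J by (auto simp: set_replicate_pmf)
      moreover have "\<exists>(i, b)\<in>D. \<sigma> i = b" using \<sigma> D by force
      ultimately show ?thesis by blast
    qed
    then show ?thesis unfolding satisfiable_def by blast
  qed
  have "measure_pmf.prob (replicate_pmf m (best_clause k l n)) {F. \<not> satisfiable F} =
      measure_pmf.prob (replicate_pmf m J) ({xs. \<not> satisfiable (map fst xs)} \<inter> set_pmf (replicate_pmf m J))"
    by (simp add: 1 measure_Int_set_pmf vimage_def flip: map_replicate_pmf)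
  also have "\<dots> \<le> measure_pmf.prob (replicate_pmf m J) {xs. \<not> satisfiable (map snd xs)}"
    using sat by (intro measure_pmf.finite_measure_mono) auto
  also have "\<dots> = measure_pmf.prob (replicate_pmf m (sub_clause k l n)) {F. \<not> satisfiable F}"
    by (simp add: 2 vimage_def flip: map_replicate_pmf)
  finally show ?thesis .
qed

lemma prob_sub_clause_npos:
  assumes "2 \<le> k" "k \<le> n" "l > 0" "s \<le> 2"
  shows "measure_pmf.prob (sub_clause k l n) {D. npos D = s} = score_prob k l s"
proof -
  have "measure_pmf.prob (sub_clause k l n) {D. npos D = s} =
     measure_pmf.expectation (best_clause k l n) (\<lambda>C. measure_pmf.prob (pmf_of_set (subpairs C)) {D. npos D = s})"
    by (simp add: sub_clause_def prob_bind_pmf)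
  also have "\<dots> = measure_pmf.expectation (best_clause k l n) (indicator {C. score C = s})"
  proof (intro integral_cong_AE AE_pmfI)
    fix C assume "C \<in> set_pmf (best_clause k l n)"
    then have C: "C \<in> kclauses n k" using set_best_clause[OF assms(2,3)] by auto
    have "measure_pmf.prob (pmf_of_set (subpairs C)) {D. npos D = s} = real (card (subpairs C \<inter> {D. npos D = s})) / card (subpairs C)"
      using subpairs_nonempty finite_subpairs C assms(1) by (simp add: measure_pmf_of_set)
    also have "subpairs C \<inter> {D. npos D = s} = (if score C = s then subpairs C else {})"
      by (auto simp: subpairs_def)
    finally show "measure_pmf.prob (pmf_of_set (subpairs C)) {D. npos D = s} = indicator {C. score C = s} C"
      using subpairs_nonempty finite_subpairs C assms(1) by (auto simp: card_eq_0_iff)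
  qed auto
  also have "\<dots> = score_prob k l s" using prob_best_clause_score[OF assms(2-4)] by simp
  finally show ?thesis .
qed

section \<open>Invariance under renaming of variables\<close>

definition rename :: "(nat \<Rightarrow> nat) \<Rightarrow> clause \<Rightarrow> clause" where
  "rename \<pi> C = map_prod \<pi> id ` C"

lemma inj_map_prod_id: "inj \<pi> \<Longrightarrow> inj (map_prod \<pi> (id :: bool \<Rightarrow> bool))"
  by (simp add: prod.inj_map)

lemma npos_rename: "inj \<pi> \<Longrightarrow> npos (rename \<pi> C) = npos C"
proof -
  assume "inj \<pi>"
  moreover have "{x \<in> rename \<pi> C. snd x} = map_prod \<pi> id ` {x \<in> C. snd x}"
    by (auto simp: rename_def)
  ultimately show ?thesis
    unfolding npos_def by (simp add: card_image inj_on_subset[OF inj_map_prod_id])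
qed

lemma score_rename: "inj \<pi> \<Longrightarrow> score (rename \<pi> C) = score C"
  by (simp add: score_def npos_rename)

lemma inj_rename: "inj \<pi> \<Longrightarrow> inj (rename \<pi>)"
  by (rule injI) (simp add: rename_def inj_image_eq_iff inj_map_prod_id)

lemma rename_mono: "C \<subseteq> D \<Longrightarrow> rename \<pi> C \<subseteq> rename \<pi> D"
  by (auto simp: rename_def)

lemma rename_kclauses:
  assumes "\<pi> permutes {1..n}" "C \<in> kclauses n k"
  shows "rename \<pi> C \<in> kclauses n k"
proof -
  have inj: "inj \<pi>" by (rule permutes_inj[OF assms(1)])
  show ?thesis
    unfolding kclauses_def
  proof (intro CollectI conjI)
    show "rename \<pi> C \<subseteq> {1..n} \<times> UNIV"
      using assms permutes_in_image[OF assms(1)] by (auto simp: rename_def kclauses_def)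
    show "card (rename \<pi> C) = k"
      using assms by (simp add: rename_def kclauses_def card_image inj_on_subset[OF inj_map_prod_id[OF inj]])
    show "inj_on fst (rename \<pi> C)"
    proof (rule inj_onI)
      fix x y assume xy: "x \<in> rename \<pi> C" "y \<in> rename \<pi> C" "fst x = fst y"
      then obtain a b where ab: "a \<in> C" "b \<in> C" "x = map_prod \<pi> id a" "y = map_prod \<pi> id b"
        by (auto simp: rename_def)
      then have "fst a = fst b" using xy inj by (simp add: inj_eq)
      then show "x = y" using assms(2) ab by (auto simp: kclauses_def dest: inj_onD)
    qed
  qed
qed

lemma bij_betw_rename_kclauses:
  assumes "\<pi> permutes {1..n}"
  shows "bij_betw (rename \<pi>) (kclauses n k) (kclauses n k)"
proof -
  have "inj_on (rename \<pi>) (kclauses n k)"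
    using inj_rename[OF permutes_inj[OF assms]] inj_on_subset by blast
  then show ?thesis
    using rename_kclauses[OF assms] finite_kclauses endo_inj_surj[of "kclauses n k" "rename \<pi>"]
    unfolding bij_betw_def by blast
qed

lemma best_map_rename: "inj \<pi> \<Longrightarrow> best (map (rename \<pi>) cs) = best cs"
  unfolding best_def by (rule arg_cong[of _ _ Least]) (auto simp: score_rename)

lemma map_rename_best_clause:
  assumes "\<pi> permutes {1..n}" "k \<le> n" "l > 0"
  shows "map_pmf (rename \<pi>) (best_clause k l n) = best_clause k l n"
proof -
  let ?U = "pmf_of_set (kclauses n k)"
  have inj: "inj \<pi>" by (rule permutes_inj[OF assms(1)])
  have U: "map_pmf (rename \<pi>) ?U = ?U"
    using map_pmf_of_set_bij_betw[OF bij_betw_rename_kclauses[OF assms(1)]] kclauses_nonempty[OF assms(2)]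
    by simp
  have "best_clause k l n = map_pmf (\<lambda>cs. cs ! best cs) (map_pmf (map (rename \<pi>)) (replicate_pmf l ?U))"
    by (simp add: best_clause_def map_replicate_pmf U)
  also have "\<dots> = map_pmf (\<lambda>cs. map (rename \<pi>) cs ! best cs) (replicate_pmf l ?U)"
    by (simp add: pmf.map_comp o_def best_map_rename[OF inj])
  also have "\<dots> = map_pmf (\<lambda>cs. rename \<pi> (cs ! best cs)) (replicate_pmf l ?U)"
  proof (intro map_pmf_cong refl)
    fix cs assume "cs \<in> set_pmf (replicate_pmf l ?U)"
    then have "cs \<noteq> []" using assms by (auto simp: set_replicate_pmf)
    then show "map (rename \<pi>) cs ! best cs = rename \<pi> (cs ! best cs)" using best_works by simp
  qed
  also have "\<dots> = map_pmf (rename \<pi>) (best_clause k l n)"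
    by (simp add: best_clause_def pmf.map_comp o_def)
  finally show ?thesis by simp
qed

lemma subpairs_rename:
  assumes "inj \<pi>"
  shows "subpairs (rename \<pi> C) = rename \<pi> ` subpairs C"
proof (intro equalityI subsetI)
  fix D assume D: "D \<in> subpairs (rename \<pi> C)"
  then obtain E where E: "E \<subseteq> C" "D = rename \<pi> E"
    unfolding subpairs_def rename_def by (auto simp: subset_image_iff)
  moreover have "card (rename \<pi> E) = card E"
    unfolding rename_def by (intro card_image inj_on_subset[OF inj_map_prod_id[OF assms]]) auto
  ultimately show "D \<in> rename \<pi> ` subpairs C"
    using D assms by (auto simp: subpairs_def npos_rename score_rename)
next
  fix D assume "D \<in> rename \<pi> ` subpairs C"
  then obtain E where E: "E \<in> subpairs C" "D = rename \<pi> E" by auto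
  moreover have "card (rename \<pi> E) = card E"
    unfolding rename_def by (intro card_image inj_on_subset[OF inj_map_prod_id[OF assms]]) auto
  ultimately show "D \<in> subpairs (rename \<pi> C)"
    using assms by (auto simp: subpairs_def npos_rename score_rename rename_mono)
qed

lemma map_rename_sub_clause:
  assumes "\<pi> permutes {1..n}" "2 \<le> k" "k \<le> n" "l > 0"
  shows "map_pmf (rename \<pi>) (sub_clause k l n) = sub_clause k l n"
proof -
  have inj: "inj \<pi>" by (rule permutes_inj[OF assms(1)])
  have "map_pmf (rename \<pi>) (sub_clause k l n) =
      best_clause k l n \<bind> (\<lambda>C. map_pmf (rename \<pi>) (pmf_of_set (subpairs C)))"
    by (simp add: sub_clause_def map_bind_pmf)
  also have "\<dots> = best_clause k l n \<bind> (\<lambda>C. pmf_of_set (subpairs (rename \<pi> C)))"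
  proof (intro bind_pmf_cong refl)
    fix C assume "C \<in> set_pmf (best_clause k l n)"
    then have "C \<in> kclauses n k" using set_best_clause[OF assms(3,4)] by auto
    then show "map_pmf (rename \<pi>) (pmf_of_set (subpairs C)) = pmf_of_set (subpairs (rename \<pi> C))"
      using subpairs_nonempty finite_subpairs assms(2) inj_rename[OF inj]
      by (subst map_pmf_of_set_inj) (auto simp: subpairs_rename[OF inj] intro: inj_on_subset)
  qed
  also have "\<dots> = map_pmf (rename \<pi>) (best_clause k l n) \<bind> (\<lambda>C. pmf_of_set (subpairs C))"
    by (simp add: bind_map_pmf)
  finally show ?thesis by (simp add: map_rename_best_clause[OF assms(1,3,4)] sub_clause_def)
qed

lemma npos_pair: "fst u \<noteq> fst v \<Longrightarrow> npos {u, v} = of_bool (snd u) + of_bool (snd v)"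
proof -
  assume "fst u \<noteq> fst v"
  then have "u \<noteq> v" by auto
  moreover have "{x \<in> {u, v}. snd x} = (if snd u then {u} else {}) \<union> (if snd v then {v} else {})" by auto
  ultimately show ?thesis by (simp add: npos_def)
qed

text \<open>The orbits of 2-clauses under renaming are thus the classes of equal
  \<open>npos\<close>. Two transpositions suffice, because the second one fixes
  \<open>fst x\<close>, where the first has sent \<open>fst u\<close>.\<close>

lemma rename_transitive:
  assumes "C \<in> kclauses n 2" "D \<in> kclauses n 2" "npos C = npos D"
  obtains \<pi> where "\<pi> permutes {1..n}" "rename \<pi> C = D"
proof -
  obtain u v where uv: "C = {u, v}" "u \<in> lits n" "v \<in> lits n" "fst u \<noteq> fst v"
    using assms(1) unfolding kclauses_2 by blast
  obtain x y where xy: "D = {x, y}" "x \<in> lits n" "y \<in> lits n" "fst x \<noteq> fst y"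
    "snd x = snd u" "snd y = snd v"
  proof -
    obtain x y where xy: "D = {x, y}" "x \<in> lits n" "y \<in> lits n" "fst x \<noteq> fst y"
      using assms(2) unfolding kclauses_2 by blast
    have "(snd x = snd u \<and> snd y = snd v) \<or> (snd y = snd u \<and> snd x = snd v)"
      using assms(3) uv xy by (auto simp: npos_pair of_bool_def split: if_splits)
    moreover have "D = {y, x}" using xy(1) by (simp only: insert_commute)
    ultimately show thesis using that[of x y] that[of y x] xy by metis
  qed
  define \<tau> where "\<tau> = Transposition.transpose (fst u) (fst x)"
  define \<pi> where "\<pi> = Transposition.transpose (\<tau> (fst v)) (fst y) \<circ> \<tau>"
  have vars: "fst u \<in> {1..n}" "fst v \<in> {1..n}" "fst x \<in> {1..n}" "fst y \<in> {1..n}"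
    using uv xy by (simp_all add: lits_def mem_Times_iff)
  have \<tau>: "\<tau> permutes {1..n}" unfolding \<tau>_def using vars by (intro permutes_swap_id)
  have tv: "\<tau> (fst v) \<in> {1..n}" using permutes_in_image[OF \<tau>] vars by simp
  have \<pi>: "\<pi> permutes {1..n}"
    unfolding \<pi>_def using vars tv by (intro permutes_compose \<tau> permutes_swap_id)
  have tu: "\<tau> (fst u) = fst x" by (simp add: \<tau>_def)
  have "\<tau> (fst v) \<noteq> fst x"
    using uv(4) permutes_inj[OF \<tau>] tu by (metis injD)
  then have "\<pi> (fst u) = fst x" "\<pi> (fst v) = fst y"
    using xy(4) tu by (simp_all add: \<pi>_def)
  then have "map_prod \<pi> id u = x" "map_prod \<pi> id v = y"
    using xy by (simp_all add: prod_eq_iff)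
  then have "rename \<pi> C = D" by (simp add: rename_def uv(1) xy(1))
  with \<pi> show thesis by (rule that)
qed

text \<open>By transitivity all 2-clauses with the same \<open>npos\<close> are equally likely, so
  each has the probability of its class divided by the size of the class.\<close>

lemma pmf_sub_clause:
  assumes "2 \<le> k" "k \<le> n" "l > 0" "D \<in> kclauses n 2"
  shows "pmf (sub_clause k l n) D * (real (n choose 2) * real (2 choose npos D)) = score_prob k l (npos D)"
proof -
  define A where "A = {C \<in> kclauses n 2. npos C = npos D}"
  have s: "npos D \<le> 2" using assms(4) by (auto simp: kclauses_2 npos_pair)
  have eq: "pmf (sub_clause k l n) C = pmf (sub_clause k l n) D" if "C \<in> A" for C
  proof -
    obtain \<pi> where \<pi>: "\<pi> permutes {1..n}" "rename \<pi> C = D"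
      using rename_transitive[of C n D] \<open>C \<in> A\<close> assms(4) by (auto simp: A_def)
    then have "pmf (map_pmf (rename \<pi>) (sub_clause k l n)) (rename \<pi> C) = pmf (sub_clause k l n) C"
      by (intro pmf_map_inj' inj_rename permutes_inj)
    then show ?thesis using \<pi> assms by (simp add: map_rename_sub_clause)
  qed
  have "score_prob k l (npos D) = measure_pmf.prob (sub_clause k l n) ({C. npos C = npos D} \<inter> set_pmf (sub_clause k l n))"
    using assms s by (simp add: measure_Int_set_pmf prob_sub_clause_npos)
  also have "{C. npos C = npos D} \<inter> set_pmf (sub_clause k l n) = A \<inter> set_pmf (sub_clause k l n)"
    using set_sub_clause[OF assms(1-3)] by (auto simp: A_def)
  also have "measure_pmf.prob (sub_clause k l n) \<dots> = (\<Sum>C\<in>A. pmf (sub_clause k l n) C)"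
    by (simp add: measure_Int_set_pmf measure_measure_pmf_finite A_def)
  also have "\<dots> = real (card A) * pmf (sub_clause k l n) D" using eq by simp
  also have "card A = (n choose 2) * (2 choose npos D)" unfolding A_def by (rule card_kclauses_npos)
  finally show ?thesis by (simp add: mult_ac)
qed

subsection \<open>Shifting the threshold\<close>

lemma satisfiable_mono: "satisfiable F \<Longrightarrow> set G \<subseteq> set F \<Longrightarrow> satisfiable G"
  unfolding satisfiable_def by blast

lemma prob_satisfiable_antimono:
  assumes "m \<le> m'"
  shows "measure_pmf.prob (replicate_pmf m' p) {F. satisfiable F} \<le>
         measure_pmf.prob (replicate_pmf m p) {F. satisfiable F}"
  using assms
proof (induction m' rule: dec_induct)
  case (step j)
  have "measure_pmf.prob (replicate_pmf (Suc j) p) {F. satisfiable F} \<le>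
        measure_pmf.prob (replicate_pmf j p) {F. satisfiable F}"
    unfolding prob_replicate_pmf_Suc
  proof (intro measure_pmf.integral_le_const AE_pmfI measure_pmf.finite_measure_mono)
    show "integrable (measure_pmf p) (\<lambda>x. measure_pmf.prob (replicate_pmf j p) ((#) x -` {F. satisfiable F}))"
      by (intro measure_pmf.integrable_const_bound[where B = 1]) auto
  qed (auto intro: satisfiable_mono)
  with step show ?case by simp
qed simp

text \<open>At density r n - \<delta> formulas are satisfiable with probability near 1, and more
  clauses only hurt; so a probability bounded away from 1 at density c forces r n - \<delta> < c
  eventually. Any fixed \<theta> will do, which is what makes a weak second moment bound
  sufficient.\<close>

lemma sat_threshold_upper_bound:
  assumes r: "sat_threshold k r" and "\<theta> > 0" "\<delta> > 0"
    and ev: "\<forall>\<^sub>F n in sequentially.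
      measure_pmf.prob (random_formula k n (nat \<lfloor>c * real n\<rfloor>)) {F. satisfiable F} \<le> 1 - \<theta>"
  shows "\<forall>\<^sub>F n in sequentially. r n < c + \<delta>"
proof -
  have "(\<lambda>n. measure_pmf.prob (random_formula k n (nat \<lfloor>(r n - \<delta>) * real n\<rfloor>)) {F. satisfiable F}) \<longlonglongrightarrow> 1"
    using r \<open>\<delta> > 0\<close> unfolding sat_threshold_def by blast
  then have "\<forall>\<^sub>F n in sequentially.
      measure_pmf.prob (random_formula k n (nat \<lfloor>(r n - \<delta>) * real n\<rfloor>)) {F. satisfiable F} > 1 - \<theta>"
    using \<open>\<theta> > 0\<close> by (intro order_tendstoD) auto
  with ev show ?thesis
  proof eventually_elim
    case (elim n)
    show ?case
    proof (rule ccontr)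
      assume "\<not> r n < c + \<delta>"
      then have "c * real n \<le> (r n - \<delta>) * real n" by (intro mult_right_mono) auto
      then have "nat \<lfloor>c * real n\<rfloor> \<le> nat \<lfloor>(r n - \<delta>) * real n\<rfloor>" by (intro nat_mono floor_mono)
      then have "measure_pmf.prob (random_formula k n (nat \<lfloor>(r n - \<delta>) * real n\<rfloor>)) {F. satisfiable F} \<le>
          measure_pmf.prob (random_formula k n (nat \<lfloor>c * real n\<rfloor>)) {F. satisfiable F}"
        unfolding random_formula_def by (rule prob_satisfiable_antimono)
      with elim show False by linarith
    qed
  qed
qed

section \<open>First moment bound on the threshold\<close>

lemma card_falsified_kclauses:
  "card {C \<in> kclauses n k. \<forall>(i, b)\<in>C. \<sigma> i \<noteq> b} = n choose k"
proof -
  define g where "g = (\<lambda>i. (i, \<not> \<sigma> i))"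
  have inj: "inj_on g A" for A by (auto simp: g_def inj_on_def)
  have "{C \<in> kclauses n k. \<forall>(i, b)\<in>C. \<sigma> i \<noteq> b} = image g ` {S. S \<subseteq> {1..n} \<and> card S = k}"
  proof (intro equalityI subsetI)
    fix C assume C: "C \<in> {C \<in> kclauses n k. \<forall>(i, b)\<in>C. \<sigma> i \<noteq> b}"
    have "g (fst x) = x" if "x \<in> C" for x using C that by (auto simp: g_def)
    then have "g ` fst ` C = C" by (simp add: image_image)
    moreover have "fst ` C \<in> {S. S \<subseteq> {1..n} \<and> card S = k}"
      using C by (auto simp: kclauses_def card_image)
    ultimately show "C \<in> image g ` {S. S \<subseteq> {1..n} \<and> card S = k}" by (metis image_eqI)
  next
    fix C assume "C \<in> image g ` {S. S \<subseteq> {1..n} \<and> card S = k}"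
    then obtain S where S: "S \<subseteq> {1..n}" "card S = k" "C = g ` S" by auto
    then have "card C = k" using inj by (simp add: card_image)
    with S show "C \<in> {C \<in> kclauses n k. \<forall>(i, b)\<in>C. \<sigma> i \<noteq> b}"
      by (auto simp: kclauses_def g_def inj_on_def)
  qed
  moreover have "inj_on (image g) {S. S \<subseteq> {1..n} \<and> card S = k}"
    using inj[of UNIV] by (auto simp: inj_on_def inj_image_eq_iff)
  ultimately show ?thesis using n_subsets[of "{1..n}" k] by (simp add: card_image)
qed

lemma prob_satisfied:
  assumes "k \<le> n"
  shows "measure_pmf.prob (pmf_of_set (kclauses n k)) {C. \<exists>(i, b)\<in>C. \<sigma> i = b} = 1 - 1 / 2 ^ k"
proof -
  let ?U = "pmf_of_set (kclauses n k)"
  have "kclauses n k \<inter> {C. \<forall>(i, b)\<in>C. \<sigma> i \<noteq> b} = {C \<in> kclauses n k. \<forall>(i, b)\<in>C. \<sigma> i \<noteq> b}" by auto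
  then have "measure_pmf.prob ?U {C. \<forall>(i, b)\<in>C. \<sigma> i \<noteq> b} = real (n choose k) / real (card (kclauses n k))"
    by (simp only: measure_pmf_of_set[OF kclauses_nonempty[OF assms] finite_kclauses] card_falsified_kclauses)
  also have "\<dots> = 1 / 2 ^ k" using assms by (simp add: card_kclauses)
  finally have "measure_pmf.prob ?U {C. \<forall>(i, b)\<in>C. \<sigma> i \<noteq> b} = 1 / 2 ^ k" .
  moreover have "{C. \<exists>(i, b)\<in>C. \<sigma> i = b} = UNIV - {C. \<forall>(i, b)\<in>C. \<sigma> i \<noteq> b}" by auto
  moreover have "measure_pmf.prob ?U (UNIV - {C. \<forall>(i, b)\<in>C. \<sigma> i \<noteq> b}) =
      measure_pmf.prob ?U UNIV - measure_pmf.prob ?U {C. \<forall>(i, b)\<in>C. \<sigma> i \<noteq> b}"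
    by (intro measure_pmf.finite_measure_Diff) auto
  ultimately show ?thesis by (simp only: measure_pmf.prob_space[unfolded space_measure_pmf])
qed

lemma prob_satisfiable_le:
  assumes "k \<le> n"
  shows "measure_pmf.prob (random_formula k n m) {F. satisfiable F} \<le> 2 ^ n * (1 - 1 / 2 ^ k) ^ m"
proof -
  \<comment> \<open>Only the values on \<open>{1..n}\<close> matter; extensional functions make the
    union finite.\<close>
  let ?A = "PiE {1..n} (\<lambda>_. UNIV :: bool set)"
  let ?M = "random_formula k n m"
  have fin: "finite ?A" by (intro finite_PiE) auto
  have "measure_pmf.prob ?M {F. satisfiable F} = measure_pmf.prob ?M ({F. satisfiable F} \<inter> set_pmf ?M)"
    by (simp only: measure_Int_set_pmf)
  also have "\<dots> \<le> measure_pmf.prob ?M (\<Union>\<sigma>\<in>?A. {F. set F \<subseteq> {C. \<exists>(i, b)\<in>C. \<sigma> i = b}})"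
  proof (intro measure_pmf.finite_measure_mono subsetI)
    fix F assume F: "F \<in> {F. satisfiable F} \<inter> set_pmf ?M"
    then obtain \<sigma> where \<sigma>: "\<forall>C\<in>set F. \<exists>(i, b)\<in>C. \<sigma> i = b" unfolding satisfiable_def by blast
    have "\<exists>(i, b)\<in>C. restrict \<sigma> {1..n} i = b" if "C \<in> set F" for C
    proof -
      have "C \<in> kclauses n k" using that F set_pmf_kclauses[OF assms]
        by (auto simp: random_formula_def set_replicate_pmf)
      then have "C \<subseteq> {1..n} \<times> UNIV" by (simp add: kclauses_def)
      moreover obtain i b where "(i, b) \<in> C" "\<sigma> i = b" using bspec[OF \<sigma> \<open>C \<in> set F\<close>] by blast
      ultimately show ?thesis by (intro bexI[of _ "(i, b)"]) auto
    qed
    then show "F \<in> (\<Union>\<sigma>\<in>?A. {F. set F \<subseteq> {C. \<exists>(i, b)\<in>C. \<sigma> i = b}})"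
      by (intro UN_I[of "restrict \<sigma> {1..n}"]) auto
  qed auto
  also have "\<dots> \<le> (\<Sum>\<sigma>\<in>?A. measure_pmf.prob ?M {F. set F \<subseteq> {C. \<exists>(i, b)\<in>C. \<sigma> i = b}})"
    by (intro measure_UNION_le fin) auto
  also have "\<dots> = (\<Sum>\<sigma>\<in>?A. (1 - 1 / 2 ^ k) ^ m)"
    by (simp only: random_formula_def prob_replicate_pmf_all prob_satisfied[OF assms])
  also have "\<dots> = 2 ^ n * (1 - 1 / 2 ^ k) ^ m" by (simp add: card_PiE card_UNIV_bool)
  finally show ?thesis .
qed

lemma two_exp_minus_one: "2 * exp (-1::real) < 1"
  using exp_lower_Taylor_quadratic[of "1::real"] by (simp add: exp_minus field_simps)

text \<open>The expected number of satisfying assignments is at most (2 / e)^n, since (1 -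
  2^-k)^(2^k) \<le> 1 / e for every k. The bound is written in the form 1 - \<theta> that
  \<open>sat_threshold_upper_bound\<close> expects.\<close>

lemma prob_satisfiable_two_power:
  assumes "k \<le> n" "n \<ge> 1"
  shows "measure_pmf.prob (random_formula k n (nat \<lfloor>2 ^ k * real n\<rfloor>)) {F. satisfiable F} \<le> 1 - (1 - 2 * exp (-1))"
proof -
  have "\<lfloor>2 ^ k * real n\<rfloor> = \<lfloor>real (2 ^ k * n)\<rfloor>" by simp
  then have m: "nat \<lfloor>2 ^ k * real n\<rfloor> = 2 ^ k * n" by (simp only: floor_of_nat nat_int)
  have "(1 - 1 / 2 ^ k :: real) ^ (2 ^ k) \<le> exp (- 1 / 2 ^ k) ^ (2 ^ k :: nat)"
    using exp_ge_add_one_self[of "- 1 / 2 ^ k :: real"] by (intro power_mono) auto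
  also have "\<dots> = exp (-1)" by (simp flip: exp_of_nat_mult)
  finally have "2 * (1 - 1 / 2 ^ k) ^ (2 ^ k) \<le> 2 * exp (-1 :: real)" by simp
  then have "(2 * (1 - 1 / 2 ^ k) ^ (2 ^ k)) ^ n \<le> (2 * exp (-1 :: real)) ^ n"
    by (intro power_mono) auto
  also have "\<dots> \<le> (2 * exp (-1)) ^ 1"
    using two_exp_minus_one assms by (intro power_decreasing) auto
  finally have "2 ^ n * (1 - 1 / 2 ^ k) ^ (2 ^ k * n) \<le> 2 * exp (-1 :: real)"
    by (simp add: power_mult_distrib power_mult)
  then show ?thesis using prob_satisfiable_le[OF assms(1), of "2 ^ k * n"] unfolding m by linarith
qed

text \<open>Normalised so that at density \<open>c\<close> a 2-clause with \<open>j\<close> positive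
  literals has expected multiplicity at most rate / (n - 1); a literal has n - 1 possible successors
  of each sign on other variables. The values at j = 2, 1, 0 are \<alpha>, \<mu>, \<beta>.\<close>

definition clause_rate :: "nat \<Rightarrow> nat \<Rightarrow> real \<Rightarrow> nat \<Rightarrow> real" where
  "clause_rate k l c j = 2 * c * score_prob k l j / real (2 choose j)"

lemma score_prob_nonneg: "score_prob k l j \<ge> 0"
proof -
  have "real k + 1 \<le> 2 ^ k"
    by (induction k) auto
  then have "((real k + 1) / 2 ^ k) ^ l \<le> 1" by (intro power_le_one) auto
  moreover have "(1 / 2 ^ k) ^ l \<le> ((real k + 1) / 2 ^ k) ^ l"
    by (intro power_mono divide_right_mono) auto
  ultimately show ?thesis by (simp add: score_prob_def)
qed

text \<open>Positive literals get weight 1 and negative ones weight \<open>z\<close>;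
  \<open>pos\<close> and \<open>neg\<close> are the two rows of the test vector inequality. The
  optimal \<open>z\<close> is sqrt(\<alpha> / \<beta>), for which the least admissible
  \<open>lam\<close> is \<mu> + sqrt(\<alpha> \<beta>). Leaving \<open>z\<close> free allows
  rational values.\<close>

lemma best_rule_satisfiable:
  fixes c lam z :: real
  assumes k: "k \<ge> 2" and l: "l > 0" and c: "c \<ge> 0" and z: "z \<ge> 1" and lam: "0 \<le> lam" "lam < 1"
    and pos: "clause_rate k l c 1 + clause_rate k l c 0 * z \<le> lam"
    and neg: "clause_rate k l c 2 + clause_rate k l c 1 * z \<le> lam * z"
  shows "(\<lambda>n. measure_pmf.prob (achlioptas_formula k l best_rule n (nat \<lfloor>c * real n\<rfloor>)) {F. satisfiable F}) \<longlonglongrightarrow> 1"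
proof -
  define b where "b = (\<lambda>s t. clause_rate k l c (of_bool (\<not> s) + of_bool t))"
  define h where "h = (\<lambda>s. if s then 1 else z)"
  define G where "G = clause_rate k l c 0 + clause_rate k l c 1 + clause_rate k l c 2"
  define S where "S = (\<Sum>s. real (Suc s) ^ 2 * lam ^ s)"
  have rate0: "clause_rate k l c j \<ge> 0" for j
    using c score_prob_nonneg by (simp add: clause_rate_def)
  have bound: "1 - S * (4 * z * G\<^sup>2 * real n / (real n - 1)\<^sup>2) \<le>
      measure_pmf.prob (achlioptas_formula k l best_rule n (nat \<lfloor>c * real n\<rfloor>)) {F. satisfiable F}"
    if n: "n \<ge> k" for n
  proof -
    define m where "m = nat \<lfloor>c * real n\<rfloor>"
    have m: "real m \<le> c * real n" using c by (simp add: m_def)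
    have b: "real m * pmf (sub_clause k l n) {neg u, v} \<le> b (snd u) (snd v) / (real n - 1)"
      if uv: "u \<in> lits n" "v \<in> lits n" "fst u \<noteq> fst v" for u v
    proof -
      define D where "D = {neg u, v}"
      have D: "D \<in> kclauses n 2" using uv by (simp add: D_def pair_in_kclauses_2)
      have np: "npos D = of_bool (\<not> snd u) + of_bool (snd v)" using uv by (simp add: D_def npos_pair)
      have bin: "real (2 choose npos D) > 0" using np by (simp add: of_bool_def)
      have ch: "real (n choose 2) = real n * (real n - 1) / 2"
        using n k by (simp add: choose_two real_of_nat_div of_nat_diff)
      have nn: "real n > 1" using n k by linarith
      have "pmf (sub_clause k l n) D * (real (n choose 2) * real (2 choose npos D)) = score_prob k l (npos D)"
        using pmf_sub_clause[OF k n l D] .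
      then have "pmf (sub_clause k l n) D = 2 * score_prob k l (npos D) / (real n * (real n - 1) * real (2 choose npos D))"
        using bin nn unfolding ch by (simp add: field_simps)
      then have "real m * pmf (sub_clause k l n) D \<le>
          (c * real n) * (2 * score_prob k l (npos D) / (real n * (real n - 1) * real (2 choose npos D)))"
        using m by (simp only:) (intro mult_right_mono divide_nonneg_nonneg mult_nonneg_nonneg score_prob_nonneg, use nn in auto)
      also have "\<dots> = clause_rate k l c (npos D) / (real n - 1)"
        using nn by (simp add: clause_rate_def mult_ac)
      finally show ?thesis by (simp only: b_def D_def[symmetric] np)
    qed
    have "measure_pmf.prob (replicate_pmf m (sub_clause k l n)) {F. \<not> satisfiable F} \<le>
        S * (4 * z * G\<^sup>2 * real n / (real n - 1)\<^sup>2)"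
      unfolding S_def
    proof (rule prob_unsat_le[where b = b and h = h])
      show "b s t \<le> G" for s t using rate0[of 0] rate0[of 1] rate0[of 2]
        by (cases s; cases t) (auto simp: b_def G_def numeral_2_eq_2)
      show "b s True * h True + b s False * h False \<le> lam * h s" for s
        using pos neg by (cases s) (auto simp: b_def h_def numeral_2_eq_2)
    qed (use b rate0 z lam n k set_sub_clause[OF k n l] in \<open>auto simp: b_def h_def\<close>)
    then have "measure_pmf.prob (replicate_pmf m (best_clause k l n)) {F. \<not> satisfiable F} \<le>
        S * (4 * z * G\<^sup>2 * real n / (real n - 1)\<^sup>2)"
      using prob_unsat_best_clause_le[OF k n l, of m] by linarith
    moreover have "measure_pmf.prob (replicate_pmf m (best_clause k l n)) {F. satisfiable F} =
        1 - measure_pmf.prob (replicate_pmf m (best_clause k l n)) {F. \<not> satisfiable F}"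
      using measure_pmf.prob_compl[of "{F. \<not> satisfiable F}" "replicate_pmf m (best_clause k l n)"]
      by (simp add: Compl_eq_Diff_UNIV[symmetric] Collect_neg_eq[symmetric])
    ultimately show ?thesis by (simp add: achlioptas_formula_best_rule m_def)
  qed
  have "(\<lambda>n. real n / (real n - 1)\<^sup>2) \<longlonglongrightarrow> 0" by real_asymp
  then have "(\<lambda>n. 1 - S * 4 * z * G\<^sup>2 * (real n / (real n - 1)\<^sup>2)) \<longlonglongrightarrow> 1 - S * 4 * z * G\<^sup>2 * 0"
    by (intro tendsto_intros)
  then have "(\<lambda>n. 1 - S * (4 * z * G\<^sup>2 * real n / (real n - 1)\<^sup>2)) \<longlonglongrightarrow> 1"
    by (simp add: mult_ac)
  then show ?thesis
  proof (rule tendsto_sandwich[rotated 2, OF _ tendsto_const])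
    show "\<forall>\<^sub>F n in sequentially. 1 - S * (4 * z * G\<^sup>2 * real n / (real n - 1)\<^sup>2) \<le>
        measure_pmf.prob (achlioptas_formula k l best_rule n (nat \<lfloor>c * real n\<rfloor>)) {F. satisfiable F}"
      using eventually_ge_at_top[of k] by eventually_elim (rule bound)
  qed auto
qed

section \<open>From an upper bound on the threshold to a shift, with numerical parameters\<close>

lemma shift_from_upper_bound:
  assumes k: "k \<ge> 2" and l: "l > 0"
    and r: "\<forall>\<^sub>F n in sequentially. r n < c0" and "c0 < c" "c \<ge> 0"
    and lam: "0 \<le> lam" "lam < 1" "z \<ge> 1"
    and pos: "clause_rate k l c 1 + clause_rate k l c 0 * z \<le> lam"
    and neg: "clause_rate k l c 2 + clause_rate k l c 1 * z \<le> lam * z"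
  shows "\<exists>\<epsilon>>0. (\<lambda>n. measure_pmf.prob
      (achlioptas_formula k l best_rule n (nat \<lfloor>(r n + \<epsilon>) * real n\<rfloor>)) {F. satisfiable F}) \<longlonglongrightarrow> 1"
proof (intro exI[of _ "c - c0"] conjI)
  \<comment> \<open>With this \<epsilon> the process makes at most \<open>c * n\<close> steps for
    large n. The chosen clauses are independent and identically distributed, so fewer steps only
    raise the probability of satisfiability.\<close>
  show "c - c0 > 0" using assms by simp
  show "(\<lambda>n. measure_pmf.prob
      (achlioptas_formula k l best_rule n (nat \<lfloor>(r n + (c - c0)) * real n\<rfloor>)) {F. satisfiable F}) \<longlonglongrightarrow> 1"
  proof (rule tendsto_sandwich[OF _ _ best_rule_satisfiable[OF k l \<open>c \<ge> 0\<close> \<open>z \<ge> 1\<close> lam(1,2) pos neg] tendsto_const])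
    show "\<forall>\<^sub>F n in sequentially.
        measure_pmf.prob (achlioptas_formula k l best_rule n (nat \<lfloor>c * real n\<rfloor>)) {F. satisfiable F} \<le>
        measure_pmf.prob (achlioptas_formula k l best_rule n (nat \<lfloor>(r n + (c - c0)) * real n\<rfloor>)) {F. satisfiable F}"
      using r
    proof eventually_elim
      case (elim n)
      then have "(r n + (c - c0)) * real n \<le> c * real n" by (intro mult_right_mono) auto
      then show ?case unfolding achlioptas_formula_best_rule
        by (intro prob_satisfiable_antimono nat_mono floor_mono)
    qed
  qed auto
qed

text \<open>Equality holds at k = 7; from there on (k + 2) / (k + 1) \<le> 3/2 and (3/2)^3 <
  4.\<close>

lemma cube_le_four_power: "7 \<le> k \<Longrightarrow> 32 * (real k + 1) ^ 3 \<le> 4 ^ k"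
proof (induction k rule: dec_induct)
  case (step k)
  have "32 * (real (Suc k) + 1) ^ 3 \<le> 4 * (32 * (real k + 1) ^ 3)"
  proof -
    have "(real (Suc k) + 1) ^ 3 \<le> (3 / 2 * (real k + 1)) ^ 3" using step by (intro power_mono) auto
    also have "\<dots> = (3 / 2) ^ 3 * (real k + 1) ^ 3" by (rule power_mult_distrib)
    also have "\<dots> \<le> 4 * (real k + 1) ^ 3" by (intro mult_right_mono) (auto simp: power_divide)
    finally show ?thesis by simp
  qed
  also have "\<dots> \<le> 4 * 4 ^ k" using step by (intro mult_left_mono) auto
  finally show ?case by simp
qed simp

text \<open>With x = 2^k and three clauses, the two summands are at most 2(k + 1)^3 / x^2 and 64 /
  x. For k from 3 to 6 they are evaluated; the tight case is k = 3, where the rate for one positive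
  literal is just below 16 (4/8)^5 = 1/2.\<close>

lemma clause_rate_large_k:
  assumes "k \<ge> 3" "l = (if k \<ge> 7 then 3 else 5)"
  shows "clause_rate k l (2 ^ (k + 1)) 1 + clause_rate k l (2 ^ (k + 1)) 0 * 2 ^ (k + 4) \<le> 3 / 4"
    and "clause_rate k l (2 ^ (k + 1)) 1 \<le> 1 / 2"
proof -
  let ?A = "clause_rate k l (2 ^ (k + 1)) 1" and ?B = "clause_rate k l (2 ^ (k + 1)) 0 * 2 ^ (k + 4)"
  have "?A + ?B \<le> 3 / 4 \<and> ?A \<le> 1 / 2"
  proof (cases "k \<ge> 7")
    case True
    define x where "x = (2::real) ^ k"
    have x: "x \<ge> 128" using power_increasing[OF True, of "2::real"] by (simp add: x_def)
    have "x\<^sup>2 = 4 ^ k" by (simp add: x_def power2_eq_square flip: power_mult_distrib)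
    then have y: "32 * (real k + 1) ^ 3 \<le> x\<^sup>2" using cube_le_four_power[OF True] by simp
    have A: "?A = 2 * x * (((real k + 1) / x) ^ 3 - (1 / x) ^ 3)"
      using True assms by (simp add: clause_rate_def score_prob_def x_def)
    have "?A \<le> 2 * x * ((real k + 1) / x) ^ 3"
      unfolding A using x by (intro mult_left_mono) auto
    also have "\<dots> = 2 * (real k + 1) ^ 3 / x\<^sup>2"
      using x by (simp add: power_divide power2_eq_square power3_eq_cube)
    also have "\<dots> \<le> 1 / 16" using y x by (simp add: field_simps)
    finally have A16: "?A \<le> 1 / 16" .
    have "?B = 4 * x * (1 / x) ^ 3 * (16 * x)"
      using True assms by (simp add: clause_rate_def score_prob_def x_def power_add)
    also have "\<dots> = 64 / x" using x by (simp add: power3_eq_cube)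
    also have "\<dots> \<le> 1 / 2" using x by (simp add: field_simps)
    finally show ?thesis using A16 by simp
  next
    case False
    then have "k = 3 \<or> k = 4 \<or> k = 5 \<or> k = 6" "l = 5" using assms by auto
    then show ?thesis
      by (elim disjE) (simp_all add: clause_rate_def score_prob_def power_divide)
  qed
  then show "?A + ?B \<le> 3 / 4" "?A \<le> 1 / 2" by auto
qed

text \<open>\<open>z = 2 ^ (k + 4)\<close> is chosen so that the trivial bound 2^(k + 2) on \<alpha>
  equals z / 4; together with \<mu> \<le> 1/2 this gives \<open>lam = 3 / 4\<close>.\<close>

lemma shift_large_k:
  assumes "k \<ge> 3" "sat_threshold k r" "l = (if k \<ge> 7 then 3 else 5)"
  shows "\<exists>\<epsilon>>0. (\<lambda>n. measure_pmf.prob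
      (achlioptas_formula k l best_rule n (nat \<lfloor>(r n + \<epsilon>) * real n\<rfloor>)) {F. satisfiable F}) \<longlonglongrightarrow> 1"
proof (rule shift_from_upper_bound[where lam = "3 / 4" and z = "2 ^ (k + 4)"])
  have "\<forall>\<^sub>F n in sequentially. n \<ge> max 1 k" by (rule eventually_ge_at_top)
  then have "\<forall>\<^sub>F n in sequentially.
      measure_pmf.prob (random_formula k n (nat \<lfloor>2 ^ k * real n\<rfloor>)) {F. satisfiable F} \<le> 1 - (1 - 2 * exp (-1))"
    by eventually_elim (intro prob_satisfiable_two_power, auto)
  then show "\<forall>\<^sub>F n in sequentially. r n < 2 ^ k + 1"
    using two_exp_minus_one by (intro sat_threshold_upper_bound[OF assms(2), where \<theta> = "1 - 2 * exp (-1)"]) auto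
  have "(2::real) ^ k > 2 ^ 0" using assms(1) by (intro power_strict_increasing) auto
  then show "(2::real) ^ k + 1 < 2 ^ (k + 1)" by simp
  show "clause_rate k l (2 ^ (k + 1)) 1 + clause_rate k l (2 ^ (k + 1)) 0 * 2 ^ (k + 4) \<le> 3 / 4"
    by (rule clause_rate_large_k[OF assms(1,3)])
  have "((real k + 1) / 2 ^ k) ^ l \<ge> 0" by simp
  then have "score_prob k l 2 \<le> 1" by (simp add: score_prob_def)
  then have "2 ^ (k + 2) * score_prob k l 2 \<le> 2 ^ (k + 2) * 1" by (intro mult_left_mono) auto
  then have "clause_rate k l (2 ^ (k + 1)) 2 \<le> 2 ^ (k + 2)" by (simp add: clause_rate_def)
  moreover have "clause_rate k l (2 ^ (k + 1)) 1 * 2 ^ (k + 4) \<le> 1 / 2 * 2 ^ (k + 4)"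
    by (intro mult_right_mono clause_rate_large_k[OF assms(1,3)]) auto
  moreover have "3 / 4 * 2 ^ (k + 4) = (2::real) ^ (k + 2) + 1 / 2 * 2 ^ (k + 4)" by (simp add: power_add)
  ultimately show "clause_rate k l (2 ^ (k + 1)) 2 + clause_rate k l (2 ^ (k + 1)) 1 * 2 ^ (k + 4) \<le> 3 / 4 * 2 ^ (k + 4)"
    by linarith
qed (use assms in auto)

text \<open>Here \<alpha>, \<mu>, \<beta> are 7c/8, c/2, c/8. At c = 1.15 the eigenvalue c(1/2 +
  sqrt(7)/8) is about 0.955, which leaves room for \<open>lam = 97 / 100\<close>, and
  \<open>z\<close> approximates sqrt(7).\<close>

lemma shift_two:
  assumes "\<forall>\<^sub>F n in sequentially. r n < (112 / 100 :: real)"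
  shows "\<exists>\<epsilon>>0. (\<lambda>n. measure_pmf.prob
      (achlioptas_formula 2 2 best_rule n (nat \<lfloor>(r n + \<epsilon>) * real n\<rfloor>)) {F. satisfiable F}) \<longlonglongrightarrow> 1"
  by (rule shift_from_upper_bound[where lam = "97 / 100" and z = "265 / 100" and c = "115 / 100", OF _ _ assms])
     (simp_all add: clause_rate_def score_prob_def power_divide)

subsection \<open>Second moment and weighted walks\<close>

text \<open>Cauchy-Schwarz for the number Y of events that occur and the indicator of their union U,
  obtained from the nonnegative expectation of (Y - a 1_U)^2 at a = E Y / P(U).\<close>

lemma chung_erdos:
  assumes "finite I"
  shows "(\<Sum>s\<in>I. measure_pmf.prob M (A s))\<^sup>2 \<le>
    measure_pmf.prob M (\<Union>s\<in>I. A s) * (\<Sum>s\<in>I. \<Sum>t\<in>I. measure_pmf.prob M (A s \<inter> A t))"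
proof -
  define U where "U = (\<Union>s\<in>I. A s)"
  define E1 where "E1 = (\<Sum>s\<in>I. measure_pmf.prob M (A s))"
  define E2 where "E2 = (\<Sum>s\<in>I. \<Sum>t\<in>I. measure_pmf.prob M (A s \<inter> A t))"
  have int: "integrable (measure_pmf M) (indicator B :: _ \<Rightarrow> real)" for B
    by (rule measure_pmf.integrable_const_bound[where B = 1]) auto
  have quad: "0 \<le> E2 - 2 * a * E1 + a\<^sup>2 * measure_pmf.prob M U" for a :: real
  proof -
    have "0 \<le> measure_pmf.expectation M (\<lambda>x. ((\<Sum>s\<in>I. indicator (A s) x) - a * indicator U x)\<^sup>2)"
      by (intro integral_nonneg_AE) auto
    also have "(\<lambda>x. ((\<Sum>s\<in>I. indicator (A s) x) - a * indicator U x)\<^sup>2) =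
       (\<lambda>x. (\<Sum>s\<in>I. \<Sum>t\<in>I. indicator (A s \<inter> A t) x) - 2 * a * (\<Sum>s\<in>I. indicator (A s) x) + a\<^sup>2 * indicator U x)"
    proof
      fix x
      define Y where "Y = (\<Sum>s\<in>I. indicator (A s) x :: real)"
      have "Y * indicator U x = Y"
        unfolding Y_def sum_distrib_right by (intro sum.cong) (auto simp: U_def indicator_def)
      moreover have "(Y - a * indicator U x)\<^sup>2 = Y * Y - 2 * a * (Y * indicator U x) + a\<^sup>2 * (indicator U x)\<^sup>2"
        by (simp add: power2_eq_square algebra_simps)
      moreover have "(\<Sum>s\<in>I. \<Sum>t\<in>I. indicator (A s \<inter> A t) x) = Y * Y"
        unfolding Y_def sum_product by (intro sum.cong) (auto simp: indicator_def)
      moreover have "(indicator U x :: real)\<^sup>2 = indicator U x" by (simp add: indicator_def)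
      ultimately show "((\<Sum>s\<in>I. indicator (A s) x) - a * indicator U x)\<^sup>2 =
          (\<Sum>s\<in>I. \<Sum>t\<in>I. indicator (A s \<inter> A t) x) - 2 * a * (\<Sum>s\<in>I. indicator (A s) x) + a\<^sup>2 * indicator U x"
        by (simp only: Y_def[symmetric])
    qed
    also have "measure_pmf.expectation M \<dots> = E2 - 2 * a * E1 + a\<^sup>2 * measure_pmf.prob M U"
    proof -
      have i1: "integrable (measure_pmf M) (\<lambda>x. \<Sum>s\<in>I. indicator (A s) x :: real)"
        and i2: "integrable (measure_pmf M) (\<lambda>x. \<Sum>s\<in>I. \<Sum>t\<in>I. indicator (A s \<inter> A t) x :: real)"
        by (intro Bochner_Integration.integrable_sum int)+
      have e1: "measure_pmf.expectation M (\<lambda>x. \<Sum>s\<in>I. indicator (A s) x) = E1"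
        unfolding E1_def by (subst Bochner_Integration.integral_sum) (auto simp: int)
      have "measure_pmf.expectation M (\<lambda>x. \<Sum>s\<in>I. \<Sum>t\<in>I. indicator (A s \<inter> A t) x :: real) =
          (\<Sum>s\<in>I. measure_pmf.expectation M (\<lambda>x. \<Sum>t\<in>I. indicator (A s \<inter> A t) x))"
        by (intro Bochner_Integration.integral_sum Bochner_Integration.integrable_sum int)
      also have "\<dots> = E2"
        unfolding E2_def
        by (intro sum.cong refl, subst Bochner_Integration.integral_sum) (auto simp: int)
      finally have e2: "measure_pmf.expectation M (\<lambda>x. \<Sum>s\<in>I. \<Sum>t\<in>I. indicator (A s \<inter> A t) x) = E2" .
      show ?thesis
        by (subst Bochner_Integration.integral_add, intro Bochner_Integration.integrable_diff i2
            integrable_mult_right i1, intro integrable_mult_right int,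
            subst Bochner_Integration.integral_diff, rule i2, intro integrable_mult_right i1)
          (simp add: e1 e2)
    qed
    finally show ?thesis .
  qed
  show ?thesis
  proof (cases "measure_pmf.prob M U = 0")
    case True
    have "measure_pmf.prob M (A s) = 0" if "s \<in> I" for s
    proof -
      have "measure_pmf.prob M (A s) \<le> measure_pmf.prob M U"
        using that by (intro measure_pmf.finite_measure_mono) (auto simp: U_def)
      then show ?thesis using True measure_nonneg[of M "A s"] by linarith
    qed
    then show ?thesis by (simp add: True U_def[symmetric])
  next
    case False
    then have pos: "measure_pmf.prob M U > 0" using measure_nonneg[of M U] by linarith
    have "0 \<le> E2 - 2 * (E1 / measure_pmf.prob M U) * E1 + (E1 / measure_pmf.prob M U)\<^sup>2 * measure_pmf.prob M U"
      by (rule quad)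
    then have "E1\<^sup>2 \<le> measure_pmf.prob M U * E2"
      using pos by (simp add: power2_eq_square field_simps)
    then show ?thesis by (simp only: E1_def E2_def U_def)
  qed
qed

section \<open>Powers of nonnegative matrices as sums over walks\<close>

lemma sum_tuples_add:
  "(\<Sum>w\<in>tuples A (i + j). f w) = (\<Sum>w\<in>tuples A i. \<Sum>w'\<in>tuples A j. f (w @ w'))"
  by (induction i arbitrary: f) (simp_all add: sum_tuples_Suc)

primrec mpow :: "'a set \<Rightarrow> ('a \<Rightarrow> 'a \<Rightarrow> real) \<Rightarrow> nat \<Rightarrow> 'a \<Rightarrow> 'a \<Rightarrow> real" where
  "mpow L f 0 u v = of_bool (u = v)"
| "mpow L f (Suc j) u v = (\<Sum>y\<in>L. f u y * mpow L f j y v)"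

primrec row_sum :: "'a set \<Rightarrow> ('a \<Rightarrow> 'a \<Rightarrow> real) \<Rightarrow> nat \<Rightarrow> 'a \<Rightarrow> real" where
  "row_sum L f 0 u = 1"
| "row_sum L f (Suc j) u = (\<Sum>y\<in>L. f u y * row_sum L f j y)"

lemma mpow_nonneg: "(\<And>u v. f u v \<ge> 0) \<Longrightarrow> mpow L f j u v \<ge> 0"
  by (induction j arbitrary: u) (auto intro!: sum_nonneg)

lemma row_sum_nonneg: "(\<And>u v. f u v \<ge> 0) \<Longrightarrow> row_sum L f j u \<ge> 0"
  by (induction j arbitrary: u) (auto intro!: sum_nonneg)

lemma mpow_le_row_sum: "(\<And>u v. f u v \<ge> 0) \<Longrightarrow> mpow L f j u v \<le> row_sum L f j u"
  by (induction j arbitrary: u) (auto intro!: sum_mono mult_left_mono)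

lemma mpow_Suc_right:
  assumes "finite L" "u \<in> L" "v \<in> L"
  shows "mpow L f (Suc j) u v = (\<Sum>y\<in>L. mpow L f j u y * f y v)"
  using assms(2)
proof (induction j arbitrary: u)
  case 0
  have "(\<Sum>y\<in>L. f u y * of_bool (y = v)) = f u v" using assms by (simp add: of_bool_def if_distrib cong: if_cong)
  moreover have "(\<Sum>y\<in>L. of_bool (u = y) * f y v) = f u v" using assms 0
    by (simp add: of_bool_def if_distrib[of "\<lambda>z. z * _"] cong: if_cong)
  ultimately show ?case by simp
next
  case (Suc j)
  have "mpow L f (Suc (Suc j)) u v = (\<Sum>z\<in>L. f u z * (\<Sum>y\<in>L. mpow L f j z y * f y v))"
    using Suc.IH by (subst mpow.simps(2)) (intro sum.cong, auto)
  also have "\<dots> = (\<Sum>y\<in>L. \<Sum>z\<in>L. f u z * (mpow L f j z y * f y v))"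
    unfolding sum_distrib_left by (rule sum.swap)
  also have "\<dots> = (\<Sum>y\<in>L. mpow L f (Suc j) u y * f y v)"
    by (simp add: sum_distrib_right mult.assoc)
  finally show ?case .
qed

lemma sum_walk_prod_eq_mpow:
  assumes "finite L" "v \<in> L"
  shows "(\<Sum>w\<in>tuples L j. walk_prod f (u # w @ [v])) = mpow L f (Suc j) u v"
proof (induction j arbitrary: u)
  case 0
  show ?case using assms by (simp add: of_bool_def if_distrib cong: if_cong)
next
  case (Suc j)
  show ?case by (simp add: sum_tuples_Suc Suc sum_distrib_left[symmetric] del: mpow.simps) simp
qed

text \<open>Contraposition turns the transpose of \<open>f\<close> into \<open>f\<close> relabelled
  by \<open>neg\<close>, so bounds on rows serve for columns too.\<close>

lemma column_sum:
  assumes "\<And>u v. f u v = f (neg v) (neg u)" "v \<in> lits n"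
  shows "(\<Sum>u\<in>lits n. mpow (lits n) f j u v) = row_sum (lits n) f j (neg v)"
  using assms(2)
proof (induction j arbitrary: v)
  case 0
  then show ?case by (simp add: of_bool_def)
next
  case (Suc j)
  have "(\<Sum>u\<in>lits n. mpow (lits n) f (Suc j) u v) = (\<Sum>u\<in>lits n. \<Sum>y\<in>lits n. mpow (lits n) f j u y * f y v)"
    using Suc by (intro sum.cong mpow_Suc_right) auto
  also have "\<dots> = (\<Sum>y\<in>lits n. (\<Sum>u\<in>lits n. mpow (lits n) f j u y) * f y v)"
    unfolding sum_distrib_right by (rule sum.swap)
  also have "\<dots> = (\<Sum>y\<in>lits n. row_sum (lits n) f j (neg y) * f y v)"
    using Suc by (intro sum.cong) auto
  also have "\<dots> = (\<Sum>y\<in>lits n. row_sum (lits n) f j y * f (neg y) v)"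
    by (rule sum.reindex_bij_witness[of _ neg neg]) auto
  also have "\<dots> = (\<Sum>y\<in>lits n. f (neg v) y * row_sum (lits n) f j y)"
    by (subst assms(1)) (simp add: mult.commute)
  finally show ?case by simp
qed

text \<open>Split the walks of p J + a at the first step that uses p J. Before it the walk follows
  \<open>a\<close> for i steps; the jump forgets the vertex it starts from, so what follows
  contributes a full column sum.\<close>

lemma mpow_add_const:
  assumes "finite L" "u \<in> L"
  shows "mpow L (\<lambda>u v. p + a u v) j u v =
    mpow L a j u v + p * (\<Sum>i<j. row_sum L a i u * (\<Sum>y\<in>L. mpow L (\<lambda>u v. p + a u v) (j - 1 - i) y v))"
  using assms(2)
proof (induction j arbitrary: u)
  case (Suc j)
  let ?S = "\<lambda>i. \<Sum>y\<in>L. mpow L (\<lambda>u v. p + a u v) i y v"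
  have "mpow L (\<lambda>u v. p + a u v) (Suc j) u v =
      p * ?S j + (\<Sum>y\<in>L. a u y * mpow L (\<lambda>u v. p + a u v) j y v)"
    by (simp add: distrib_right sum.distrib sum_distrib_left)
  also have "(\<Sum>y\<in>L. a u y * mpow L (\<lambda>u v. p + a u v) j y v) =
      (\<Sum>y\<in>L. a u y * mpow L a j y v + a u y * (p * (\<Sum>i<j. row_sum L a i y * ?S (j - 1 - i))))"
    using Suc by (intro sum.cong) (auto simp: distrib_left)
  also have "\<dots> = mpow L a (Suc j) u v + p * (\<Sum>y\<in>L. \<Sum>i<j. a u y * row_sum L a i y * ?S (j - 1 - i))"
    by (simp add: sum.distrib sum_distrib_left mult_ac)
  also have "(\<Sum>y\<in>L. \<Sum>i<j. a u y * row_sum L a i y * ?S (j - 1 - i)) = (\<Sum>i<j. row_sum L a (Suc i) u * ?S (j - 1 - i))"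
    by (subst sum.swap) (simp add: sum_distrib_right)
  also have "p * ?S j + (mpow L a (Suc j) u v + p * (\<Sum>i<j. row_sum L a (Suc i) u * ?S (j - 1 - i))) =
      mpow L a (Suc j) u v + p * (\<Sum>i<Suc j. row_sum L a i u * ?S (Suc j - 1 - i))"
    unfolding sum.lessThan_Suc_shift by (simp add: distrib_left)
  finally show ?case .
qed simp

text \<open>Only \<open>\<gamma> ^ j\<close> with \<open>\<gamma>\<close> within \<open>O(t / n)\<close> of \<open>c = card L * p\<close> is affordable here; the summand
  \<open>- H\<close> absorbs the additive constant of the recursion.\<close>
lemma column_growth:
  fixes p c D G H \<gamma> :: real
  assumes L: "finite L" and a: "\<And>u v. a u v \<ge> 0" and p: "p \<ge> 0"
    and c: "c = real (card L) * p" "c > 1" and D: "D \<ge> 0"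
    and H: "H = 2 / (c - 1)" and G: "G = 1 + H" and \<gamma>: "\<gamma> = c + p * D / (c - 1)"
    and col: "\<And>i. i \<le> t \<Longrightarrow> (\<Sum>u\<in>L. mpow L a i u v) \<le> 2"
    and tot: "\<And>i. 1 \<le> i \<Longrightarrow> i \<le> t \<Longrightarrow> (\<Sum>u\<in>L. row_sum L a i u) \<le> D"
    and v: "v \<in> L"
  shows "j \<le> t \<Longrightarrow> (\<Sum>u\<in>L. mpow L (\<lambda>u v. p + a u v) j u v) \<le> G * \<gamma> ^ j - H"
proof (induction j rule: less_induct)
  case (less j)
  define S where "S = (\<lambda>i. \<Sum>u\<in>L. mpow L (\<lambda>u v. p + a u v) i u v)"
  have H0: "H > 0" using c by (simp add: H)
  have G0: "G > 0" using H0 by (simp add: G)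
  have g: "\<gamma> \<ge> c" using p D c by (simp add: \<gamma>)
  have S0: "S i \<ge> 0" for i unfolding S_def by (intro sum_nonneg mpow_nonneg add_nonneg_nonneg p a)
  have IH: "S i \<le> G * \<gamma> ^ i - H" if "i < j" for i
    using less.IH[OF that] less.prems that by (simp add: S_def)
  show ?case
  proof (cases j)
    case 0
    have "(\<Sum>u\<in>L. of_bool (u = v)) = (1::real)" using L v by (simp add: of_bool_def)
    then show ?thesis by (simp add: 0 G)
  next
    case (Suc l)
    have "S j = (\<Sum>u\<in>L. mpow L a j u v) + p * (\<Sum>i<j. (\<Sum>u\<in>L. row_sum L a i u) * S (j - 1 - i))"
    proof -
      have "S j = (\<Sum>u\<in>L. mpow L a j u v + p * (\<Sum>i<j. row_sum L a i u * S (j - 1 - i)))"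
        unfolding S_def by (intro sum.cong refl mpow_add_const[OF L])
      also have "\<dots> = (\<Sum>u\<in>L. mpow L a j u v) + p * (\<Sum>u\<in>L. \<Sum>i<j. row_sum L a i u * S (j - 1 - i))"
        by (simp only: sum.distrib sum_distrib_left)
      also have "(\<Sum>u\<in>L. \<Sum>i<j. row_sum L a i u * S (j - 1 - i)) = (\<Sum>i<j. \<Sum>u\<in>L. row_sum L a i u * S (j - 1 - i))"
        by (rule sum.swap)
      finally show ?thesis by (simp only: sum_distrib_right)
    qed
    also have "\<dots> \<le> 2 + p * (real (card L) * S l + D * (G * (\<gamma> ^ l / (c - 1))))"
    proof (intro add_mono col less.prems mult_left_mono p)
      \<comment> \<open>The term with i = 0 is the main one: its mass is \<open>card L\<close>,
        which with the factor \<open>p\<close> gives \<open>c * S l\<close>. Each later term has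
        mass at most \<open>D\<close>.\<close>
      have "(\<Sum>i<j. (\<Sum>u\<in>L. row_sum L a i u) * S (j - 1 - i)) =
          real (card L) * S l + (\<Sum>i<l. (\<Sum>u\<in>L. row_sum L a (Suc i) u) * S (l - 1 - i))"
        unfolding Suc sum.lessThan_Suc_shift by (simp add: S_def)
      also have "(\<Sum>i<l. (\<Sum>u\<in>L. row_sum L a (Suc i) u) * S (l - 1 - i)) \<le> (\<Sum>i<l. D * (G * \<gamma> ^ (l - 1 - i)))"
      proof (intro sum_mono mult_mono)
        fix i assume i: "i \<in> {..<l}"
        show "(\<Sum>u\<in>L. row_sum L a (Suc i) u) \<le> D" using i Suc less.prems by (intro tot) auto
        show "S (l - 1 - i) \<le> G * \<gamma> ^ (l - 1 - i)" 
        proof -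
          have "l - 1 - i < j" using Suc by simp
          then show ?thesis using IH[of "l - 1 - i"] H0 by linarith
        qed
      qed (auto intro: S0 D)
      also have "\<dots> = D * (G * (\<Sum>i<l. \<gamma> ^ (l - 1 - i)))" by (simp only: sum_distrib_left)
      also have "(\<Sum>i<l. \<gamma> ^ (l - 1 - i)) = (\<Sum>i<l. \<gamma> ^ i)"
        by (subst sum.nat_diff_reindex[symmetric]) simp
      also have "D * (G * (\<Sum>i<l. \<gamma> ^ i)) \<le> D * (G * (\<gamma> ^ l / (c - 1)))"
      proof (intro mult_left_mono)
        have "(\<Sum>i<l. \<gamma> ^ i) = (\<gamma> ^ l - 1) / (\<gamma> - 1)" using g c by (intro geometric_sum) auto
        also have "\<dots> \<le> \<gamma> ^ l / (c - 1)" using g c by (intro frac_le) auto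
        finally show "(\<Sum>i<l. \<gamma> ^ i) \<le> \<gamma> ^ l / (c - 1)" .
      qed (use G0 D in auto)
      finally show "(\<Sum>i<j. (\<Sum>u\<in>L. row_sum L a i u) * S (j - 1 - i)) \<le>
          real (card L) * S l + D * (G * (\<gamma> ^ l / (c - 1)))" by simp
    qed
    also have "\<dots> = 2 + c * S l + p * D / (c - 1) * (G * \<gamma> ^ l)"
      by (simp add: c(1) algebra_simps)
    also have "\<dots> \<le> 2 + c * (G * \<gamma> ^ l - H) + p * D / (c - 1) * (G * \<gamma> ^ l)"
      using IH[of l] Suc c by (intro add_mono mult_left_mono order_refl) auto
    also have "\<dots> = G * \<gamma> ^ j + (2 - c * H)" by (simp add: \<gamma> Suc algebra_simps)
    also have "2 - c * H = - H"
    proof -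
      have "H * (c - 1) = 2" unfolding H using c(2) by (subst times_divide_eq_left) (simp add: divide_eq_eq)
      then show ?thesis by (simp add: algebra_simps)
    qed
    finally show ?thesis by (simp add: S_def)
  qed
qed

text \<open>For a = 0 and t > 0 the entry is c^t / card L; a sparse \<open>a\<close> costs only a
  constant factor. From c - 1 \<ge> 1/20 come H \<le> 40 and G \<le> 41, a factor 2 for the powers
  of \<gamma> gives column sums up to 82 c^i, and 2 + 3280 c \<le> 4000. By \<open>big\<close>, the
  contribution 2 of walks using \<open>a\<close> alone is at most 2 c^t / card L.\<close>

lemma mpow_bound:
  fixes p c D :: real
  assumes L: "finite L" and a: "\<And>u v. a u v \<ge> 0" and p: "p \<ge> 0"
    and c: "c = real (card L) * p" "105 / 100 \<le> c" "c \<le> 12 / 10" and D: "D \<ge> 0" "40 * (p * D * real t) \<le> 1"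
    and row: "\<And>i u. u \<in> L \<Longrightarrow> i \<le> t \<Longrightarrow> row_sum L a i u \<le> 2"
    and col: "\<And>i v. v \<in> L \<Longrightarrow> i \<le> t \<Longrightarrow> (\<Sum>u\<in>L. mpow L a i u v) \<le> 2"
    and tot: "\<And>i. 1 \<le> i \<Longrightarrow> i \<le> t \<Longrightarrow> (\<Sum>u\<in>L. row_sum L a i u) \<le> D"
    and big: "c ^ t \<ge> real (card L)" and uv: "u \<in> L" "v \<in> L"
  shows "mpow L (\<lambda>u v. p + a u v) t u v \<le> 4000 * (c ^ t / real (card L))"
proof -
  define H where "H = 2 / (c - 1)"
  define G where "G = 1 + H"
  define \<gamma> where "\<gamma> = c + p * D / (c - 1)"
  define S where "S = (\<lambda>i. \<Sum>u\<in>L. mpow L (\<lambda>u v. p + a u v) i u v)"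
  have L0: "card L > 0" using L uv by (auto simp: card_gt_0_iff)
  have H: "0 \<le> H" "H \<le> 40" using c by (auto simp: H_def field_simps)
  have G: "0 \<le> G" "G \<le> 41" using H by (auto simp: G_def)
  have g0: "\<gamma> \<ge> 0" unfolding \<gamma>_def using p D c(2) by (intro add_nonneg_nonneg divide_nonneg_nonneg) auto
  have g: "\<gamma> ^ i \<le> 2 * c ^ i" if "i \<le> t" for i
  proof -
    define e where "e = p * D / (c - 1)"
    have e0: "e \<ge> 0" using p D c by (simp add: e_def)
    have "e \<le> p * D / (5 / 100)" unfolding e_def using p D c by (intro divide_left_mono) auto
    then have "e * real t \<le> (p * D / (5 / 100)) * real t" by (intro mult_right_mono) auto
    \<comment> \<open>The factor 40 in the assumption on \<open>D\<close> is made for this: e \<le>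
      20 p D, hence e t \<le> 1/2 and \<gamma>^i \<le> c^i exp(1/2).\<close>
    then have et: "e * real t \<le> 1 / 2" using D(2) by simp
    have "\<gamma> \<le> c * exp e"
    proof -
      have "\<gamma> = c + e" by (simp add: \<gamma>_def e_def)
      also have "\<dots> \<le> c * (1 + e)" using mult_right_mono[of 1 c e] c(2) e0 by (simp add: distrib_left)
      also have "\<dots> \<le> c * exp e" using c exp_ge_add_one_self[of e] by (intro mult_left_mono) auto
      finally show ?thesis .
    qed
    then have "\<gamma> ^ i \<le> (c * exp e) ^ i" using g0 by (intro power_mono)
    also have "\<dots> = c ^ i * exp (e * real i)" by (simp add: power_mult_distrib exp_of_nat_mult[symmetric] mult.commute)
    also have "\<dots> \<le> c ^ i * exp (1 / 2)"
    proof (intro mult_left_mono)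
      have "e * real i \<le> e * real t" using that e0 by (intro mult_left_mono) auto
      then show "exp (e * real i) \<le> exp (1 / 2)" using et by simp
    qed (use c in auto)
    also have "\<dots> \<le> c ^ i * 2" using c exp_bound[of "1 / 2"] by (intro mult_left_mono) (auto simp: power2_eq_square)
    finally show ?thesis by simp
  qed
  have S: "S i \<le> 82 * c ^ i" if "i \<le> t" for i
  proof -
    have "S i \<le> G * \<gamma> ^ i - H"
      unfolding S_def
      by (rule column_growth[OF L a p c(1) _ D(1) H_def G_def \<gamma>_def, where t = t]) (use c col tot uv that in auto)
    also have "\<dots> \<le> G * \<gamma> ^ i" using H by simp
    also have "\<dots> \<le> 41 * (2 * c ^ i)" using G g[OF that] c
      by (intro mult_mono zero_le_power g0) auto
    finally show ?thesis by simp
  qed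
  have "mpow L (\<lambda>u v. p + a u v) t u v = mpow L a t u v + p * (\<Sum>i<t. row_sum L a i u * S (t - 1 - i))"
    unfolding S_def by (rule mpow_add_const[OF L uv(1)])
  also have "\<dots> \<le> 2 + p * (\<Sum>i<t. 2 * (82 * c ^ (t - 1 - i)))"
  proof (intro add_mono mult_left_mono p sum_mono mult_mono)
    have "mpow L a t u v \<le> row_sum L a t u" by (intro mpow_le_row_sum a)
    then show "mpow L a t u v \<le> 2" using row[OF uv(1), of t] by linarith
    show "0 \<le> S (t - 1 - i)" for i unfolding S_def by (intro sum_nonneg mpow_nonneg add_nonneg_nonneg p a)
  qed (use row uv S in auto)
  also have "(\<Sum>i<t. 2 * (82 * c ^ (t - 1 - i))) = 164 * (\<Sum>i<t. c ^ (t - 1 - i))"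
    by (simp add: sum_distrib_left)
  also have "(\<Sum>i<t. c ^ (t - 1 - i)) = (\<Sum>i<t. c ^ i)"
    by (subst sum.nat_diff_reindex[symmetric]) simp
  also have "\<dots> = (c ^ t - 1) / (c - 1)" using c by (intro geometric_sum) auto
  also have "2 + p * (164 * ((c ^ t - 1) / (c - 1))) \<le> 2 * (c ^ t / card L) + p * (164 * (c ^ t / (5 / 100)))"
    using c p big L0 by (intro add_mono mult_left_mono frac_le) (auto simp: field_simps)
  also have "2 * (c ^ t / card L) + p * (164 * (c ^ t / (5 / 100))) = 2 * (c ^ t / card L) + c / card L * (164 * (c ^ t / (5 / 100)))"
    using c(1) L0 by simp
  also have "2 * (c ^ t / card L) + c / card L * (164 * (c ^ t / (5 / 100))) = (2 + 3280 * c) * (c ^ t / card L)"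
    by (simp add: algebra_simps add_divide_distrib)
  also have "\<dots> \<le> 4000 * (c ^ t / card L)" using c(2,3) by (intro mult_right_mono) auto
  finally show ?thesis .
qed

subsection \<open>Walks inside a snake\<close>

definition arc_of :: "clause set \<Rightarrow> lit \<Rightarrow> lit \<Rightarrow> real" where
  "arc_of G u v = of_bool ({neg u, v} \<in> G)"

lemma arc_of_nonneg: "arc_of G u v \<ge> 0"
  by (simp add: arc_of_def)

lemma arc_of_contrapos: "arc_of G u v = arc_of G (neg v) (neg u)"
  by (simp add: arc_of_def insert_commute)

lemma row_step_le_1:
  assumes "finite L" "\<And>v. v \<in> L \<Longrightarrow> {neg u, v} \<in> G \<Longrightarrow> v = v1"
  shows "row_sum L (arc_of G) (Suc i) u \<le> row_sum L (arc_of G) i v1"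
proof -
  have r0: "row_sum L (arc_of G) i y \<ge> 0" for y by (intro row_sum_nonneg arc_of_nonneg)
  have "row_sum L (arc_of G) (Suc i) u \<le> (\<Sum>y\<in>L. if y = v1 then row_sum L (arc_of G) i v1 else 0)"
    unfolding row_sum.simps
  proof (rule sum_mono)
    fix y assume "y \<in> L"
    then show "arc_of G u y * row_sum L (arc_of G) i y \<le> (if y = v1 then row_sum L (arc_of G) i v1 else 0)"
      using assms(2)[of y] r0[of v1] by (cases "{neg u, y} \<in> G") (simp_all add: arc_of_def)
  qed
  also have "\<dots> \<le> row_sum L (arc_of G) i v1" using assms(1) r0 by (simp add: sum.delta)
  finally show ?thesis .
qed

lemma row_step_le_2:
  assumes "finite L" "\<And>v. v \<in> L \<Longrightarrow> {neg u, v} \<in> G \<Longrightarrow> v = v1 \<or> v = v2"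
  shows "row_sum L (arc_of G) (Suc i) u \<le> row_sum L (arc_of G) i v1 + row_sum L (arc_of G) i v2"
proof -
  have r0: "row_sum L (arc_of G) i y \<ge> 0" for y by (intro row_sum_nonneg arc_of_nonneg)
  have "row_sum L (arc_of G) (Suc i) u \<le>
      (\<Sum>y\<in>L. (if y = v1 then row_sum L (arc_of G) i v1 else 0) + (if y = v2 then row_sum L (arc_of G) i v2 else 0))"
    unfolding row_sum.simps using assms(2) r0 by (intro sum_mono) (auto simp: arc_of_def)
  also have "\<dots> \<le> row_sum L (arc_of G) i v1 + row_sum L (arc_of G) i v2"
    using assms(1) r0 by (simp add: sum.distrib sum.delta)
  finally show ?thesis .
qed

text \<open>With x = \<open>W t\<close>: two implication paths of t arcs each, from
  \<open>neg x\<close> to x and back, on distinct variables. Having x in the middle makes reversal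
  with negation a symmetry and keeps the only branching literals, x and \<open>neg x\<close>, t
  steps apart.\<close>

locale snake =
  fixes W :: "nat \<Rightarrow> lit" and t :: nat
  assumes ends: "W 0 = neg (W t)" "W (2 * t) = neg (W t)"
    and inj: "inj_on (fst \<circ> W) {0<..<2 * t}" and t: "t \<ge> 2"
begin

definition G :: "clause set" where "G = {{neg (W i), W (Suc i)} |i. i < 2 * t}"

lemma same_var: "fst (W i) = fst (W j) \<Longrightarrow> 0 < i \<Longrightarrow> i < 2 * t \<Longrightarrow> 0 < j \<Longrightarrow> j < 2 * t \<Longrightarrow> i = j"
  using inj_onD[OF inj, of i j] by simp

lemma same_var': "fst (W i) = fst (W j) \<Longrightarrow> 0 < i \<Longrightarrow> i < 2 * t \<Longrightarrow> j \<le> 2 * t \<Longrightarrow> i = j \<or> i = t"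
proof -
  assume *: "fst (W i) = fst (W j)" "0 < i" "i < 2 * t" "j \<le> 2 * t"
  consider "j = 0 \<or> j = 2 * t" | "0 < j" "j < 2 * t" using *(4) by linarith
  then show ?thesis
  proof cases
    case 1
    then have "fst (W j) = fst (W t)" using ends by (elim disjE) simp_all
    then have "fst (W i) = fst (W t)" using *(1) by simp
    then show ?thesis using same_var[of i t] * t by simp
  qed (use same_var * in blast)
qed

lemma arcE:
  assumes "{neg u, v} \<in> G"
  obtains i where "i < 2 * t" "u = W i" "v = W (Suc i)" | i where "i < 2 * t" "u = neg (W (Suc i))" "v = neg (W i)"
proof -
  obtain i where i: "i < 2 * t" "{neg u, v} = {neg (W i), W (Suc i)}" using assms by (auto simp: G_def)
  then consider "neg u = neg (W i)" "v = W (Suc i)" | "neg u = W (Suc i)" "v = neg (W i)"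
    unfolding doubleton_eq_iff by blast
  then show thesis
  proof cases
    case 1 then show thesis using i that(1) by simp
  next
    case 2 then show thesis using i that(2) neg_eq_swap by blast
  qed
qed

lemma succ_inner:
  assumes "0 < i" "i < 2 * t" "i \<noteq> t" "{neg (W i), v} \<in> G"
  shows "v = W (Suc i)"
  using assms(4)
proof (cases rule: arcE)
  case (1 k)
  then show ?thesis using same_var'[of i k] assms by auto
next
  case (2 k)
  then have "i = Suc k" using same_var'[of i "Suc k"] assms by auto
  then show ?thesis using 2 by simp
qed

text \<open>Besides the next arc there is the contrapositive of the last one, which leads from
  \<open>W (2 * t - 1)\<close> to \<open>neg (W t)\<close>.\<close>

lemma succ_center:
  assumes "{neg (W t), v} \<in> G"
  shows "v = W (Suc t) \<or> v = neg (W (2 * t - 1))"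
  using assms
proof (cases rule: arcE)
  case (1 k)
  show ?thesis
  proof (cases "k = 0")
    case True
    then show ?thesis using 1 ends by simp
  next
    case False
    then have "k = t" using same_var[of k t] 1 t by auto
    then show ?thesis using 1 by simp
  qed
next
  case (2 k)
  show ?thesis
  proof (cases "Suc k = 2 * t")
    case True
    then have "k = 2 * t - 1" by simp
    then show ?thesis using 2 by simp
  next
    case False
    then have "Suc k = t" using same_var[of "Suc k" t] 2 t by auto
    then show ?thesis using 2 by simp
  qed
qed

text \<open>All arcs contraposed. By \<open>rev_G\<close> the clauses stay the same, so statements
  about \<open>W j\<close> transfer to \<open>neg (W j)\<close>.\<close>

lemma rev_snake: "snake (\<lambda>i. neg (W (2 * t - i))) t"
proof
  show "inj_on (fst \<circ> (\<lambda>i. neg (W (2 * t - i)))) {0<..<2 * t}"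
  proof (rule inj_onI)
    fix i j assume "i \<in> {0<..<2 * t}" "j \<in> {0<..<2 * t}"
      "(fst \<circ> (\<lambda>i. neg (W (2 * t - i)))) i = (fst \<circ> (\<lambda>i. neg (W (2 * t - i)))) j"
    then show "i = j" using same_var[of "2 * t - i" "2 * t - j"] by auto
  qed
qed (use ends t in auto)

lemma rev_G: "snake.G (\<lambda>i. neg (W (2 * t - i))) t = G"
proof -
  interpret r: snake "\<lambda>i. neg (W (2 * t - i))" t by (rule rev_snake)
  have sub: "{neg (neg (W (2 * t - i))), neg (W (2 * t - Suc i))} =
      {neg (W (2 * t - Suc i)), W (Suc (2 * t - Suc i))}" if "i < 2 * t" for i
  proof -
    have "Suc (2 * t - Suc i) = 2 * t - i" using that by simp
    then show ?thesis by (simp add: insert_commute)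
  qed
  show ?thesis
  proof (intro equalityI subsetI)
    fix C assume "C \<in> r.G"
    then obtain i where "i < 2 * t" "C = {neg (neg (W (2 * t - i))), neg (W (2 * t - Suc i))}"
      unfolding r.G_def by blast
    then show "C \<in> G" unfolding G_def using sub[of i]
      by (intro CollectI exI[of _ "2 * t - Suc i"]) auto
  next
    fix C assume "C \<in> G"
    then obtain i where i: "i < 2 * t" "C = {neg (W i), W (Suc i)}" unfolding G_def by blast
    have "2 * t - Suc (2 * t - Suc i) = i" using i(1) by simp
    then have "C = {neg (neg (W (2 * t - (2 * t - Suc i)))), neg (W (2 * t - Suc (2 * t - Suc i)))}"
      using sub[of "2 * t - Suc i"] i by simp
    then show "C \<in> r.G" unfolding r.G_def using i
      by (intro CollectI exI[of _ "2 * t - Suc i"]) simp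
  qed
qed

lemma row_before_center:
  assumes "finite L" "0 < j"
  shows "(j + i \<le> t \<or> (t < j \<and> j + i \<le> 2 * t)) \<Longrightarrow> row_sum L (arc_of G) i (W j) \<le> 1"
  using assms(2)
proof (induction i arbitrary: j)
  case (Suc i)
  have "row_sum L (arc_of G) (Suc i) (W j) \<le> row_sum L (arc_of G) i (W (Suc j))"
    using Suc.prems by (intro row_step_le_1 assms(1) succ_inner) auto
  also have "\<dots> \<le> 1" using Suc.prems by (intro Suc.IH) auto
  finally show ?case .
qed simp

lemma row_center:
  assumes "finite L" "i \<le> t"
  shows "row_sum L (arc_of G) i (W t) \<le> 2"
proof (cases i)
  case (Suc j)
  interpret r: snake "\<lambda>i. neg (W (2 * t - i))" t by (rule rev_snake)
  have "row_sum L (arc_of G) (Suc j) (W t) \<le>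
      row_sum L (arc_of G) j (W (Suc t)) + row_sum L (arc_of G) j (neg (W (2 * t - 1)))"
    by (intro row_step_le_2 assms(1) succ_center)
  also have "\<dots> \<le> 1 + 1"
    using r.row_before_center[OF assms(1), of 1 j] assms Suc
    by (intro add_mono row_before_center) (auto simp: rev_G)
  finally show ?thesis using Suc by simp
qed simp

text \<open>A walk is forced until it leaves \<open>W t\<close> or \<open>neg (W t)\<close>, where
  it may split in two. The next such literal is t steps further on, so walks of at most t steps
  split at most once.\<close>

lemma row_on_walk:
  assumes "finite L" "i \<le> t" "j \<le> 2 * t"
  shows "row_sum L (arc_of G) i (W j) \<le> 2"
  using assms(2,3)
proof (induction i arbitrary: j)
  case (Suc i)
  interpret r: snake "\<lambda>i. neg (W (2 * t - i))" t by (rule rev_snake)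
  consider "j = 0 \<or> j = 2 * t" | "j = t" | "0 < j" "j < 2 * t" "j \<noteq> t" using Suc.prems by linarith
  then show ?case
  proof cases
    case 1
    then have "W j = neg (W t)" using ends by auto
    moreover have "row_sum L (arc_of G) (Suc i) (neg (W t)) \<le> 2"
      using r.row_center[OF assms(1) Suc.prems(1)] by (simp only: rev_G) (simp add: mult_2)
    ultimately show ?thesis by simp
  next
    case 2
    then show ?thesis using row_center[OF assms(1) Suc.prems(1)] by simp
  next
    case 3
    have "row_sum L (arc_of G) (Suc i) (W j) \<le> row_sum L (arc_of G) i (W (Suc j))"
      using 3 by (intro row_step_le_1 assms(1) succ_inner)
    also have "\<dots> \<le> 2" using Suc.prems 3 by (intro Suc.IH) auto
    finally show ?thesis .
  qed
qed simp

definition support :: "lit set" where "support = W ` {..2 * t} \<union> neg ` W ` {..2 * t}"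

lemma row_off_support:
  assumes "u \<notin> support"
  shows "row_sum L (arc_of G) (Suc i) u = 0"
proof -
  have "{neg u, v} \<notin> G" for v
  proof
    assume "{neg u, v} \<in> G"
    then show False
      by (cases rule: arcE) (use assms in \<open>auto simp: support_def\<close>)
  qed
  then show ?thesis by (simp add: arc_of_def)
qed

lemma row_le_2:
  assumes "finite L" "i \<le> t"
  shows "row_sum L (arc_of G) i u \<le> 2"
proof (cases i)
  case (Suc i')
  interpret r: snake "\<lambda>i. neg (W (2 * t - i))" t by (rule rev_snake)
  show ?thesis
  proof (cases "u \<in> support")
    case True
    then consider j where "j \<le> 2 * t" "u = W j" | j where "j \<le> 2 * t" "u = neg (W j)"
      unfolding support_def by auto
    then show ?thesis
    proof cases
      case 1
      then show ?thesis using row_on_walk[OF assms] by simp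
    next
      case (2 j)
      then show ?thesis using r.row_on_walk[OF assms, of "2 * t - j"] by (simp add: rev_G)
    qed
  next
    case False
    then show ?thesis using row_off_support Suc by simp
  qed
qed simp

text \<open>Only the O(t) literals on the snake have successors; this total supplies
  \<open>D\<close> in \<open>mpow_bound\<close>. At \<open>i = 0\<close> it would be
  \<open>card L\<close>.\<close>

lemma sum_row_le:
  assumes "finite L" "1 \<le> i" "i \<le> t"
  shows "(\<Sum>u\<in>L. row_sum L (arc_of G) i u) \<le> 12 * real t"
proof -
  obtain i' where i: "i = Suc i'" using assms(2) by (cases i) auto
  have fin: "finite support" by (simp add: support_def)
  have "card support \<le> card (W ` {..2 * t}) + card (neg ` W ` {..2 * t})"
    unfolding support_def by (rule card_Un_le)
  also have "\<dots> \<le> (2 * t + 1) + (2 * t + 1)"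
    using card_image_le[of "{..2 * t}" W] card_image_le[of "W ` {..2 * t}" neg] by simp
  finally have card: "card support \<le> 6 * t" using t by simp
  have "(\<Sum>u\<in>L. row_sum L (arc_of G) i u) = (\<Sum>u\<in>L \<inter> support. row_sum L (arc_of G) i u)"
    using assms(1) row_off_support unfolding i by (intro sum.mono_neutral_right) auto
  also have "\<dots> \<le> (\<Sum>u\<in>L \<inter> support. 2)" by (intro sum_mono row_le_2 assms)
  also have "\<dots> = 2 * real (card (L \<inter> support))" by simp
  also have "card (L \<inter> support) \<le> card support" using fin by (intro card_mono) auto
  finally show ?thesis using card by simp
qed

end

subsection \<open>The 2-SAT threshold from above\<close>

lemma walk_truth:
  assumes "\<forall>C\<in>set (walk_clauses (u # W)). \<exists>(i, b)\<in>C. \<sigma> i = b" "\<sigma> (fst u) = snd u" "v \<in> set (u # W)"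
  shows "\<sigma> (fst v) = snd v"
  using assms
proof (induction W arbitrary: u)
  case (Cons y W)
  have "\<exists>(i, b)\<in>{neg u, y}. \<sigma> i = b" using Cons.prems(1) by simp
  then have "\<sigma> (fst y) = snd y" using Cons.prems(2) by (auto simp: case_prod_beta)
  with Cons.prems Cons.IH[of y] show ?case by auto
qed simp

lemma unsat_closed_bicycle:
  assumes "set (bicycle w p (neg (w ! p))) \<subseteq> set F" "p < length w"
  shows "\<not> satisfiable F"
proof
  assume "satisfiable F"
  then obtain \<sigma> where \<sigma>: "\<forall>C\<in>set F. \<exists>(i, b)\<in>C. \<sigma> i = b" unfolding satisfiable_def by blast
  define x where "x = w ! p"
  obtain a b where w: "w = a @ x # b" using id_take_nth_drop[OF assms(2)] unfolding x_def by blast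
  have c: "\<forall>C\<in>set (walk_clauses (neg x # w @ [neg x])). \<exists>(i, b)\<in>C. \<sigma> i = b"
    using assms(1) \<sigma> unfolding bicycle_def x_def by blast
  have x: "x \<in> set w" using assms(2) by (simp add: x_def)
  show False
  proof (cases "\<sigma> (fst x) = snd x")
    case False
    then have "\<sigma> (fst (neg x)) = snd (neg x)" by simp
    from walk_truth[OF c this, of x] x False show False by simp
  next
    case True
    have "walk_clauses (neg x # w @ [neg x]) = walk_clauses ((neg x # a) @ [x]) @ walk_clauses (x # b @ [neg x])"
      using walk_clauses_append[of "neg x # a" x "b @ [neg x]"] by (simp add: w)
    then have "\<forall>C\<in>set (walk_clauses (x # b @ [neg x])). \<exists>(i, b)\<in>C. \<sigma> i = b"
      using c by simp
    from walk_truth[OF this True, of "neg x"] True show False by simp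
  qed
qed

section \<open>Counting snakes, and snakes as closed bicycles\<close>

definition var_distinct :: "nat \<Rightarrow> nat \<Rightarrow> lit list set" where
  "var_distinct n s = {w \<in> tuples (lits n) s. distinct (map fst w)}"

lemma finite_var_distinct [simp]: "finite (var_distinct n s)"
  by (simp add: var_distinct_def)

lemma card_var_distinct_ge:
  assumes "s \<le> n"
  shows "real (card (var_distinct n s)) \<ge> (\<Prod>i<s. 2 * (real n - real i))"
  using assms
proof (induction s)
  case 0
  have "var_distinct n 0 = {[]}" by (auto simp: var_distinct_def)
  then show ?case by simp
next
  case (Suc s)
  have card: "real (card (var_distinct n s)) = (\<Sum>w\<in>tuples (lits n) s. of_bool (distinct (map fst w)))" for s
    unfolding var_distinct_def of_bool_def by (subst sum.inter_filter[symmetric]) simp_all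
  have row: "of_bool (distinct (map fst w)) * (2 * (real n - real s)) \<le>
      (\<Sum>x\<in>lits n. of_bool (distinct (map fst (x # w))))" if "w \<in> tuples (lits n) s" for w
  proof (cases "distinct (map fst w)")
    case True
    have len: "length w = s" using that by (simp add: tuples_def)
    have "(\<Sum>x\<in>lits n. of_bool (distinct (map fst (x # w)))) = (\<Sum>x\<in>lits n. 1 - of_bool (fst x \<in> fst ` set w) :: real)"
      using True by (intro sum.cong) auto
    also have "\<dots> = 2 * real n - real (card {x \<in> lits n. fst x \<in> fst ` set w})"
      unfolding sum_subtractf of_bool_def by (subst sum.inter_filter[symmetric]) simp_all
    also have "\<dots> \<ge> 2 * real n - 2 * real s"
      using card_lits_on_vars[of n w] len by simp
    finally show ?thesis using True by simp
  next
    case False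
    then show ?thesis by (simp add: sum_nonneg)
  qed
  have "(\<Prod>i<Suc s. 2 * (real n - real i)) \<le> real (card (var_distinct n s)) * (2 * (real n - real s))"
    unfolding prod.lessThan_Suc using Suc by (intro mult_right_mono) auto
  also have "\<dots> = (\<Sum>w\<in>tuples (lits n) s. of_bool (distinct (map fst w)) * (2 * (real n - real s)))"
    by (simp only: card sum_distrib_right)
  also have "\<dots> \<le> (\<Sum>w\<in>tuples (lits n) s. \<Sum>x\<in>lits n. of_bool (distinct (map fst (x # w))))"
    by (intro sum_mono row)
  also have "\<dots> = real (card (var_distinct n (Suc s)))"
    unfolding card sum_tuples_Suc by (rule sum.swap)
  finally show ?case .
qed

text \<open>By Bernoulli's inequality, distinctness of the variables costs at most a fraction s^2 /
  n of all tuples.\<close>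

lemma card_var_distinct_ge_half:
  assumes "2 * s\<^sup>2 \<le> n" "s \<ge> 1"
  shows "real (card (var_distinct n s)) \<ge> (2 * real n) ^ s / 2"
proof -
  have sn: "2 * (s * s) \<le> n" using assms(1) by (simp add: power2_eq_square)
  have "s * 1 \<le> s * s" using assms(2) by (intro mult_left_mono) auto
  then have le: "s \<le> n" using sn by linarith
  have n: "real n > 0" using le assms(2) by simp
  have "(2 * real n) ^ s / 2 \<le> (2 * real n) ^ s * (1 + real s * (- real s / real n))"
  proof -
    have "real (2 * (s * s)) \<le> real n" using sn by (simp only: of_nat_le_iff)
    then have "1 / 2 \<le> 1 + real s * (- real s / real n)" using n by (simp add: field_simps)
    then have "(2 * real n) ^ s * (1 / 2) \<le> (2 * real n) ^ s * (1 + real s * (- real s / real n))"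
      by (intro mult_left_mono) auto
    then show ?thesis by simp
  qed
  also have "\<dots> \<le> (2 * real n) ^ s * (1 + (- real s / real n)) ^ s"
    using le n by (intro mult_left_mono Bernoulli_inequality) (auto simp: field_simps)
  also have "\<dots> = (\<Prod>i<s. 2 * (real n - real s))"
  proof -
    have "2 * real n * (1 + - real s / real n) = 2 * (real n - real s)" using n by (simp add: field_simps)
    then show ?thesis by (simp only: prod_constant card_lessThan power_mult_distrib[symmetric])
  qed
  also have "\<dots> \<le> (\<Prod>i<s. 2 * (real n - real i))"
    using le by (intro prod_mono) auto
  also have "\<dots> \<le> real (card (var_distinct n s))" by (rule card_var_distinct_ge[OF le])
  finally show ?thesis .
qed

lemma card_kclauses_2: "real (card (kclauses n 2)) = 2 * real n * (real n - 1)"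
proof (cases n)
  case (Suc k)
  have "n choose 2 = n * (n - 1) div 2" by (rule choose_two)
  moreover have "even (n * (n - 1))" using Suc by simp
  ultimately have "2 * (n choose 2) = n * (n - 1)" by simp
  then have "2 * real (n choose 2) = real n * (real n - 1)"
    using Suc by (metis of_nat_mult of_nat_numeral of_nat_diff le_add1 plus_1_eq_Suc of_nat_1)
  then show ?thesis by (simp add: card_kclauses)
qed (simp add: card_kclauses)

text \<open>The literal put in front shifts indices by one: the centre \<open>w ! j\<close> is
  \<open>W (Suc j)\<close>, so the half-length is \<open>Suc j\<close>.\<close>

lemma snake_bicycle:
  assumes w: "w \<in> var_distinct n (2 * j + 1)" and j: "j \<ge> 1"
  defines "W \<equiv> (\<lambda>i. (neg (w ! j) # w @ [neg (w ! j)]) ! i)"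
  shows "snake W (Suc j)" and "snake.G W (Suc j) = set (bicycle w j (neg (w ! j)))"
proof -
  have len: "length w = 2 * j + 1" and d: "distinct (map fst w)"
    using w by (auto simp: var_distinct_def tuples_def)
  have W: "W i = w ! (i - 1)" if "0 < i" "i < 2 * Suc j" for i
    using that len by (cases i) (auto simp: W_def nth_append)
  have "W (2 * Suc j) = neg (w ! j)" using len by (simp add: W_def nth_append)
  moreover have "W (Suc j) = w ! j" using W[of "Suc j"] by simp
  moreover have "W 0 = neg (w ! j)" by (simp add: W_def)
  moreover have "inj_on (fst \<circ> W) {0<..<2 * Suc j}"
  proof (rule inj_onI)
    fix a b assume ab: "a \<in> {0<..<2 * Suc j}" "b \<in> {0<..<2 * Suc j}" "(fst \<circ> W) a = (fst \<circ> W) b"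
    then have l: "a - 1 < length (map fst w)" "b - 1 < length (map fst w)" using len by auto
    moreover have "map fst w ! (a - 1) = map fst w ! (b - 1)"
      using W[of a] W[of b] ab l by (simp del: One_nat_def)
    ultimately have "a - 1 = b - 1" using d by (simp only: nth_eq_iff_index_eq)
    then show "a = b" using ab by auto
  qed
  ultimately show s: "snake W (Suc j)" using j by unfold_locales auto
  interpret snake W "Suc j" by (rule s)
  show "G = set (bicycle w j (neg (w ! j)))"
    unfolding G_def bicycle_def set_conv_nth length_walk_clauses
    by (intro Collect_cong iff_exI) (auto simp: walk_clauses_nth W_def len simp del: nth_Cons_Suc)
qed

text \<open>For \<open>j = 0\<close> the two end clauses would collapse to single literals.\<close>

lemma bicycle_in_kclauses:
  assumes w: "w \<in> var_distinct n (2 * j + 1)" and j: "j \<ge> 1"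
  shows "set (bicycle w j (neg (w ! j))) \<subseteq> kclauses n 2"
proof
  let ?W = "neg (w ! j) # w @ [neg (w ! j)]"
  have len: "length w = 2 * j + 1" and d: "distinct (map fst w)" and L: "set w \<subseteq> lits n"
    using w by (auto simp: var_distinct_def tuples_def)
  have wL: "w ! i \<in> lits n" if "i < 2 * j + 1" for i using L len that nth_mem[of i w] by auto
  have ne: "fst (w ! a) \<noteq> fst (w ! b)" if "a \<noteq> b" "a < 2 * j + 1" "b < 2 * j + 1" for a b
    using that d len by (metis distinct_conv_nth length_map nth_map)
  fix C assume "C \<in> set (bicycle w j (neg (w ! j)))"
  then obtain i where i: "i < 2 * j + 2" "C = {neg (?W ! i), ?W ! Suc i}"
    using len by (auto simp: bicycle_def set_conv_nth length_walk_clauses walk_clauses_nth simp del: nth_Cons_Suc)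
  consider "i = 0" | k where "i = Suc k" "k < 2 * j" | "i = 2 * j + 1"
    using i(1) by (cases i) (auto, linarith)
  then show "C \<in> kclauses n 2"
  proof cases
    case 1
    have "?W ! Suc 0 = w ! 0" using len by (simp add: nth_append)
    then show ?thesis using i 1 wL[of j] wL[of 0] ne[of j 0] j by (simp add: pair_in_kclauses_2)
  next
    case (2 k)
    have "?W ! i = w ! k" "?W ! Suc i = w ! Suc k" using len 2 by (simp_all add: nth_append)
    then show ?thesis using i 2 wL[of k] wL[of "Suc k"] ne[of k "Suc k"] by (simp add: pair_in_kclauses_2)
  next
    case 3
    have "?W ! i = w ! (2 * j)" "?W ! Suc i = neg (w ! j)" using len 3 by (simp_all add: nth_append)
    then show ?thesis using i 3 wL[of "2 * j"] wL[of j] ne[of "2 * j" j] j by (simp add: pair_in_kclauses_2)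
  qed
qed

text \<open>Dropping the distinctness of variables only adds nonnegative terms; cutting at the
  centre x then leaves two unconstrained walks of \<open>Suc j\<close> arcs.\<close>

lemma sum_closed_walks:
  assumes "\<And>u v. f u v \<ge> 0"
  shows "(\<Sum>w\<in>var_distinct n (2 * j + 1). walk_prod f (neg (w ! j) # w @ [neg (w ! j)])) \<le>
    (\<Sum>x\<in>lits n. mpow (lits n) f (Suc j) (neg x) x * mpow (lits n) f (Suc j) x (neg x))"
proof -
  let ?T = "tuples (lits n)"
  have "(\<Sum>w\<in>var_distinct n (2 * j + 1). walk_prod f (neg (w ! j) # w @ [neg (w ! j)])) \<le>
      (\<Sum>w\<in>?T (j + Suc j). walk_prod f (neg (w ! j) # w @ [neg (w ! j)]))"
    by (intro sum_mono2 walk_prod_nonneg assms) (auto simp: var_distinct_def mult_2)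
  also have "\<dots> = (\<Sum>w1\<in>?T j. \<Sum>x\<in>lits n. \<Sum>w2\<in>?T j. walk_prod f (neg x # w1 @ [x]) * walk_prod f (x # w2 @ [neg x]))"
    unfolding sum_tuples_add sum_tuples_Suc
  proof (intro sum.cong refl)
    fix w1 x w2 assume "w1 \<in> ?T j"
    then have "(w1 @ x # w2) ! j = x" by (simp add: tuples_def nth_append)
    then show "walk_prod f (neg ((w1 @ x # w2) ! j) # (w1 @ x # w2) @ [neg ((w1 @ x # w2) ! j)]) =
        walk_prod f (neg x # w1 @ [x]) * walk_prod f (x # w2 @ [neg x])"
      using walk_prod_append[of f "neg x # w1" x "w2 @ [neg x]"] by simp
  qed
  also have "\<dots> = (\<Sum>x\<in>lits n. \<Sum>w1\<in>?T j. \<Sum>w2\<in>?T j. walk_prod f (neg x # w1 @ [x]) * walk_prod f (x # w2 @ [neg x]))"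
    by (rule sum.swap)
  also have "\<dots> = (\<Sum>x\<in>lits n. (\<Sum>w1\<in>?T j. walk_prod f (neg x # w1 @ [x])) * (\<Sum>w2\<in>?T j. walk_prod f (x # w2 @ [neg x])))"
    by (simp only: sum_product)
  also have "\<dots> = (\<Sum>x\<in>lits n. mpow (lits n) f (Suc j) (neg x) x * mpow (lits n) f (Suc j) x (neg x))"
    by (intro sum.cong refl) (simp only: sum_walk_prod_eq_mpow[OF finite_lits] neg_in_lits)
  finally show ?thesis .
qed

text \<open>Second moment method for snakes with \<open>2 * t\<close> arcs. The bound on t^2 keeps
  corrections of order t^2 / n small, and \<open>big\<close> makes walks long enough to
  equidistribute over the literals.\<close>

lemma prob_unsat_2SAT_ge:
  fixes n m j :: nat
  defines "t \<equiv> Suc j" and "c \<equiv> real m / (real n - 1)"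
  assumes j: "j \<ge> 1" and n: "n \<ge> 21" and tn: "1000 * t\<^sup>2 \<le> n"
    and c: "105 / 100 \<le> c" "c \<le> 12 / 10" and big: "c ^ t \<ge> 2 * real n"
  shows "measure_pmf.prob (random_formula 2 n m) {F. \<not> satisfiable F} \<ge> 1 / 128000000"
proof -
  let ?K = "kclauses n 2" and ?L = "lits n"
  define P where "P = measure_pmf.prob (random_formula 2 n m)"
  have P0: "P B \<ge> 0" for B unfolding P_def by (rule measure_nonneg)
  define p where "p = real m / real (card ?K)"
  define Sn where "Sn = var_distinct n (2 * j + 1)"
  define cl where "cl = (\<lambda>w. set (bicycle w j (neg (w ! j))))"
  define A where "A = (\<lambda>w. {F. cl w \<subseteq> set F})"
  \<comment> \<open>This is 2n (4000 c^t / 2n)^2: a choice of the centre of the second snake, and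
    one matrix entry for each of its halves.\<close>
  define Z where "Z = 16000000 * (c ^ t)\<^sup>2 / (2 * real n)"
  have n1: "real n > 1" using n by simp
  have N: "real (card ?K) = 2 * real n * (real n - 1)" by (rule card_kclauses_2)
  have N0: "real (card ?K) > 0" using n1 by (simp add: N)
  have p0: "p \<ge> 0" by (simp add: p_def)
  have cp: "c = real (card ?L) * p" using n1 by (simp add: p_def N c_def)
  have ppos: "p > 0" using c(1) cp p0 by (cases "p = 0") auto
  have mc: "real m = c * (real n - 1)" using n1 by (simp add: c_def)
  \<comment> \<open>The assumption \<open>n \<ge> 21\<close> comes from here: it is equivalent to
    1.05 (n - 1) \<ge> n.\<close>
  have mn: "real m \<ge> real n"
  proof -
    have "105 / 100 * (real n - 1) \<le> c * (real n - 1)" using c n1 by (intro mult_right_mono) auto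
    then show ?thesis using mc n by simp
  qed
  have t2: "t \<ge> 2" using j by (simp add: t_def)
  have tn': "1000 * (real t)\<^sup>2 \<le> real n"
  proof -
    have "real (1000 * t\<^sup>2) \<le> real n" using tn by (simp only: of_nat_le_iff)
    then show ?thesis by simp
  qed
  have tt: "real t \<le> (real t)\<^sup>2" using t2 by (simp add: power2_eq_square)
  have pn: "p * real n \<le> 6 / 10" using cp c by simp
  have pt: "p * real t \<le> 1 / 1000"
  proof -
    have "1000 * real t \<le> real n" using tt tn' by linarith
    then have "p * (1000 * real t) \<le> p * real n" using p0 by (intro mult_left_mono)
    then show ?thesis using pn by simp
  qed
  have ptt: "p * (real t)\<^sup>2 \<le> 6 / 10000"
  proof -
    have "p * (1000 * (real t)\<^sup>2) \<le> p * real n" using tn' p0 by (intro mult_left_mono) auto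
    then show ?thesis using pn by simp
  qed
  have len: "length w = 2 * j + 1" "distinct (map fst w)" "w \<in> tuples ?L (2 * j + 1)" if "w \<in> Sn" for w
    using that by (simp_all add: Sn_def var_distinct_def tuples_def)
  have card_cl: "card (cl w) = 2 * t" if "w \<in> Sn" for w
  proof -
    have "distinct (bicycle w j (neg (w ! j)))" using len[OF that] by (intro distinct_bicycle) auto
    then show ?thesis using len[OF that] by (simp add: cl_def distinct_card t_def)
  qed
  \<comment> \<open>The falling factorial and the factor (1 - 2t / N)^m each lose at most a quarter
    by Bernoulli's inequality, and 9/16 \<ge> 1/2.\<close>
  have low: "P (A w) \<ge> p ^ (2 * t) / 2" if w: "w \<in> Sn" for w
  proof -
    have m0: "real m > 0" using mn n by simp
    have "2 * real t \<le> real m" using tn' tt mn by linarith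
    then have q: "1 - 2 * real t / real m \<ge> 0" using m0 by (simp add: divide_le_eq)
    have a: "(\<Prod>i<2 * t. (real m - real i) / real (card ?K)) \<ge> p ^ (2 * t) * (3 / 4)"
    proof -
      have "3 / 4 \<le> 1 + real (2 * t) * (- (2 * real t / real m))"
      proof -
        have "4 * (real t)\<^sup>2 / real m \<le> 1 / 4" using tn' mn m0 by (simp add: divide_le_eq)
        then show ?thesis by (simp add: power2_eq_square)
      qed
      also have "\<dots> \<le> (1 + - (2 * real t / real m)) ^ (2 * t)"
        using q by (intro Bernoulli_inequality) auto
      finally have "p ^ (2 * t) * (3 / 4) \<le> p ^ (2 * t) * (1 - 2 * real t / real m) ^ (2 * t)"
        using p0 by (intro mult_left_mono) auto
      also have "\<dots> = (\<Prod>i<2 * t. p * (1 - 2 * real t / real m))" by (simp add: power_mult_distrib)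
      also have "\<dots> \<le> (\<Prod>i<2 * t. (real m - real i) / real (card ?K))"
      proof (intro prod_mono conjI)
        fix i assume i: "i \<in> {..<2 * t}"
        show "0 \<le> p * (1 - 2 * real t / real m)" using p0 q by simp
        have "p * (1 - 2 * real t / real m) = (real m - 2 * real t) / real (card ?K)"
          using m0 by (simp add: p_def right_diff_distrib diff_divide_distrib)
        also have "\<dots> \<le> (real m - real i) / real (card ?K)" 
        proof (intro divide_right_mono)
          have "real i \<le> real (2 * t)" using i by (simp only: of_nat_le_iff lessThan_iff)
          then show "real m - 2 * real t \<le> real m - real i" by simp
        qed (use N0 in simp)
        finally show "p * (1 - 2 * real t / real m) \<le> (real m - real i) / real (card ?K)" .
      qed
      finally show ?thesis .
    qed
    have b: "(1 - real (2 * t) / real (card ?K)) ^ m \<ge> 3 / 4"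
    proof -
      have "real (2 * t) / real (card ?K) \<le> 1"
      proof -
        have "2 * real t \<le> real n" using tn' tt by linarith
        then have "real (2 * t) \<le> real n * 1" by simp
        also have "\<dots> \<le> real n * (2 * (real n - 1))" using n by (intro mult_left_mono) simp_all
        also have "\<dots> = real (card ?K)" by (simp only: N mult_ac)
        finally show ?thesis using N0 by (simp add: divide_le_eq)
      qed
      have "real m * (- (real (2 * t) / real (card ?K))) = - 2 * (p * real t)" by (simp add: p_def)
      then have "3 / 4 \<le> 1 + real m * (- (real (2 * t) / real (card ?K)))" using pt by linarith
      also have "\<dots> \<le> (1 + - (real (2 * t) / real (card ?K))) ^ m"
        using \<open>real (2 * t) / real (card ?K) \<le> 1\<close> by (intro Bernoulli_inequality) simp
      finally show ?thesis by simp
    qed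
    have "p ^ (2 * t) / 2 \<le> (p ^ (2 * t) * (3 / 4)) * (3 / 4)" using p0 by simp
    also have "\<dots> \<le> (\<Prod>i<2 * t. (real m - real i) / real (card ?K)) * (1 - real (2 * t) / real (card ?K)) ^ m"
    proof (intro mult_mono a b)
      have "0 \<le> p ^ (2 * t) * (3 / 4)" using p0 by simp
      then show "0 \<le> (\<Prod>i<2 * t. (real m - real i) / real (card ?K))" using a by (rule order_trans)
    qed simp
    also have "\<dots> \<le> P (A w)"
    proof -
      have "cl w \<subseteq> ?K" unfolding cl_def using bicycle_in_kclauses w j by (simp only: Sn_def)
      moreover have "?K \<noteq> {}" using N0 by (intro notI) simp
      ultimately show ?thesis
        unfolding P_def A_def random_formula_def card_cl[OF w, symmetric]
        by (intro prob_replicate_pmf_superset_ge finite_kclauses)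
    qed
    finally show ?thesis .
  qed
  have high: "(\<Sum>w'\<in>Sn. P (A w \<inter> A w')) \<le> p ^ (2 * t) * Z" if w: "w \<in> Sn" for w
  proof -
    interpret snake "\<lambda>i. (neg (w ! j) # w @ [neg (w ! j)]) ! i" t
      unfolding t_def using snake_bicycle(1) w j by (simp add: Sn_def)
    have G: "G = cl w" unfolding t_def cl_def using snake_bicycle(2) w j by (simp add: Sn_def t_def)
    define f where "f = (\<lambda>u v. p + arc_of (cl w) u v)"
    have f0: "f u v \<ge> 0" for u v by (simp add: f_def p0 arc_of_nonneg)
    have pair: "P (A w \<inter> A w') \<le> p ^ (2 * t) * walk_prod f (neg (w' ! j) # w' @ [neg (w' ! j)])"
      if w': "w' \<in> Sn" for w'
    proof -
      have fin: "finite (cl w)" for w by (simp add: cl_def)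
      have "A w \<inter> A w' = {F. cl w \<union> cl w' \<subseteq> set F}" by (auto simp: A_def)
      then have "P (A w \<inter> A w') \<le> (\<Prod>C\<in>cl w \<union> cl w'. real m * pmf (pmf_of_set ?K) C)"
        unfolding P_def random_formula_def using fin prob_replicate_pmf_superset_le[of "cl w \<union> cl w'"] by simp
      also have "\<dots> \<le> (\<Prod>C\<in>cl w \<union> cl w'. p)"
      proof (intro prod_mono conjI)
        fix C
        have "pmf (pmf_of_set ?K) C \<le> 1 / real (card ?K)"
          using N0 by (subst pmf_of_set) (auto simp: card_gt_0_iff indicator_def)
        then have "real m * pmf (pmf_of_set ?K) C \<le> real m * (1 / real (card ?K))" by (intro mult_left_mono) auto
        then show "real m * pmf (pmf_of_set ?K) C \<le> p" by (simp add: p_def)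
      qed simp
      also have "\<dots> = p ^ (2 * t) * (\<Prod>C\<in>cl w' - cl w. p)"
      proof -
        have "(\<Prod>C\<in>cl w \<union> (cl w' - cl w). p) = (\<Prod>C\<in>cl w. p) * (\<Prod>C\<in>cl w' - cl w. p)"
          using fin by (intro prod.union_disjoint) auto
        then show ?thesis by (simp add: card_cl[OF w])
      qed
      \<comment> \<open>A clause shared with the first snake costs 1, a new one costs
        \<open>p\<close>. Raising 1 to p + 1 makes every cost an entry of p J + B, so that the pair
        sum becomes a sum over walks.\<close>
      also have "\<dots> \<le> p ^ (2 * t) * (\<Prod>C\<in>cl w'. p + of_bool (C \<in> cl w))"
      proof (intro mult_left_mono)
        have "(\<Prod>C\<in>cl w' - cl w. p) = (\<Prod>C\<in>cl w'. if C \<in> cl w then 1 else p)"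
          using fin by (simp add: prod.If_cases Diff_eq)
        also have "\<dots> \<le> (\<Prod>C\<in>cl w'. p + of_bool (C \<in> cl w))"
          using p0 by (intro prod_mono) auto
        finally show "(\<Prod>C\<in>cl w' - cl w. p) \<le> (\<Prod>C\<in>cl w'. p + of_bool (C \<in> cl w))" .
      qed (use p0 in simp)
      also have "(\<Prod>C\<in>cl w'. p + of_bool (C \<in> cl w)) = walk_prod f (neg (w' ! j) # w' @ [neg (w' ! j)])"
      proof -
        have "distinct (bicycle w' j (neg (w' ! j)))" using len[OF w'] by (intro distinct_bicycle) simp_all
        then have d: "distinct (walk_clauses (neg (w' ! j) # w' @ [neg (w' ! j)]))" by (simp only: bicycle_def)
        have "cl w' = set (walk_clauses (neg (w' ! j) # w' @ [neg (w' ! j)]))" by (simp only: cl_def bicycle_def)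
        then show ?thesis
          using prod_walk_clauses[OF d, of "\<lambda>C. p + of_bool (C \<in> cl w)"] by (simp only: f_def arc_of_def)
      qed
      finally show ?thesis .
    qed
    have bound: "mpow ?L f t u v \<le> 4000 * (c ^ t / real (card ?L))" if "u \<in> ?L" "v \<in> ?L" for u v
      unfolding f_def
    proof (rule mpow_bound[OF finite_lits arc_of_nonneg p0 cp c, where D = "12 * real t"])
      show "40 * (p * (12 * real t) * real t) \<le> 1" using ptt by (simp add: power2_eq_square)
      show "row_sum ?L (arc_of (cl w)) i u \<le> 2" if "i \<le> t" for i u
        using row_le_2[of ?L i u] that by (simp add: G)
      show "(\<Sum>u\<in>?L. mpow ?L (arc_of (cl w)) i u v) \<le> 2" if "v \<in> ?L" "i \<le> t" for i v
      proof -
        have "(\<Sum>u\<in>?L. mpow ?L (arc_of (cl w)) i u v) = row_sum ?L (arc_of (cl w)) i (neg v)"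
          by (intro column_sum that arc_of_contrapos)
        then show ?thesis using row_le_2[of ?L i "neg v"] that by (simp add: G)
      qed
      show "(\<Sum>u\<in>?L. row_sum ?L (arc_of (cl w)) i u) \<le> 12 * real t" if "1 \<le> i" "i \<le> t" for i
        using sum_row_le[of ?L i] that by (simp add: G)
      show "real (card ?L) \<le> c ^ t" using big by simp
    qed (use that in auto)
    have "(\<Sum>w'\<in>Sn. P (A w \<inter> A w')) \<le> (\<Sum>w'\<in>Sn. p ^ (2 * t) * walk_prod f (neg (w' ! j) # w' @ [neg (w' ! j)]))"
      by (intro sum_mono pair)
    also have "\<dots> = p ^ (2 * t) * (\<Sum>w'\<in>Sn. walk_prod f (neg (w' ! j) # w' @ [neg (w' ! j)]))"
      by (simp only: sum_distrib_left)
    also have "\<dots> \<le> p ^ (2 * t) * (\<Sum>x\<in>?L. mpow ?L f t (neg x) x * mpow ?L f t x (neg x))"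
      unfolding Sn_def t_def using p0 f0 by (intro mult_left_mono sum_closed_walks) auto
    also have "\<dots> \<le> p ^ (2 * t) * (\<Sum>x\<in>?L. (4000 * (c ^ t / real (card ?L))) * (4000 * (c ^ t / real (card ?L))))"
    proof (intro mult_left_mono sum_mono mult_mono bound)
      show "0 \<le> 4000 * (c ^ t / real (card ?L))" using c by simp
      show "0 \<le> mpow ?L f t x (neg x)" for x by (intro mpow_nonneg f0)
    qed (use p0 in simp_all)
    also have "\<dots> = p ^ (2 * t) * Z"
    proof -
      have "(\<Sum>x\<in>?L. (4000 * (c ^ t / real (card ?L))) * (4000 * (c ^ t / real (card ?L)))) =
          2 * real n * ((4000 * (c ^ t / (2 * real n))) * (4000 * (c ^ t / (2 * real n))))" by simp
      also have "\<dots> = Z" using n1 unfolding Z_def power2_eq_square by simp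
      finally show ?thesis by (simp only:)
    qed
    finally show ?thesis .
  qed
  \<comment> \<open>\<open>X / 2\<close> bounds the first moment from below, and
    \<open>X * Z\<close> the second from above. A snake has 2t clauses but only 2t - 1 free
    literals, so X is of order c^(2t) / n.\<close>
  define X where "X = real (card Sn) * p ^ (2 * t)"
  have X: "X \<ge> (c ^ t)\<^sup>2 / (4 * real n)"
  proof -
    have "2 * (2 * j + 1)\<^sup>2 \<le> n"
    proof -
      have "2 * (2 * j + 1)\<^sup>2 \<le> 1000 * t\<^sup>2" by (simp add: t_def power2_eq_square algebra_simps)
      then show ?thesis using tn by linarith
    qed
    then have "(2 * real n) ^ (2 * j + 1) / 2 \<le> real (card Sn)"
      unfolding Sn_def by (intro card_var_distinct_ge_half) auto
    then have "(2 * real n) ^ (2 * j + 1) / 2 * p ^ (2 * t) \<le> X"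
      unfolding X_def using p0 by (intro mult_right_mono) auto
    also have "(2 * real n) ^ (2 * j + 1) / 2 * p ^ (2 * t) = ((2 * real n) * p) ^ (2 * t) / (4 * real n)"
    proof -
      have "(2 * real n) ^ (2 * t) = (2 * real n) ^ (2 * j + 1) * (2 * real n)" by (simp add: t_def)
      then have "((2 * real n) * p) ^ (2 * t) = (2 * real n) ^ (2 * j + 1) * (2 * real n) * p ^ (2 * t)"
        by (simp only: power_mult_distrib[of "2 * real n" p])
      then show ?thesis using n1 by simp
    qed
    also have "(2 * real n) * p = c" using cp by simp
    also have "c ^ (2 * t) = (c ^ t)\<^sup>2" by (subst mult.commute) (rule power_mult)
    finally show ?thesis .
  qed
  have cpos: "c ^ t > 0" using c by simp
  have Xpos: "X > 0"
  proof (rule less_le_trans[OF _ X])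
    show "0 < (c ^ t)\<^sup>2 / (4 * real n)" using zero_less_power[OF cpos, of 2] n1 by (intro divide_pos_pos) simp_all
  qed
  have "(X / 2)\<^sup>2 \<le> (\<Sum>w\<in>Sn. P (A w))\<^sup>2"
  proof (intro power_mono)
    have "X / 2 = (\<Sum>w\<in>Sn. p ^ (2 * t) / 2)" by (simp only: X_def sum_constant times_divide_eq_right)
    also have "\<dots> \<le> (\<Sum>w\<in>Sn. P (A w))" by (intro sum_mono low)
    finally show "X / 2 \<le> (\<Sum>w\<in>Sn. P (A w))" .
  qed (use Xpos in simp)
  also have "\<dots> \<le> P (\<Union>w\<in>Sn. A w) * (\<Sum>w\<in>Sn. \<Sum>w'\<in>Sn. P (A w \<inter> A w'))"
    unfolding P_def by (rule chung_erdos) (simp add: Sn_def)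
  also have "\<dots> \<le> P (\<Union>w\<in>Sn. A w) * (\<Sum>w\<in>Sn. p ^ (2 * t) * Z)"
    by (intro mult_left_mono sum_mono high P0)
  also have "\<dots> = X * (P (\<Union>w\<in>Sn. A w) * Z)" by (simp only: X_def sum_constant mult_ac)
  finally have "X * (X / 4) \<le> X * (P (\<Union>w\<in>Sn. A w) * Z)" by (simp add: power2_eq_square)
  then have "X / 4 \<le> P (\<Union>w\<in>Sn. A w) * Z" using Xpos by (simp only: mult_le_cancel_left_pos)
  then have XP: "X \<le> 4 * (P (\<Union>w\<in>Sn. A w) * Z)" by linarith
  \<comment> \<open>In units of \<open>Q\<close>, X \<ge> Q / 4 and Z = 8000000 Q; so c^t cancels,
    and X / (4 Z) is at least 1 / 128000000.\<close>
  define Q where "Q = (c ^ t)\<^sup>2 / real n"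
  have Q: "(c ^ t)\<^sup>2 / (4 * real n) = Q / 4" "Z = Q * 8000000" by (simp_all add: Q_def Z_def)
  have Qpos: "Q > 0" unfolding Q_def using zero_less_power[OF cpos, of 2] n1 by (intro divide_pos_pos) simp_all
  have "Q / 4 \<le> 4 * (P (\<Union>w\<in>Sn. A w) * (Q * 8000000))"
    using X XP unfolding Q by (rule order_trans)
  then have "Q * (1 / 4) \<le> Q * (P (\<Union>w\<in>Sn. A w) * 32000000)" by (simp add: mult_ac)
  then have "1 / 4 \<le> P (\<Union>w\<in>Sn. A w) * 32000000" using Qpos by (simp only: mult_le_cancel_left_pos)
  then have "1 / 128000000 \<le> P (\<Union>w\<in>Sn. A w)" by simp
  also have "P (\<Union>w\<in>Sn. A w) \<le> P {F. \<not> satisfiable F}"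
  proof -
    have "(\<Union>w\<in>Sn. A w) \<subseteq> {F. \<not> satisfiable F}"
    proof (intro UN_least subsetI CollectI)
      fix w F assume w: "w \<in> Sn" and "F \<in> A w"
      then have "set (bicycle w j (neg (w ! j))) \<subseteq> set F" by (simp only: A_def cl_def mem_Collect_eq)
      then show "\<not> satisfiable F" by (rule unsat_closed_bicycle) (simp add: len(1)[OF w])
    qed
    then show ?thesis unfolding P_def by (intro measure_pmf.finite_measure_mono) auto
  qed
  finally show ?thesis by (simp add: P_def)
qed

lemma prob_satisfiable_2SAT_le:
  "\<forall>\<^sub>F n in sequentially.
     measure_pmf.prob (random_formula 2 n (nat \<lfloor>11 / 10 * real n\<rfloor>)) {F. satisfiable F} \<le> 1 - 1 / 128000000"
proof -
  \<comment> \<open>\<open>Suc (j n)\<close> is the half-length t, chosen above the logarithm of 2n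
    to base 1.05. The outer \<open>Suc\<close> ensures \<open>j n \<ge> 1\<close>; with rounding, t
    stays below that logarithm plus 3.\<close>
  define j where "j = (\<lambda>n. Suc (nat \<lceil>ln (2 * real n) / ln (105 / 100)\<rceil>))"
  have l: "ln (105 / 100 :: real) > 0" by simp
  have "\<forall>\<^sub>F n in sequentially. 1000 * (ln (2 * real n) / ln (105 / 100) + 3)\<^sup>2 \<le> real n"
    by real_asymp
  moreover have "\<forall>\<^sub>F n in sequentially. n \<ge> (21 :: nat)" by (rule eventually_ge_at_top)
  ultimately show ?thesis
  proof eventually_elim
    case (elim n)
    define m where "m = nat \<lfloor>11 / 10 * real n\<rfloor>"
    define c where "c = real m / (real n - 1)"
    define x where "x = ln (2 * real n) / ln (105 / 100)"
    have x0: "x \<ge> 0" using elim(2) l by (simp add: x_def)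
    have j: "j n = Suc (nat \<lceil>x\<rceil>)" by (simp only: j_def x_def)
    have "real (nat \<lceil>x\<rceil>) = of_int \<lceil>x\<rceil>" using x0 by simp
    then have jx: "x \<le> real (j n)" "real (Suc (j n)) \<le> x + 3"
      unfolding j of_nat_Suc by linarith+
    define y where "y = 11 / 10 * real n"
    have "real (nat \<lfloor>y\<rfloor>) = of_int \<lfloor>y\<rfloor>" by (simp add: y_def)
    then have "real (nat \<lfloor>y\<rfloor>) \<le> y" "real (nat \<lfloor>y\<rfloor>) \<ge> y - 1" by linarith+
    then have m: "real m \<le> 11 / 10 * real n" "real m \<ge> 11 / 10 * real n - 1"
      by (simp_all only: m_def y_def)
    have c: "105 / 100 \<le> c" "c \<le> 12 / 10" using m elim(2) by (auto simp: c_def field_simps)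
    have "2 * real n = exp (ln (105 / 100) * x)" using elim(2) l by (simp add: x_def)
    also have "\<dots> \<le> exp (ln (105 / 100) * real (Suc (j n)))" using jx l by (auto intro!: mult_left_mono)
    also have "\<dots> = (105 / 100) ^ Suc (j n)" by (subst mult.commute) (simp only: exp_of_nat_mult, simp)
    also have "\<dots> \<le> c ^ Suc (j n)" using c by (intro power_mono) auto
    finally have big: "2 * real n \<le> c ^ Suc (j n)" .
    have "real (1000 * (Suc (j n))\<^sup>2) \<le> 1000 * (x + 3)\<^sup>2"
      using jx power_mono[OF jx(2), of 2] by simp
    also have "\<dots> \<le> real n" using elim(1) by (simp add: x_def)
    finally have tn: "1000 * (Suc (j n))\<^sup>2 \<le> n" by (simp only: of_nat_le_iff)
    have "measure_pmf.prob (random_formula 2 n m) {F. \<not> satisfiable F} \<ge> 1 / 128000000"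
      using prob_unsat_2SAT_ge[of "j n" n m] elim(2) tn c big unfolding c_def by (simp add: j_def)
    moreover have "measure_pmf.prob (random_formula 2 n m) {F. satisfiable F} =
        1 - measure_pmf.prob (random_formula 2 n m) {F. \<not> satisfiable F}"
      using measure_pmf.prob_compl[of "{F. \<not> satisfiable F}" "random_formula 2 n m"]
      by (simp add: Compl_eq_Diff_UNIV[symmetric] Collect_neg_eq[symmetric])
    ultimately show ?case by (simp add: m_def)
  qed
qed

theorem theorem1:
  fixes k :: nat and r :: "nat \<Rightarrow> real"
  assumes "k \<ge> 2" and "sat_threshold k r"
  shows "\<exists>(\<epsilon>::real) (l::nat) (R::choice_rule).
           \<epsilon> > 0 \<and> l > 0 \<and> achlioptas_rule l R \<and>
           (\<lambda>n. measure_pmf.prob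
                  (achlioptas_formula k l R n (nat \<lfloor>(r n + \<epsilon>) * real n\<rfloor>))
                  {F. satisfiable F}) \<longlonglongrightarrow> 1 \<and>
           (k \<ge> 7 \<longrightarrow> l = 3) \<and> (3 \<le> k \<and> k \<le> 6 \<longrightarrow> l = 5) \<and> (k = 2 \<longrightarrow> l = 2)"
proof -
  define l where "l = (if k = 2 then 2 else if k \<ge> 7 then 3 else 5 :: nat)"
  have "\<exists>\<epsilon>>0. (\<lambda>n. measure_pmf.prob
      (achlioptas_formula k l best_rule n (nat \<lfloor>(r n + \<epsilon>) * real n\<rfloor>)) {F. satisfiable F}) \<longlonglongrightarrow> 1"
  proof (cases "k = 2")
    case True
    \<comment> \<open>The slack 1/50 gives 112/100, which stays below the density 115/100 reached in
      \<open>shift_two\<close>.\<close>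
    have "\<forall>\<^sub>F n in sequentially. r n < 11 / 10 + 1 / 50"
      using assms(2) prob_satisfiable_2SAT_le unfolding True
      by (intro sat_threshold_upper_bound[where k = 2 and \<theta> = "1 / 128000000"]) auto
    then have "\<forall>\<^sub>F n in sequentially. r n < 112 / 100" by simp
    then show ?thesis using shift_two True by (simp add: l_def)
  next
    case False
    then show ?thesis using assms by (intro shift_large_k) (auto simp: l_def)
  qed
  then obtain \<epsilon> where "\<epsilon> > 0" "(\<lambda>n. measure_pmf.prob
      (achlioptas_formula k l best_rule n (nat \<lfloor>(r n + \<epsilon>) * real n\<rfloor>)) {F. satisfiable F}) \<longlonglongrightarrow> 1"
    by blast
  moreover have "l > 0" by (simp add: l_def)
  moreover have "(k \<ge> 7 \<longrightarrow> l = 3) \<and> (3 \<le> k \<and> k \<le> 6 \<longrightarrow> l = 5) \<and> (k = 2 \<longrightarrow> l = 2)"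
    by (simp add: l_def)
  ultimately show ?thesis using achlioptas_best_rule[of l] by blast
qed

end
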